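(* Let $\mathcal{C}$ be a small coherent category and $M:\mathcal{C}\to\mathbf{Set}$ a coherent functor. Then the distributive lattice $LM$ is computed as follows. Its underlying set is $$\Big(\bigsqcup_{x\in\mathcal{C},\ a\in Mx}Sub_{\mathcal{C}}(x)\Big)\Big/\sim,$$ where, writing $(u\hookrightarrow x)^a$ for the element $u\hookrightarrow x$ of the summand indexed by $a\in Mx$, we have $(u\hookrightarrow x)^a\sim(v\hookrightarrow y)^b$ iff there exists a subobject $\varphi\hookrightarrow x\times y$ such that $(a,b)\in M\varphi$ and $\varphi\cap(u\times y)=\varphi\cap(x\times v)$. One has $(u\hookrightarrow x)^a\sim(u\times y\hookrightarrow x\times y)^{(a,b)}$ for any $y\in\mathcal{C}$ and $b\in My$, therefore any two elements of $LM$ have representatives in a common summand $Sub_{\mathcal{C}}(x)^a$, and the lattice operations are defined through these representatives. Moreover, given a coherent functor $F:\mathcal{C}\to\mathcal{D}$, a coherent functor $N:\mathcal{D}\to\mathbf{Set}$ and a natural transformation $\eta_F:M\Rightarrow NF$, the induced map $$L\eta_F:\Big(\bigsqcup_{a\in Mx}Sub_{\mathcal{C}}(x)\Big)\Big/\sim\ \longrightarrow\ \Big(\bigsqcup_{b\in Ny}Sub_{\mathcal{D}}(y)\Big)\Big/\sim$$ takes the equivalence class of $(u\hookrightarrow x)^a$ to that of $(Fu\hookrightarrow Fx)^{\eta_{F,x}(a)}$.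
   Context: $\mathbf{DLat}$ is the category of (bounded) distributive lattices; $Sub_{\mathcal{C}}:\mathcal{C}^{op}\to\mathbf{DLat}$ sends $x$ to its lattice of subobjects and $f$ to pullback $f^*$. For a coherent functor $M:\mathcal{C}\to\mathbf{Set}$, $LM=\mathrm{colim}\big((\int M)^{op}\to\mathcal{C}^{op}\xrightarrow{Sub_{\mathcal{C}}}\mathbf{DLat}\big)$, where $\int M$ is the category of elements (objects $(x,a)$ with $a\in Mx$; arrows $(x,a)\to(y,b)$ are $f:x\to y$ with $Mf(a)=b$). Write $Sub_{\mathcal{C}}(x)^a$ for the copy of $Sub_{\mathcal{C}}(x)$ at $(x,a)$. For a pair $(F:\mathcal{C}\to\mathcal{D},\eta_F:M\Rightarrow NF)$ with $\mathcal{D}$ a small coherent category, the map $L\eta_F:LM\to LN$ is the one induced by the composites $Sub_{\mathcal{C}}(x)^a\xrightarrow{F}Sub_{\mathcal{D}}(Fx)^{\eta_{F,x}(a)}\to LN$, the last map being the colimit cocone map. *)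

theory Defs
  imports "HOL-Algebra.Lattice" "HOL-Library.FuncSet"
begin

section \<open>Categories, functors, limits\<close>

text \<open>A small category is given by sets of objects and arrows; \<open>g \<cdot>\<^bsub>C\<^esub> f\<close> is
  ``first \<open>f\<close>, then \<open>g\<close>'', and is unconstrained unless \<open>Dom C g = Cod C f\<close>.\<close>

record ('o, 'm) cat =
  Ob :: "'o set"
  Ar :: "'m set"
  Dom :: "'m \<Rightarrow> 'o"
  Cod :: "'m \<Rightarrow> 'o"
  Idn :: "'o \<Rightarrow> 'm"
  Cmp :: "'m \<Rightarrow> 'm \<Rightarrow> 'm"  (infixl "\<cdot>\<index>" 75)

definition Hom :: "('o, 'm) cat \<Rightarrow> 'o \<Rightarrow> 'o \<Rightarrow> 'm set" where
  "Hom C x y = {f \<in> Ar C. Dom C f = x \<and> Cod C f = y}"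

definition category :: "('o, 'm) cat \<Rightarrow> bool" where
  "category C \<longleftrightarrow>
     (\<forall>f\<in>Ar C. Dom C f \<in> Ob C \<and> Cod C f \<in> Ob C) \<and>
     (\<forall>x\<in>Ob C. Idn C x \<in> Hom C x x) \<and>
     (\<forall>f\<in>Ar C. \<forall>g\<in>Ar C. Dom C g = Cod C f \<longrightarrow> g \<cdot>\<^bsub>C\<^esub> f \<in> Hom C (Dom C f) (Cod C g)) \<and>
     (\<forall>f\<in>Ar C. f \<cdot>\<^bsub>C\<^esub> Idn C (Dom C f) = f \<and> Idn C (Cod C f) \<cdot>\<^bsub>C\<^esub> f = f) \<and>
     (\<forall>f\<in>Ar C. \<forall>g\<in>Ar C. \<forall>h\<in>Ar C. Dom C g = Cod C f \<longrightarrow> Dom C h = Cod C g \<longrightarrow>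
        (h \<cdot>\<^bsub>C\<^esub> g) \<cdot>\<^bsub>C\<^esub> f = h \<cdot>\<^bsub>C\<^esub> (g \<cdot>\<^bsub>C\<^esub> f))"

definition op_cat :: "('o, 'm) cat \<Rightarrow> ('o, 'm) cat" where
  "op_cat C = \<lparr>Ob = Ob C, Ar = Ar C, Dom = Cod C, Cod = Dom C, Idn = Idn C,
     Cmp = (\<lambda>g f. f \<cdot>\<^bsub>C\<^esub> g)\<rparr>"

record ('o, 'm, 'p, 'n) func =
  fo :: "'o \<Rightarrow> 'p"
  fa :: "'m \<Rightarrow> 'n"

definition is_functor :: "('o, 'm) cat \<Rightarrow> ('p, 'n) cat \<Rightarrow> ('o, 'm, 'p, 'n) func \<Rightarrow> bool" where
  "is_functor C D F \<longleftrightarrow> category C \<and> category D \<and>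
     (\<forall>x\<in>Ob C. fo F x \<in> Ob D) \<and>
     (\<forall>f\<in>Ar C. fa F f \<in> Hom D (fo F (Dom C f)) (fo F (Cod C f))) \<and>
     (\<forall>x\<in>Ob C. fa F (Idn C x) = Idn D (fo F x)) \<and>
     (\<forall>f\<in>Ar C. \<forall>g\<in>Ar C. Dom C g = Cod C f \<longrightarrow> fa F (g \<cdot>\<^bsub>C\<^esub> f) = fa F g \<cdot>\<^bsub>D\<^esub> fa F f)"

definition fcomp ::
  "('p, 'n, 'q, 'k) func \<Rightarrow> ('o, 'm, 'p, 'n) func \<Rightarrow> ('o, 'm, 'q, 'k) func" where
  "fcomp G F = \<lparr>fo = fo G \<circ> fo F, fa = fa G \<circ> fa F\<rparr>"

definition nat_trans ::
  "('o, 'm) cat \<Rightarrow> ('p, 'n) cat \<Rightarrow> ('o, 'm, 'p, 'n) func \<Rightarrow> ('o, 'm, 'p, 'n) func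
    \<Rightarrow> ('o \<Rightarrow> 'n) \<Rightarrow> bool" where
  "nat_trans C D F G \<eta> \<longleftrightarrow> is_functor C D F \<and> is_functor C D G \<and>
     (\<forall>x\<in>Ob C. \<eta> x \<in> Hom D (fo F x) (fo G x)) \<and>
     (\<forall>f\<in>Ar C. \<eta> (Cod C f) \<cdot>\<^bsub>D\<^esub> fa F f = fa G f \<cdot>\<^bsub>D\<^esub> \<eta> (Dom C f))"

definition is_cone ::
  "('o, 'm) cat \<Rightarrow> ('i, 'j) cat \<Rightarrow> ('i, 'j, 'o, 'm) func \<Rightarrow> 'o \<Rightarrow> ('i \<Rightarrow> 'm) \<Rightarrow> bool" where
  "is_cone C J T l \<pi> \<longleftrightarrow> l \<in> Ob C \<and>
     (\<forall>i\<in>Ob J. \<pi> i \<in> Hom C l (fo T i)) \<and>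
     (\<forall>j\<in>Ar J. fa T j \<cdot>\<^bsub>C\<^esub> \<pi> (Dom J j) = \<pi> (Cod J j))"

definition is_limit ::
  "('o, 'm) cat \<Rightarrow> ('i, 'j) cat \<Rightarrow> ('i, 'j, 'o, 'm) func \<Rightarrow> 'o \<Rightarrow> ('i \<Rightarrow> 'm) \<Rightarrow> bool" where
  "is_limit C J T l \<pi> \<longleftrightarrow> is_cone C J T l \<pi> \<and>
     (\<forall>z \<kappa>. is_cone C J T z \<kappa> \<longrightarrow> (\<exists>!h. h \<in> Hom C z l \<and> (\<forall>i\<in>Ob J. \<pi> i \<cdot>\<^bsub>C\<^esub> h = \<kappa> i)))"

definition finite_category :: "('i, 'j) cat \<Rightarrow> bool" where
  "finite_category J \<longleftrightarrow> category J \<and> finite (Ob J) \<and> finite (Ar J)"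

text \<open>Every finite category is isomorphic to one whose objects and arrows are natural numbers,
  so shapes of type \<^typ>\<open>(nat, nat) cat\<close> account for all finite diagrams.\<close>

definition has_finite_limits :: "('o, 'm) cat \<Rightarrow> bool" where
  "has_finite_limits C \<longleftrightarrow>
     (\<forall>(J :: (nat, nat) cat) T. finite_category J \<and> is_functor J C T \<longrightarrow> (\<exists>l \<pi>. is_limit C J T l \<pi>))"

definition preserves_finite_limits ::
  "('o, 'm) cat \<Rightarrow> ('p, 'n) cat \<Rightarrow> ('o, 'm, 'p, 'n) func \<Rightarrow> bool" where
  "preserves_finite_limits C D F \<longleftrightarrow>
     (\<forall>(J :: (nat, nat) cat) T l \<pi>.
        finite_category J \<and> is_functor J C T \<and> is_limit C J T l \<pi> \<longrightarrow>
        is_limit D J (fcomp F T) (fo F l) (fa F \<circ> \<pi>))"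

definition is_product :: "('o, 'm) cat \<Rightarrow> 'o \<Rightarrow> 'o \<Rightarrow> 'o \<Rightarrow> 'm \<Rightarrow> 'm \<Rightarrow> bool" where
  "is_product C x y P p q \<longleftrightarrow> P \<in> Ob C \<and> p \<in> Hom C P x \<and> q \<in> Hom C P y \<and>
     (\<forall>z\<in>Ob C. \<forall>f\<in>Hom C z x. \<forall>g\<in>Hom C z y.
        \<exists>!h. h \<in> Hom C z P \<and> p \<cdot>\<^bsub>C\<^esub> h = f \<and> q \<cdot>\<^bsub>C\<^esub> h = g)"

text \<open>\<open>is_pullback C f v w q\<close>: the square \<open>f \<cdot> w = v \<cdot> q\<close> is a pullback, i.e. \<open>w\<close> is a pullback
  of \<open>v\<close> along \<open>f\<close>.\<close>

definition is_pullback :: "('o, 'm) cat \<Rightarrow> 'm \<Rightarrow> 'm \<Rightarrow> 'm \<Rightarrow> 'm \<Rightarrow> bool" where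
  "is_pullback C f v w q \<longleftrightarrow>
     f \<in> Ar C \<and> v \<in> Ar C \<and> w \<in> Ar C \<and> q \<in> Ar C \<and>
     Cod C f = Cod C v \<and> Dom C w = Dom C q \<and> Cod C w = Dom C f \<and> Cod C q = Dom C v \<and>
     f \<cdot>\<^bsub>C\<^esub> w = v \<cdot>\<^bsub>C\<^esub> q \<and>
     (\<forall>z\<in>Ob C. \<forall>s\<in>Hom C z (Dom C f). \<forall>t\<in>Hom C z (Dom C v). f \<cdot>\<^bsub>C\<^esub> s = v \<cdot>\<^bsub>C\<^esub> t \<longrightarrow>
        (\<exists>!h. h \<in> Hom C z (Dom C w) \<and> w \<cdot>\<^bsub>C\<^esub> h = s \<and> q \<cdot>\<^bsub>C\<^esub> h = t))"


section \<open>Subobjects\<close>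

definition mono :: "('o, 'm) cat \<Rightarrow> 'm \<Rightarrow> bool" where
  "mono C u \<longleftrightarrow> u \<in> Ar C \<and>
     (\<forall>z\<in>Ob C. \<forall>g\<in>Hom C z (Dom C u). \<forall>h\<in>Hom C z (Dom C u). u \<cdot>\<^bsub>C\<^esub> g = u \<cdot>\<^bsub>C\<^esub> h \<longrightarrow> g = h)"

definition factors :: "('o, 'm) cat \<Rightarrow> 'm \<Rightarrow> 'm \<Rightarrow> bool" where
  "factors C f v \<longleftrightarrow> (\<exists>g\<in>Hom C (Dom C f) (Dom C v). f = v \<cdot>\<^bsub>C\<^esub> g)"

definition monos_into :: "('o, 'm) cat \<Rightarrow> 'o \<Rightarrow> 'm set" where
  "monos_into C x = {u. mono C u \<and> Cod C u = x}"

definition subobj_rel :: "('o, 'm) cat \<Rightarrow> 'o \<Rightarrow> 'm rel" where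
  "subobj_rel C x =
     {(u, v). u \<in> monos_into C x \<and> v \<in> monos_into C x \<and> factors C u v \<and> factors C v u}"

text \<open>A subobject is an isomorphism class of monomorphisms.\<close>

definition Sub :: "('o, 'm) cat \<Rightarrow> 'o \<Rightarrow> 'm set gorder" where
  "Sub C x = \<lparr>carrier = monos_into C x // subobj_rel C x, eq = (=),
     le = (\<lambda>U V. \<exists>u\<in>U. \<exists>v\<in>V. factors C u v)\<rparr>"

text \<open>The set of all pullbacks of representatives is again a full isomorphism class.\<close>

definition sub_pullback :: "('o, 'm) cat \<Rightarrow> 'm \<Rightarrow> 'm set \<Rightarrow> 'm set" where
  "sub_pullback C f V = {w. \<exists>v\<in>V. \<exists>q. is_pullback C f v w q}"

definition sub_image :: "('p, 'n) cat \<Rightarrow> ('o, 'm, 'p, 'n) func \<Rightarrow> 'm set \<Rightarrow> 'n set" where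
  "sub_image D F U = (\<Union>u\<in>U. subobj_rel D (Cod D (fa F u)) `` {fa F u})"

text \<open>\<open>sub_prod C P p q U V\<close> is the subobject \<open>u \<times> v\<close> of the product \<open>P\<close> (with projections
  \<open>p\<close>, \<open>q\<close>), for all choices of representatives and of the product of their domains.\<close>

definition sub_prod ::
  "('o, 'm) cat \<Rightarrow> 'o \<Rightarrow> 'm \<Rightarrow> 'm \<Rightarrow> 'm set \<Rightarrow> 'm set \<Rightarrow> 'm set" where
  "sub_prod C P p q U V =
     {w. \<exists>u\<in>U. \<exists>v\<in>V. \<exists>Q p' q'. is_product C (Dom C u) (Dom C v) Q p' q' \<and> w \<in> Hom C Q P \<and>
          p \<cdot>\<^bsub>C\<^esub> w = u \<cdot>\<^bsub>C\<^esub> p' \<and> q \<cdot>\<^bsub>C\<^esub> w = v \<cdot>\<^bsub>C\<^esub> q'}"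

definition full_sub :: "('o, 'm) cat \<Rightarrow> 'o \<Rightarrow> 'm set" where
  "full_sub C x = subobj_rel C x `` {Idn C x}"


section \<open>Coherent categories and coherent functors\<close>

definition is_image :: "('o, 'm) cat \<Rightarrow> 'm \<Rightarrow> 'm set \<Rightarrow> bool" where
  "is_image C f I \<longleftrightarrow> f \<in> Ar C \<and>
     least (Sub C (Cod C f)) I {V \<in> carrier (Sub C (Cod C f)). \<exists>v\<in>V. factors C f v}"

definition is_union :: "('o, 'm) cat \<Rightarrow> 'o \<Rightarrow> 'm set set \<Rightarrow> 'm set \<Rightarrow> bool" where
  "is_union C x A W \<longleftrightarrow> x \<in> Ob C \<and> A \<subseteq> carrier (Sub C x) \<and> finite A \<and>
     least (Sub C x) W (Upper (Sub C x) A)"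

text \<open>Finite limits, pullback-stable images and pullback-stable finite (including empty) unions.\<close>

definition coherent_category :: "('o, 'm) cat \<Rightarrow> bool" where
  "coherent_category C \<longleftrightarrow> category C \<and> has_finite_limits C \<and>
     (\<forall>f\<in>Ar C. \<exists>I. is_image C f I) \<and>
     (\<forall>f g f' q I. is_pullback C g f f' q \<and> is_image C f I \<longrightarrow> is_image C f' (sub_pullback C g I)) \<and>
     (\<forall>x\<in>Ob C. \<forall>A. A \<subseteq> carrier (Sub C x) \<and> finite A \<longrightarrow> (\<exists>W. is_union C x A W)) \<and>
     (\<forall>f\<in>Ar C. \<forall>A W. is_union C (Cod C f) A W \<longrightarrow>
        is_union C (Dom C f) (sub_pullback C f ` A) (sub_pullback C f W))"

text \<open>The codomain is only required to be a category, since the category of subsets of a finite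
  type (see \<open>SetCat\<close>) lacks products.\<close>

definition coherent_functor ::
  "('o, 'm) cat \<Rightarrow> ('p, 'n) cat \<Rightarrow> ('o, 'm, 'p, 'n) func \<Rightarrow> bool" where
  "coherent_functor C D F \<longleftrightarrow> is_functor C D F \<and> preserves_finite_limits C D F \<and>
     (\<forall>f I. is_image C f I \<longrightarrow> is_image D (fa F f) (sub_image D F I)) \<and>
     (\<forall>x A W. is_union C x A W \<longrightarrow> is_union D (fo F x) (sub_image D F ` A) (sub_image D F W))"


section \<open>Sets and bounded distributive lattices\<close>

text \<open>Concrete arrows are triples of a domain, an extensional function and a codomain.\<close>

definition app :: "'a \<times> ('s \<Rightarrow> 't) \<times> 'b \<Rightarrow> 's \<Rightarrow> 't" where
  "app f = fst (snd f)"

text \<open>The sets are the subsets of an arbitrary type \<open>'s\<close>. A functor from a small category to sets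
  involves only a set of sets, hence factors through \<open>SetCat\<close> for a suitable \<open>'s\<close>; whether a cone,
  an image or a union in \<open>SetCat\<close> is one among all sets can be tested on subsets of \<open>'s\<close>.\<close>

definition SetCat :: "('s set, 's set \<times> ('s \<Rightarrow> 's) \<times> 's set) cat" where
  "SetCat = \<lparr>Ob = UNIV, Ar = {(A, f, B). f \<in> A \<rightarrow>\<^sub>E B},
     Dom = fst, Cod = snd \<circ> snd,
     Idn = (\<lambda>A. (A, \<lambda>a\<in>A. a, A)),
     Cmp = (\<lambda>g f. (fst f, compose (fst f) (app g) (app f), snd (snd g)))\<rparr>"

type_synonym ('o, 'm, 's) set_func = "('o, 'm, 's set, 's set \<times> ('s \<Rightarrow> 's) \<times> 's set) func"

definition distributive_lattice :: "'l gorder \<Rightarrow> bool" where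
  "distributive_lattice L \<longleftrightarrow> bounded_lattice L \<and>
     (\<forall>x\<in>carrier L. \<forall>y\<in>carrier L. \<forall>z\<in>carrier L.
        x \<sqinter>\<^bsub>L\<^esub> (y \<squnion>\<^bsub>L\<^esub> z) = (x \<sqinter>\<^bsub>L\<^esub> y) \<squnion>\<^bsub>L\<^esub> (x \<sqinter>\<^bsub>L\<^esub> z))"

definition dlat_hom :: "'l gorder \<Rightarrow> 'k gorder \<Rightarrow> ('l \<Rightarrow> 'k) set" where
  "dlat_hom L K = {h \<in> carrier L \<rightarrow>\<^sub>E carrier K. meet_pres L K h \<and> join_pres L K h \<and>
     h \<top>\<^bsub>L\<^esub> = \<top>\<^bsub>K\<^esub> \<and> h \<bottom>\<^bsub>L\<^esub> = \<bottom>\<^bsub>K\<^esub>}"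

definition DLat :: "('l gorder, 'l gorder \<times> ('l \<Rightarrow> 'l) \<times> 'l gorder) cat" where
  "DLat = \<lparr>Ob = {L. distributive_lattice L},
     Ar = {(L, h, K). distributive_lattice L \<and> distributive_lattice K \<and> h \<in> dlat_hom L K},
     Dom = fst, Cod = snd \<circ> snd,
     Idn = (\<lambda>L. (L, \<lambda>u\<in>carrier L. u, L)),
     Cmp = (\<lambda>g f. (fst f, compose (carrier (fst f)) (app g) (app f), snd (snd g)))\<rparr>"

type_synonym ('i, 'j, 'l) dlat_func = "('i, 'j, 'l gorder, 'l gorder \<times> ('l \<Rightarrow> 'l) \<times> 'l gorder) func"

text \<open>Cocones under a diagram of lattices on a type \<open>'l\<close> may have a vertex on any type \<open>'k\<close>.\<close>

definition dlat_cocone ::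
  "('i, 'j) cat \<Rightarrow> ('i, 'j, 'l) dlat_func \<Rightarrow> 'k gorder \<Rightarrow> ('i \<Rightarrow> 'l \<Rightarrow> 'k) \<Rightarrow> bool" where
  "dlat_cocone J T E \<kappa> \<longleftrightarrow> distributive_lattice E \<and>
     (\<forall>i\<in>Ob J. \<kappa> i \<in> dlat_hom (fo T i) E) \<and>
     (\<forall>j\<in>Ar J. compose (carrier (fo T (Dom J j))) (\<kappa> (Cod J j)) (app (fa T j)) = \<kappa> (Dom J j))"

definition mediating ::
  "('i, 'j) cat \<Rightarrow> ('i, 'j, 'l) dlat_func \<Rightarrow> 'k gorder \<Rightarrow> ('i \<Rightarrow> 'l \<Rightarrow> 'k)
    \<Rightarrow> 'd gorder \<Rightarrow> ('i \<Rightarrow> 'l \<Rightarrow> 'd) \<Rightarrow> ('k \<Rightarrow> 'd) \<Rightarrow> bool" where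
  "mediating J T L \<iota> E \<kappa> h \<longleftrightarrow> h \<in> dlat_hom L E \<and>
     (\<forall>i\<in>Ob J. compose (carrier (fo T i)) h (\<iota> i) = \<kappa> i)"

text \<open>Universality is tested against lattices on the type \<open>'d\<close>; a claim about all lattices is
  obtained by leaving \<open>'d\<close> arbitrary.\<close>

definition dlat_colimit ::
  "'d itself \<Rightarrow> ('i, 'j) cat \<Rightarrow> ('i, 'j, 'l) dlat_func \<Rightarrow> 'k gorder \<Rightarrow> ('i \<Rightarrow> 'l \<Rightarrow> 'k) \<Rightarrow> bool" where
  "dlat_colimit _ J T L \<iota> \<longleftrightarrow> is_functor J DLat T \<and> dlat_cocone J T L \<iota> \<and>
     (\<forall>(E :: 'd gorder) \<kappa>. dlat_cocone J T E \<kappa> \<longrightarrow> (\<exists>!h. mediating J T L \<iota> E \<kappa> h))"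


section \<open>The diagram defining \<open>LM\<close>\<close>

definition elements ::
  "('o, 'm) cat \<Rightarrow> ('o, 'm, 's) set_func \<Rightarrow> ('o \<times> 's, ('o \<times> 's) \<times> 'm \<times> ('o \<times> 's)) cat" where
  "elements C M = \<lparr>Ob = {(x, a). x \<in> Ob C \<and> a \<in> fo M x},
     Ar = {((x, a), f, (y, b)). x \<in> Ob C \<and> a \<in> fo M x \<and> y \<in> Ob C \<and> b \<in> fo M y \<and>
             f \<in> Hom C x y \<and> app (fa M f) a = b},
     Dom = fst, Cod = snd \<circ> snd,
     Idn = (\<lambda>(x, a). ((x, a), Idn C x, (x, a))),
     Cmp = (\<lambda>g f. (fst f, fst (snd g) \<cdot>\<^bsub>C\<^esub> fst (snd f), snd (snd g)))\<rparr>"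

text \<open>The forgetful functor, which is the same as a functor \<open>op_cat (elements C M) \<rightarrow> op_cat C\<close>.\<close>

definition forget :: "('o \<times> 's, ('o \<times> 's) \<times> 'm \<times> ('o \<times> 's), 'o, 'm) func" where
  "forget = \<lparr>fo = fst, fa = fst \<circ> snd\<rparr>"

definition SubF :: "('o, 'm) cat \<Rightarrow> ('o, 'm, 'm set) dlat_func" where
  "SubF C = \<lparr>fo = Sub C,
     fa = (\<lambda>f. (Sub C (Cod C f), \<lambda>V\<in>carrier (Sub C (Cod C f)). sub_pullback C f V,
                Sub C (Dom C f)))\<rparr>"

abbreviation L_shape ::
  "('o, 'm) cat \<Rightarrow> ('o, 'm, 's) set_func \<Rightarrow> ('o \<times> 's, ('o \<times> 's) \<times> 'm \<times> ('o \<times> 's)) cat" where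
  "L_shape C M \<equiv> op_cat (elements C M)"

abbreviation L_diagram ::
  "('o, 'm) cat \<Rightarrow> ('o \<times> 's, ('o \<times> 's) \<times> 'm \<times> ('o \<times> 's), 'm set) dlat_func" where
  "L_diagram C \<equiv> fcomp (SubF C) forget"


section \<open>The explicit description of \<open>LM\<close>\<close>

text \<open>\<open>(u \<hookrightarrow> x)\<^sup>a\<close> is encoded as \<open>((x, a), U)\<close> with \<open>U\<close> the subobject represented by \<open>u\<close>.\<close>

definition L_gens ::
  "('o, 'm) cat \<Rightarrow> ('o, 'm, 's) set_func \<Rightarrow> (('o \<times> 's) \<times> 'm set) set" where
  "L_gens C M = {((x, a), U). x \<in> Ob C \<and> a \<in> fo M x \<and> U \<in> carrier (Sub C x)}"

text \<open>\<open>c \<in> M (x \<times> y)\<close> is the element corresponding to \<open>(a, b) \<in> M x \<times> M y\<close>.\<close>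

definition is_pair ::
  "('o, 'm, 's) set_func \<Rightarrow> 'o \<Rightarrow> 'm \<Rightarrow> 'm \<Rightarrow> 's \<Rightarrow> 's \<Rightarrow> 's \<Rightarrow> bool" where
  "is_pair M P p q a b c \<longleftrightarrow> c \<in> fo M P \<and> app (fa M p) c = a \<and> app (fa M q) c = b"

definition in_sub ::
  "('o, 'm) cat \<Rightarrow> ('o, 'm, 's) set_func \<Rightarrow> 's \<Rightarrow> 'm set \<Rightarrow> bool" where
  "in_sub C M c \<Phi> \<longleftrightarrow> (\<exists>w\<in>\<Phi>. c \<in> app (fa M w) ` fo M (Dom C w))"

definition L_rel ::
  "('o, 'm) cat \<Rightarrow> ('o, 'm, 's) set_func \<Rightarrow> (('o \<times> 's) \<times> 'm set) rel" where
  "L_rel C M = {(((x, a), U), ((y, b), V)).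
     ((x, a), U) \<in> L_gens C M \<and> ((y, b), V) \<in> L_gens C M \<and>
     (\<exists>P p q c. \<exists>\<Phi>\<in>carrier (Sub C P).
        is_product C x y P p q \<and> is_pair M P p q a b c \<and> in_sub C M c \<Phi> \<and>
        \<Phi> \<sqinter>\<^bsub>Sub C P\<^esub> sub_prod C P p q U (full_sub C y) =
        \<Phi> \<sqinter>\<^bsub>Sub C P\<^esub> sub_prod C P p q (full_sub C x) V)}"

definition L_class ::
  "('o, 'm) cat \<Rightarrow> ('o, 'm, 's) set_func \<Rightarrow> 'o \<Rightarrow> 's \<Rightarrow> 'm set \<Rightarrow> (('o \<times> 's) \<times> 'm set) set" where
  "L_class C M x a U = L_rel C M `` {((x, a), U)}"

text \<open>The order is read off from representatives in a common summand.\<close>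

definition LM ::
  "('o, 'm) cat \<Rightarrow> ('o, 'm, 's) set_func \<Rightarrow> (('o \<times> 's) \<times> 'm set) set gorder" where
  "LM C M = \<lparr>carrier = L_gens C M // L_rel C M, eq = (=),
     le = (\<lambda>X Y. \<exists>x a U V. ((x, a), U) \<in> L_gens C M \<and> ((x, a), V) \<in> L_gens C M \<and>
             X = L_class C M x a U \<and> Y = L_class C M x a V \<and> U \<sqsubseteq>\<^bsub>Sub C x\<^esub> V)\<rparr>"

definition L_in ::
  "('o, 'm) cat \<Rightarrow> ('o, 'm, 's) set_func \<Rightarrow> 'o \<times> 's \<Rightarrow> 'm set \<Rightarrow> (('o \<times> 's) \<times> 'm set) set" where
  "L_in C M = (\<lambda>(x, a). \<lambda>U\<in>carrier (Sub C x). L_class C M x a U)"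

text \<open>The composites \<open>Sub C x \<rightarrow> Sub D (F x) \<rightarrow> LN\<close>, and the map they induce on the colimit.\<close>

definition L_map_cocone ::
  "('o, 'm) cat \<Rightarrow> ('p, 'n) cat \<Rightarrow> ('p, 'n, 's) set_func \<Rightarrow> ('o, 'm, 'p, 'n) func
    \<Rightarrow> ('o \<Rightarrow> 's set \<times> ('s \<Rightarrow> 's) \<times> 's set) \<Rightarrow> 'o \<times> 's \<Rightarrow> 'm set \<Rightarrow> (('p \<times> 's) \<times> 'n set) set" where
  "L_map_cocone C D N F \<eta> = (\<lambda>(x, a). \<lambda>U\<in>carrier (Sub C x).
     L_in D N (fo F x, app (\<eta> x) a) (sub_image D F U))"

definition L_map ::
  "('o, 'm) cat \<Rightarrow> ('o, 'm, 's) set_func \<Rightarrow> ('p, 'n) cat \<Rightarrow> ('p, 'n, 's) set_func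
    \<Rightarrow> ('o, 'm, 'p, 'n) func \<Rightarrow> ('o \<Rightarrow> 's set \<times> ('s \<Rightarrow> 's) \<times> 's set)
    \<Rightarrow> (('o \<times> 's) \<times> 'm set) set \<Rightarrow> (('p \<times> 's) \<times> 'n set) set" where
  "L_map C M D N F \<eta> = (THE h.
     mediating (L_shape C M) (L_diagram C) (LM C M) (L_in C M) (LM D N) (L_map_cocone C D N F \<eta>) h)"

end

theory Submission
  imports Defs
begin

text \<open>Since \<open>M\<close> preserves finite limits, its category of elements is cofiltered: two elements
  \<open>a \<in> M x\<close> and \<open>b \<in> M y\<close> are joined by a span \<open>x \<leftarrow> z \<rightarrow> y\<close> with an element of \<open>M z\<close> over both, and
  two such spans have a common refinement (\<open>span_exists\<close>, \<open>span_refine\<close>). Hence \<open>LM\<close> is a filtered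
  colimit of lattices, and such a colimit can be written down. The class of \<open>(U \<hookrightarrow> x)\<^sup>a\<close> lies below that of
  \<open>(V \<hookrightarrow> y)\<^sup>b\<close> iff \<open>f\<^sup>*U \<le> g\<^sup>*V\<close> for some span \<open>(f, g)\<close> between \<open>a\<close> and \<open>b\<close>; this is a preorder, and
  \<open>LM\<close> is the partial order it induces.

  What remains specific to the statement is that its equivalence relation, which speaks of a
  subobject \<open>\<phi>\<close> of \<open>x \<times> y\<close>, is the symmetric part of this preorder (\<open>L_rel_iff_L_le\<close>). A subobject
  \<open>\<phi>\<close> with \<open>(a, b) \<in> M \<phi>\<close> is a span by means of the two projections, and the condition
  \<open>\<phi> \<inter> (u \<times> y) = \<phi> \<inter> (x \<times> v)\<close> says that \<open>u\<close> and \<open>v\<close> have the same pullback to it. Conversely, a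
  span with apex \<open>z\<close> is replaced by the image \<open>\<phi>\<close> of \<open>z \<rightarrow> x \<times> y\<close>; as images are stable under
  pullback, subobjects of \<open>\<phi>\<close> can be compared after pulling back to \<open>z\<close> (\<open>lies_in_of_image\<close>).

  Pullback maps between subobject lattices are lattice homomorphisms, again by stability, so the
  operations of \<open>LM\<close> can be carried out in any common summand (\<open>L_class_meet\<close>, \<open>L_class_join\<close>). A
  cocone is constant along spans and so factors uniquely through the classes (\<open>LM_universal\<close>). A
  coherent functor \<open>F\<close> acts on subobjects by lattice homomorphisms that commute with pullback;
  together with the naturality of \<open>\<eta>\<close> this makes the composites \<open>Sub x \<rightarrow> Sub (F x) \<rightarrow> LN\<close> a
  cocone, and the induced map is known on every class because it is known on every summand.\<close>

section \<open>Lattices from universal properties\<close>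

lemma meet_eqI:
  fixes L (structure)
  assumes "partial_order L" "x \<in> carrier L" "y \<in> carrier L" "g \<in> carrier L" "g \<sqsubseteq> x" "g \<sqsubseteq> y"
    and "\<And>z. z \<in> carrier L \<Longrightarrow> z \<sqsubseteq> x \<Longrightarrow> z \<sqsubseteq> y \<Longrightarrow> z \<sqsubseteq> g"
  shows "greatest L g (Lower L {x, y})" and "x \<sqinter> y = g"
proof -
  interpret partial_order L by fact
  show *: "greatest L g (Lower L {x, y})"
    using assms by (intro greatest_LowerI) (auto simp: Lower_def)
  show "x \<sqinter> y = g"
    unfolding meet_def Lattice.inf_def using * by (rule some_equality) (rule greatest_unique[OF _ *])
qed

lemma join_eqI:
  fixes L (structure)
  assumes "partial_order L" "x \<in> carrier L" "y \<in> carrier L" "g \<in> carrier L" "x \<sqsubseteq> g" "y \<sqsubseteq> g"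
    and "\<And>z. z \<in> carrier L \<Longrightarrow> x \<sqsubseteq> z \<Longrightarrow> y \<sqsubseteq> z \<Longrightarrow> g \<sqsubseteq> z"
  shows "least L g (Upper L {x, y})" and "x \<squnion> y = g"
proof -
  interpret partial_order L by fact
  show *: "least L g (Upper L {x, y})"
    using assms by (intro least_UpperI) (auto simp: Upper_def)
  show "x \<squnion> y = g"
    unfolding join_def Lattice.sup_def using * by (rule some_equality) (rule least_unique[OF _ *])
qed

lemma top_eqI:
  fixes L (structure)
  assumes "partial_order L" "t \<in> carrier L" "\<And>z. z \<in> carrier L \<Longrightarrow> z \<sqsubseteq> t"
  shows "greatest L t (carrier L)" and "\<top> = t"
proof -
  interpret partial_order L by fact
  show *: "greatest L t (carrier L)"
    using assms by (simp add: greatest_def)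
  show "\<top> = t"
    unfolding top_def using * by (rule some_equality) (rule greatest_unique[OF _ *])
qed

lemma bottom_eqI:
  fixes L (structure)
  assumes "partial_order L" "t \<in> carrier L" "\<And>z. z \<in> carrier L \<Longrightarrow> t \<sqsubseteq> z"
  shows "least L t (carrier L)" and "\<bottom> = t"
proof -
  interpret partial_order L by fact
  show *: "least L t (carrier L)"
    using assms by (simp add: least_def)
  show "\<bottom> = t"
    unfolding bottom_def using * by (rule some_equality) (rule least_unique[OF _ *])
qed

lemma distributive_latticeI:
  fixes L (structure)
  assumes po: "partial_order L"
    and glb: "\<And>x y. x \<in> carrier L \<Longrightarrow> y \<in> carrier L \<Longrightarrow> \<exists>g. greatest L g (Lower L {x, y})"
    and lub: "\<And>x y. x \<in> carrier L \<Longrightarrow> y \<in> carrier L \<Longrightarrow> \<exists>g. least L g (Upper L {x, y})"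
    and top: "\<exists>t. greatest L t (carrier L)"
    and bot: "\<exists>t. least L t (carrier L)"
    and distr: "\<And>x y z. x \<in> carrier L \<Longrightarrow> y \<in> carrier L \<Longrightarrow> z \<in> carrier L \<Longrightarrow>
      x \<sqinter> (y \<squnion> z) \<sqsubseteq> (x \<sqinter> y) \<squnion> (x \<sqinter> z)"
  shows "distributive_lattice L"
proof -
  interpret partial_order L by fact
  interpret bounded_lattice L
    using assms by unfold_locales auto
  have "x \<sqinter> (y \<squnion> z) = (x \<sqinter> y) \<squnion> (x \<sqinter> z)"
    if "x \<in> carrier L" "y \<in> carrier L" "z \<in> carrier L" for x y z
  proof (rule le_antisym[OF distr[OF that]])
    show "(x \<sqinter> y) \<squnion> (x \<sqinter> z) \<sqsubseteq> x \<sqinter> (y \<squnion> z)"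
      using that
      by (intro join_le meet_le meet_closed join_closed meet_left)
        (auto intro: le_trans[OF meet_right join_left] le_trans[OF meet_right join_right])
  qed (use that in auto)
  then show ?thesis
    unfolding distributive_lattice_def using bounded_lattice_axioms by blast
qed

lemma distributive_latticeD:
  assumes "distributive_lattice L"
  shows "bounded_lattice L" "lattice L"
  using assms unfolding distributive_lattice_def bounded_lattice_def by auto

lemma dlat_homI:
  assumes "distributive_lattice L" "distributive_lattice K" "h \<in> extensional (carrier L)"
    and "\<And>x. x \<in> carrier L \<Longrightarrow> h x \<in> carrier K"
    and "\<And>x y. x \<in> carrier L \<Longrightarrow> y \<in> carrier L \<Longrightarrow> h (x \<sqinter>\<^bsub>L\<^esub> y) = h x \<sqinter>\<^bsub>K\<^esub> h y"
    and "\<And>x y. x \<in> carrier L \<Longrightarrow> y \<in> carrier L \<Longrightarrow> h (x \<squnion>\<^bsub>L\<^esub> y) = h x \<squnion>\<^bsub>K\<^esub> h y"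
    and "h \<top>\<^bsub>L\<^esub> = \<top>\<^bsub>K\<^esub>" "h \<bottom>\<^bsub>L\<^esub> = \<bottom>\<^bsub>K\<^esub>"
  shows "h \<in> dlat_hom L K"
  using assms unfolding dlat_hom_def meet_pres_def join_pres_def PiE_def
  by (auto dest: distributive_latticeD(2))

lemma distributive_lattice_closed:
  assumes "distributive_lattice L"
  shows "\<top>\<^bsub>L\<^esub> \<in> carrier L" "\<bottom>\<^bsub>L\<^esub> \<in> carrier L"
    and "\<And>x y. x \<in> carrier L \<Longrightarrow> y \<in> carrier L \<Longrightarrow> x \<sqinter>\<^bsub>L\<^esub> y \<in> carrier L"
    and "\<And>x y. x \<in> carrier L \<Longrightarrow> y \<in> carrier L \<Longrightarrow> x \<squnion>\<^bsub>L\<^esub> y \<in> carrier L"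
proof -
  interpret bounded_lattice L by (rule distributive_latticeD) fact
  show "\<top>\<^bsub>L\<^esub> \<in> carrier L" "\<bottom>\<^bsub>L\<^esub> \<in> carrier L"
    and "\<And>x y. x \<in> carrier L \<Longrightarrow> y \<in> carrier L \<Longrightarrow> x \<sqinter>\<^bsub>L\<^esub> y \<in> carrier L"
    and "\<And>x y. x \<in> carrier L \<Longrightarrow> y \<in> carrier L \<Longrightarrow> x \<squnion>\<^bsub>L\<^esub> y \<in> carrier L" by auto
qed

lemma dlat_homD:
  assumes "h \<in> dlat_hom L K"
  shows "\<And>x. x \<in> carrier L \<Longrightarrow> h x \<in> carrier K"
    and "\<And>x y. x \<in> carrier L \<Longrightarrow> y \<in> carrier L \<Longrightarrow> h (x \<sqinter>\<^bsub>L\<^esub> y) = h x \<sqinter>\<^bsub>K\<^esub> h y"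
    and "\<And>x y. x \<in> carrier L \<Longrightarrow> y \<in> carrier L \<Longrightarrow> h (x \<squnion>\<^bsub>L\<^esub> y) = h x \<squnion>\<^bsub>K\<^esub> h y"
    and "h \<top>\<^bsub>L\<^esub> = \<top>\<^bsub>K\<^esub>" "h \<bottom>\<^bsub>L\<^esub> = \<bottom>\<^bsub>K\<^esub>" "h \<in> extensional (carrier L)"
  using assms unfolding dlat_hom_def meet_pres_def join_pres_def PiE_def by auto

lemma dlat_hom_compose:
  assumes "distributive_lattice L" "distributive_lattice K" "distributive_lattice E"
    and f: "f \<in> dlat_hom L K" and g: "g \<in> dlat_hom K E"
  shows "compose (carrier L) g f \<in> dlat_hom L E"
  by (rule dlat_homI)
    (use assms(1-3) dlat_homD[OF f] dlat_homD[OF g] in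
      \<open>auto simp: compose_def distributive_lattice_closed\<close>)

lemma dlat_hom_id: "distributive_lattice L \<Longrightarrow> (\<lambda>u\<in>carrier L. u) \<in> dlat_hom L L"
  by (rule dlat_homI) (auto simp: distributive_lattice_closed)

lemma category_DLat: "category DLat"
proof -
  have 1: "compose (carrier L) f (\<lambda>u\<in>carrier L. u) = f"
    and 2: "compose (carrier L) (\<lambda>u\<in>carrier K. u) f = f"
    if "f \<in> dlat_hom L K" for f :: "'l \<Rightarrow> 'l" and L K
    using dlat_homD[OF that] by (auto simp: fun_eq_iff compose_def extensional_def)
  have 3: "compose (carrier L) (compose (carrier K) h g) f = compose (carrier L) h (compose (carrier L) g f)"
    if "f \<in> dlat_hom L K" for f g h :: "'l \<Rightarrow> 'l" and L K
    using dlat_homD(1)[OF that] by (auto simp: fun_eq_iff compose_def)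
  show ?thesis
    unfolding category_def
    by (auto simp: DLat_def Hom_def app_def dlat_hom_id dlat_hom_compose 1 2 3)
qed

section \<open>Subobjects through their generalised elements\<close>

text \<open>An arrow \<open>s\<close> into \<open>x\<close> is a generalised element of \<open>x\<close>; it belongs to a subobject when it
  factors through a representative. Meets and pullbacks of subobjects become conjunction and
  substitution in this language, which replaces all diagram chases with representatives.\<close>

definition lies_in :: "('o, 'm) cat \<Rightarrow> 'm \<Rightarrow> 'm set \<Rightarrow> bool" where
  "lies_in C s U \<longleftrightarrow> (\<exists>u\<in>U. factors C s u)"

definition sub_of :: "('o, 'm) cat \<Rightarrow> 'm \<Rightarrow> 'm set" where
  "sub_of C u = subobj_rel C (Cod C u) `` {u}"

locale small_category =
  fixes C :: "('o, 'm) cat" (structure)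
  assumes category: "category C"
begin

lemma Dom_Cod_Ob [simp]: "f \<in> Ar C \<Longrightarrow> Dom C f \<in> Ob C" "f \<in> Ar C \<Longrightarrow> Cod C f \<in> Ob C"
  using category unfolding category_def by blast+

lemma Idn_simps [simp]:
  assumes "x \<in> Ob C"
  shows "Idn C x \<in> Ar C" "Dom C (Idn C x) = x" "Cod C (Idn C x) = x"
  using category assms unfolding category_def Hom_def by blast+

lemma Cmp_simps [simp]:
  assumes "f \<in> Ar C" "g \<in> Ar C" "Dom C g = Cod C f"
  shows "g \<cdot> f \<in> Ar C" "Dom C (g \<cdot> f) = Dom C f" "Cod C (g \<cdot> f) = Cod C g"
  using category assms unfolding category_def Hom_def by auto

lemma Cmp_Idn [simp]:
  "f \<in> Ar C \<Longrightarrow> Dom C f = x \<Longrightarrow> f \<cdot> Idn C x = f"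
  "f \<in> Ar C \<Longrightarrow> Cod C f = x \<Longrightarrow> Idn C x \<cdot> f = f"
  using category unfolding category_def by blast+

lemma Cmp_assoc [simp]:
  assumes "f \<in> Ar C" "g \<in> Ar C" "h \<in> Ar C" "Dom C g = Cod C f" "Dom C h = Cod C g"
  shows "(h \<cdot> g) \<cdot> f = h \<cdot> (g \<cdot> f)"
  using category assms unfolding category_def by blast

lemma Cmp_square:
  assumes "f \<in> Ar C" "w \<in> Ar C" "v \<in> Ar C" "q \<in> Ar C" "g \<in> Ar C"
    and "Dom C f = Cod C w" "Dom C v = Cod C q" "Dom C q = Dom C w" "Cod C g = Dom C w"
    and "f \<cdot> w = v \<cdot> q"
  shows "f \<cdot> (w \<cdot> g) = v \<cdot> (q \<cdot> g)"
  using assms Cmp_assoc[of g w f] Cmp_assoc[of g q v] by simp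

lemma factors_iff:
  assumes "v \<in> Ar C"
  shows "factors C s v \<longleftrightarrow> (\<exists>g\<in>Ar C. Cod C g = Dom C v \<and> s = v \<cdot> g)"
proof
  assume "factors C s v"
  then show "\<exists>g\<in>Ar C. Cod C g = Dom C v \<and> s = v \<cdot> g"
    unfolding factors_def Hom_def by blast
next
  assume "\<exists>g\<in>Ar C. Cod C g = Dom C v \<and> s = v \<cdot> g"
  then obtain g where "g \<in> Ar C" "Cod C g = Dom C v" "s = v \<cdot> g" by blast
  with assms show "factors C s v"
    unfolding factors_def by (intro bexI[of _ g]) (auto simp: Hom_def)
qed

lemma factorsI: "v \<in> Ar C \<Longrightarrow> g \<in> Ar C \<Longrightarrow> Cod C g = Dom C v \<Longrightarrow> factors C (v \<cdot> g) v"
  by (auto simp: factors_iff)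

lemma factors_refl [simp]: "v \<in> Ar C \<Longrightarrow> factors C v v"
  using factorsI[of v "Idn C (Dom C v)"] by simp

lemma factors_trans:
  assumes "factors C s u" "factors C u v" "v \<in> Ar C"
  shows "factors C s v"
proof -
  obtain h where h: "h \<in> Ar C" "Cod C h = Dom C v" "u = v \<cdot> h"
    using assms factors_iff by blast
  moreover from this obtain g where "g \<in> Ar C" "Cod C g = Dom C u" "s = u \<cdot> g"
    using assms factors_iff[of u] by auto
  ultimately show ?thesis
    using factorsI[of v "h \<cdot> g"] \<open>v \<in> Ar C\<close> by simp
qed

lemma factors_type:
  assumes "factors C s v" "v \<in> Ar C"
  shows "s \<in> Ar C" "Cod C s = Cod C v"
  using assms by (auto simp: factors_iff)

lemma monoD: "mono C u \<Longrightarrow> u \<in> Ar C"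
  unfolding mono_def by blast

lemma mono_cancel:
  assumes "mono C u" "g \<in> Ar C" "h \<in> Ar C" "Cod C g = Dom C u" "Cod C h = Dom C u"
    and "Dom C g = Dom C h" "u \<cdot> g = u \<cdot> h"
  shows "g = h"
proof -
  have "g \<in> Hom C (Dom C h) (Dom C u)" "h \<in> Hom C (Dom C h) (Dom C u)" "Dom C h \<in> Ob C"
    using assms by (auto simp: Hom_def)
  then show ?thesis
    using assms(1,7) unfolding mono_def by blast
qed

lemma monoI:
  assumes "u \<in> Ar C"
    and "\<And>g h. g \<in> Ar C \<Longrightarrow> h \<in> Ar C \<Longrightarrow> Cod C g = Dom C u \<Longrightarrow> Cod C h = Dom C u \<Longrightarrow>
      Dom C g = Dom C h \<Longrightarrow> u \<cdot> g = u \<cdot> h \<Longrightarrow> g = h"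
  shows "mono C u"
  using assms unfolding mono_def Hom_def by auto

lemma mono_Cmp:
  assumes "mono C u" "mono C w" "Cod C w = Dom C u"
  shows "mono C (u \<cdot> w)"
proof (rule monoI)
  fix g h
  assume *: "g \<in> Ar C" "h \<in> Ar C" "Cod C g = Dom C (u \<cdot> w)" "Cod C h = Dom C (u \<cdot> w)"
    "Dom C g = Dom C h" "(u \<cdot> w) \<cdot> g = (u \<cdot> w) \<cdot> h"
  have "w \<cdot> g = w \<cdot> h"
    using * assms monoD[of u] monoD[of w] by - (rule mono_cancel[of u], auto)
  then show "g = h"
    using * assms monoD[of u] monoD[of w] by - (rule mono_cancel[of w], auto)
qed (use assms monoD in auto)

lemma mono_Idn: "x \<in> Ob C \<Longrightarrow> mono C (Idn C x)"
  by (rule monoI) auto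

lemma subobj_rel_equiv: "equiv (monos_into C x) (subobj_rel C x)"
proof (intro equivI refl_onI symI transI)
  show "(u, w) \<in> subobj_rel C x" if "(u, v) \<in> subobj_rel C x" "(v, w) \<in> subobj_rel C x" for u v w
    using that factors_trans[of u v w] factors_trans[of w v u]
    by (auto simp: subobj_rel_def monos_into_def dest: monoD)
qed (auto simp: subobj_rel_def monos_into_def monoD)

lemma Sub_carrier_iff:
  "U \<in> carrier (Sub C x) \<longleftrightarrow> (\<exists>u. mono C u \<and> Cod C u = x \<and> U = sub_of C u)"
  unfolding Sub_def quotient_def sub_of_def monos_into_def by auto

lemma sub_of_closed [simp]: "mono C u \<Longrightarrow> Cod C u = x \<Longrightarrow> sub_of C u \<in> carrier (Sub C x)"
  unfolding Sub_carrier_iff by blast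

lemma in_sub_of_iff:
  "mono C u \<Longrightarrow> v \<in> sub_of C u \<longleftrightarrow> mono C v \<and> Cod C v = Cod C u \<and> factors C u v \<and> factors C v u"
  unfolding sub_of_def subobj_rel_def monos_into_def by auto

lemma in_Sub:
  assumes "U \<in> carrier (Sub C x)" "u \<in> U"
  shows "mono C u" "Cod C u = x" "U = sub_of C u"
proof -
  obtain u' where u': "mono C u'" "Cod C u' = x" "U = sub_of C u'"
    using assms Sub_carrier_iff by blast
  then show "mono C u" "Cod C u = x" using assms in_sub_of_iff by auto
  then show "U = sub_of C u"
    using u' assms(2) equiv_class_eq[OF subobj_rel_equiv[of x], of u' u] unfolding sub_of_def by auto
qed

lemma Sub_nonempty:
  assumes "U \<in> carrier (Sub C x)"
  obtains u where "u \<in> U" "mono C u" "Cod C u = x" "U = sub_of C u" "u \<in> Ar C"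
proof -
  from assms obtain u where u: "mono C u" "Cod C u = x" "U = sub_of C u"
    unfolding Sub_carrier_iff by blast
  then have "u \<in> U" by (auto simp: in_sub_of_iff monoD)
  with u show ?thesis using that monoD by blast
qed

lemma lies_in_sub_of [simp]: "mono C u \<Longrightarrow> lies_in C s (sub_of C u) \<longleftrightarrow> factors C s u"
  unfolding lies_in_def
  by (auto simp: in_sub_of_iff intro: factors_trans intro!: bexI[of _ u] monoD factors_refl)

lemma lies_in_type:
  assumes "lies_in C s U" "U \<in> carrier (Sub C x)"
  shows "s \<in> Ar C" "Cod C s = x"
  using assms in_Sub factors_type monoD unfolding lies_in_def by metis+

lemma lies_in_Cmp:
  assumes "lies_in C s U" "U \<in> carrier (Sub C x)" "t \<in> Ar C" "Cod C t = Dom C s"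
  shows "lies_in C (s \<cdot> t) U"
  using assms factors_trans[OF factorsI] lies_in_type[OF assms(1,2)] in_Sub monoD
  unfolding lies_in_def by metis

lemma Sub_le_iff:
  assumes "U \<in> carrier (Sub C x)" "V \<in> carrier (Sub C x)"
  shows "U \<sqsubseteq>\<^bsub>Sub C x\<^esub> V \<longleftrightarrow> (\<forall>s. lies_in C s U \<longrightarrow> lies_in C s V)"
proof -
  have "U \<sqsubseteq>\<^bsub>Sub C x\<^esub> V \<longleftrightarrow> (\<exists>u\<in>U. lies_in C u V)"
    by (simp add: Sub_def lies_in_def)
  also have "\<dots> \<longleftrightarrow> (\<forall>s. lies_in C s U \<longrightarrow> lies_in C s V)"
  proof safe
    fix u s
    assume u: "u \<in> U" "lies_in C u V" "lies_in C s U"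
    then obtain v where v: "v \<in> V" "factors C u v" unfolding lies_in_def by blast
    have "factors C s u" using u assms in_Sub by (metis lies_in_sub_of)
    with v show "lies_in C s V"
      unfolding lies_in_def using assms in_Sub monoD factors_trans by metis
  next
    assume *: "\<forall>s. lies_in C s U \<longrightarrow> lies_in C s V"
    obtain u where "u \<in> U" "u \<in> Ar C" using Sub_nonempty assms by metis
    with * show "\<exists>u\<in>U. lies_in C u V"
      by (metis factors_refl lies_in_def)
  qed
  finally show ?thesis .
qed

lemma Sub_eqI:
  assumes U: "U \<in> carrier (Sub C x)" and V: "V \<in> carrier (Sub C x)"
    and "\<And>s. s \<in> Ar C \<Longrightarrow> Cod C s = x \<Longrightarrow> lies_in C s U \<longleftrightarrow> lies_in C s V"
  shows "U = V"
proof -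
  obtain u v where u: "mono C u" "Cod C u = x" "U = sub_of C u" "u \<in> Ar C"
    and v: "mono C v" "Cod C v = x" "V = sub_of C v" "v \<in> Ar C"
    using Sub_nonempty[OF U] Sub_nonempty[OF V] by metis
  have "factors C u v" "factors C v u"
    using assms(3)[of u] assms(3)[of v] u v by auto
  with u v have "(u, v) \<in> subobj_rel C x" by (simp add: subobj_rel_def monos_into_def)
  then show ?thesis
    using u v equiv_class_eq[OF subobj_rel_equiv[of x]] unfolding sub_of_def by metis
qed

lemma Sub_partial_order: "partial_order (Sub C x)"
proof
  show eq: "(.=\<^bsub>Sub C x\<^esub>) = (=)" by (simp add: Sub_def)
  fix U V W
  assume "U \<in> carrier (Sub C x)" "V \<in> carrier (Sub C x)"
  then show "U \<sqsubseteq>\<^bsub>Sub C x\<^esub> V \<Longrightarrow> V \<sqsubseteq>\<^bsub>Sub C x\<^esub> U \<Longrightarrow> U .=\<^bsub>Sub C x\<^esub> V"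
    using Sub_eqI[of U x V] by (simp only: Sub_le_iff eq) blast
  show "W \<in> carrier (Sub C x) \<Longrightarrow> U \<sqsubseteq>\<^bsub>Sub C x\<^esub> V \<Longrightarrow> V \<sqsubseteq>\<^bsub>Sub C x\<^esub> W \<Longrightarrow> U \<sqsubseteq>\<^bsub>Sub C x\<^esub> W"
    using \<open>U \<in> _\<close> \<open>V \<in> _\<close> by (simp add: Sub_le_iff)
qed (auto simp: Sub_le_iff, auto simp: Sub_def)

lemma full_sub_eq: "x \<in> Ob C \<Longrightarrow> full_sub C x = sub_of C (Idn C x)"
  by (simp add: full_sub_def sub_of_def)

lemma Sub_top:
  assumes "x \<in> Ob C"
  shows "full_sub C x \<in> carrier (Sub C x)"
    and "\<And>s. lies_in C s (full_sub C x) \<longleftrightarrow> s \<in> Ar C \<and> Cod C s = x"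
    and "greatest (Sub C x) (full_sub C x) (carrier (Sub C x))"
    and "\<top>\<^bsub>Sub C x\<^esub> = full_sub C x"
proof -
  show 1: "full_sub C x \<in> carrier (Sub C x)"
    using assms by (simp add: full_sub_eq mono_Idn)
  show 2: "lies_in C s (full_sub C x) \<longleftrightarrow> s \<in> Ar C \<and> Cod C s = x" for s
    using assms by (auto simp: full_sub_eq mono_Idn factors_iff)
  have "V \<sqsubseteq>\<^bsub>Sub C x\<^esub> full_sub C x" if "V \<in> carrier (Sub C x)" for V
    using that 1 by (auto simp: Sub_le_iff 2 lies_in_type)
  from top_eqI[OF Sub_partial_order 1 this]
  show "greatest (Sub C x) (full_sub C x) (carrier (Sub C x))" "\<top>\<^bsub>Sub C x\<^esub> = full_sub C x" by auto
qed

subsection \<open>Pullback of subobjects\<close>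

lemma is_pullbackD:
  assumes "is_pullback C f v w q"
  shows "f \<in> Ar C" "v \<in> Ar C" "w \<in> Ar C" "q \<in> Ar C" "Cod C f = Cod C v" "Dom C q = Dom C w"
    "Cod C w = Dom C f" "Cod C q = Dom C v" "f \<cdot> w = v \<cdot> q"
  using assms unfolding is_pullback_def by auto

lemma is_pullback_lift:
  assumes pb: "is_pullback C f v w q" and "s \<in> Ar C" "t \<in> Ar C" "Cod C s = Dom C f" "Cod C t = Dom C v"
    and "Dom C t = Dom C s" "f \<cdot> s = v \<cdot> t"
  obtains h where "h \<in> Ar C" "Dom C h = Dom C s" "Cod C h = Dom C w" "w \<cdot> h = s" "q \<cdot> h = t"
proof -
  have "Dom C s \<in> Ob C" "s \<in> Hom C (Dom C s) (Dom C f)" "t \<in> Hom C (Dom C s) (Dom C v)"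
    using assms by (auto simp: Hom_def)
  with assms(7) pb obtain h where "h \<in> Hom C (Dom C s) (Dom C w)" "w \<cdot> h = s" "q \<cdot> h = t"
    unfolding is_pullback_def by metis
  with that[of h] show ?thesis by (simp add: Hom_def)
qed

lemma is_pullback_unique:
  assumes pb: "is_pullback C f v w q" and g: "g \<in> Ar C" "Cod C g = Dom C w"
    and h: "h \<in> Ar C" "Cod C h = Dom C w"
    and "Dom C g = Dom C h" "w \<cdot> g = w \<cdot> h" "q \<cdot> g = q \<cdot> h"
  shows "g = h"
proof -
  note c = is_pullbackD[OF pb]
  have "f \<cdot> (w \<cdot> h) = v \<cdot> (q \<cdot> h)"
    using h c by (intro Cmp_square) auto
  moreover have "Dom C h \<in> Ob C" "w \<cdot> h \<in> Hom C (Dom C h) (Dom C f)" "q \<cdot> h \<in> Hom C (Dom C h) (Dom C v)"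
    "g \<in> Hom C (Dom C h) (Dom C w)" "h \<in> Hom C (Dom C h) (Dom C w)"
    using assms c by (auto simp: Hom_def)
  ultimately show ?thesis
    using pb assms(7,8) unfolding is_pullback_def by blast
qed

lemma is_pullback_factors:
  assumes pb: "is_pullback C f v w q" and "s \<in> Ar C" "Cod C s = Dom C f"
  shows "factors C s w \<longleftrightarrow> factors C (f \<cdot> s) v"
proof
  assume "factors C s w"
  then obtain g where "g \<in> Ar C" "Cod C g = Dom C w" "s = w \<cdot> g"
    using factors_iff[of w] is_pullbackD[OF pb] by blast
  moreover from this have "f \<cdot> s = v \<cdot> (q \<cdot> g)"
    using is_pullbackD[OF pb] Cmp_square[of f w v q g] by simp
  ultimately show "factors C (f \<cdot> s) v"
    using is_pullbackD[OF pb] by (simp add: factorsI)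
next
  assume "factors C (f \<cdot> s) v"
  then obtain t where t: "t \<in> Ar C" "Cod C t = Dom C v" "f \<cdot> s = v \<cdot> t"
    using factors_iff[of v] is_pullbackD[OF pb] by auto
  then have "Dom C t = Dom C s"
    using assms is_pullbackD[OF pb] by (metis Cmp_simps(2))
  then obtain h where "h \<in> Ar C" "Cod C h = Dom C w" "w \<cdot> h = s"
    using is_pullback_lift[OF pb, of s t] t assms by metis
  then show "factors C s w" using factorsI is_pullbackD[OF pb] by metis
qed

text \<open>Two arrows into the pullback that agree after \<open>w\<close> also agree after \<open>q\<close>, as \<open>v\<close> is monic.\<close>

lemma is_pullback_mono:
  assumes pb: "is_pullback C f v w q" and v: "mono C v"
  shows "mono C w"
proof (rule monoI)
  show wA: "w \<in> Ar C" using pb unfolding is_pullback_def by blast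
  fix g h
  assume *: "g \<in> Ar C" "h \<in> Ar C" "Cod C g = Dom C w" "Cod C h = Dom C w"
    "Dom C g = Dom C h" "w \<cdot> g = w \<cdot> h"
  note c = is_pullbackD[OF pb]
  have "v \<cdot> (q \<cdot> g) = v \<cdot> (q \<cdot> h)"
    using * c wA Cmp_square[of f w v q g] Cmp_square[of f w v q h] by simp
  then have q: "q \<cdot> g = q \<cdot> h"
    using * c v by - (rule mono_cancel[of v], auto)
  from is_pullback_unique[OF pb _ _ _ _ _ _ this] show "g = h"
    using * by blast
qed

text \<open>Replacing a pullback \<open>w\<close> by an isomorphic subobject gives another pullback. Therefore the
  pullbacks of the representatives of a subobject fill a whole isomorphism class.\<close>

lemma is_pullback_iso_left:
  assumes pb: "is_pullback C f v w q" and v: "mono C v" and w': "mono C w'"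
    and "Cod C w' = Cod C w" "factors C w w'" "factors C w' w"
  shows "\<exists>q'. is_pullback C f v w' q'"
proof -
  note c = is_pullbackD[OF pb]
  have w'A: "w' \<in> Ar C" using w' monoD by blast
  obtain i where i: "i \<in> Ar C" "Cod C i = Dom C w" "w' = w \<cdot> i" "Dom C w' = Dom C i"
    using assms(6) c factors_iff[of w] by auto
  have e: "f \<cdot> w' = v \<cdot> (q \<cdot> i)"
    unfolding i(3) using c i by (intro Cmp_square) auto
  have "\<exists>!h. h \<in> Hom C z (Dom C w') \<and> w' \<cdot> h = s \<and> (q \<cdot> i) \<cdot> h = t"
    if "z \<in> Ob C" "s \<in> Hom C z (Dom C f)" "t \<in> Hom C z (Dom C v)" "f \<cdot> s = v \<cdot> t" for z s t
  proof -
    have s: "s \<in> Ar C" "Dom C s = z" "Cod C s = Dom C f"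
      "t \<in> Ar C" "Dom C t = z" "Cod C t = Dom C v"
      using that unfolding Hom_def by auto
    have "factors C (f \<cdot> s) v" unfolding that(4) using c s by (intro factorsI) auto
    then have "factors C s w" using is_pullback_factors[OF pb] s by blast
    then have "factors C s w'" using factors_trans assms(5) w'A by blast
    then obtain h where h: "h \<in> Ar C" "Dom C h = z" "Cod C h = Dom C w'" "s = w' \<cdot> h"
      unfolding factors_def Hom_def using s by blast
    have "v \<cdot> ((q \<cdot> i) \<cdot> h) = (f \<cdot> w') \<cdot> h"
      unfolding e using c i h by simp
    also have "\<dots> = v \<cdot> t"
      using c i h w'A that assms(4) by simp
    finally have "(q \<cdot> i) \<cdot> h = t"
      using c i h s by - (rule mono_cancel[OF v], auto)
    moreover have "h' = h" if "h' \<in> Hom C z (Dom C w')" "w' \<cdot> h' = s" for h'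
      using that h w' unfolding Hom_def by - (rule mono_cancel[OF w'], auto)
    moreover have "h \<in> Hom C z (Dom C w')" using h by (simp add: Hom_def)
    ultimately show ?thesis
      using h(4)[symmetric] by blast
  qed
  then have "is_pullback C f v w' (q \<cdot> i)"
    unfolding is_pullback_def using c w'A i assms(4) e by auto
  then show ?thesis by blast
qed

lemma is_pullback_sub_pullback:
  assumes pb: "is_pullback C f v w q" and v: "mono C v"
  shows "sub_pullback C f (sub_of C v) = sub_of C w"
proof -
  from pb have c: "f \<in> Ar C" "v \<in> Ar C" "w \<in> Ar C" "Cod C f = Cod C v" "Cod C w = Dom C f"
    unfolding is_pullback_def by auto
  have w: "mono C w" using is_pullback_mono[OF assms] .
  show ?thesis
  proof (intro Set.set_eqI iffI)
    fix w'
    assume "w' \<in> sub_pullback C f (sub_of C v)"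
    then obtain v' q' where v': "v' \<in> sub_of C v" and pb': "is_pullback C f v' w' q'"
      unfolding sub_pullback_def by blast
    then have v'2: "mono C v'" "factors C v v'" "factors C v' v" "v' \<in> Ar C"
      using in_sub_of_iff[OF v] monoD by auto
    have w': "mono C w'" using is_pullback_mono[OF pb' v'2(1)] .
    have c': "w' \<in> Ar C" "Cod C w' = Dom C f" using pb' unfolding is_pullback_def by auto
    have "factors C w w'" "factors C w' w"
      using is_pullback_factors[OF pb] is_pullback_factors[OF pb'] factors_trans c c' v'2 factors_refl
      by metis+
    then show "w' \<in> sub_of C w" using w w' c c' in_sub_of_iff by auto
  next
    fix w'
    assume "w' \<in> sub_of C w"
    then have "\<exists>q'. is_pullback C f v w' q'"
      using in_sub_of_iff[OF w] is_pullback_iso_left[OF pb v] by auto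
    moreover have "v \<in> sub_of C v" using v c in_sub_of_iff by auto
    ultimately show "w' \<in> sub_pullback C f (sub_of C v)" unfolding sub_pullback_def by blast
  qed
qed

end

section \<open>Terminal objects, products and pullbacks as limits of finite diagrams\<close>

text \<open>Limits of shape \<open>discrete 0\<close> are terminal objects, those of shape \<open>discrete 2\<close> are binary
  products.\<close>

definition discrete :: "nat \<Rightarrow> (nat, nat) cat" where
  "discrete n = \<lparr>Ob = {..<n}, Ar = {..<n}, Dom = id, Cod = id, Idn = id, Cmp = (\<lambda>g f. f)\<rparr>"

text \<open>The shape \<open>0 \<rightarrow> 2 \<leftarrow> 1\<close>: the arrows \<open>0, 1, 2\<close> are the identities, and \<open>3, 4\<close> are
  the two legs.\<close>

definition cospan :: "(nat, nat) cat" where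
  "cospan = \<lparr>Ob = {0, 1, 2}, Ar = {0, 1, 2, 3, 4},
     Dom = (\<lambda>j. if j = 3 then 0 else if j = 4 then 1 else j),
     Cod = (\<lambda>j. if j = 3 \<or> j = 4 then 2 else j),
     Idn = id, Cmp = (\<lambda>g f. if g \<le> 2 then f else g)\<rparr>"

lemma finite_category_discrete: "finite_category (discrete n)"
  unfolding finite_category_def category_def Hom_def discrete_def by auto

lemma finite_category_cospan: "finite_category cospan"
  unfolding finite_category_def category_def Hom_def cospan_def by auto

lemma is_functor_fcomp:
  assumes "is_functor J C T" "is_functor C D F"
  shows "is_functor J D (fcomp F T)"
proof -
  from assms(2) have F: "\<And>x. x \<in> Ob C \<Longrightarrow> fo F x \<in> Ob D"
    "\<And>f x y. f \<in> Hom C x y \<Longrightarrow> fa F f \<in> Hom D (fo F x) (fo F y)"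
    "\<And>x. x \<in> Ob C \<Longrightarrow> fa F (Idn C x) = Idn D (fo F x)"
    "\<And>f g. f \<in> Ar C \<Longrightarrow> g \<in> Ar C \<Longrightarrow> Dom C g = Cod C f \<Longrightarrow>
      fa F (g \<cdot>\<^bsub>C\<^esub> f) = fa F g \<cdot>\<^bsub>D\<^esub> fa F f" "category D"
    unfolding is_functor_def Hom_def by auto
  from assms(1) have T: "\<And>x. x \<in> Ob J \<Longrightarrow> fo T x \<in> Ob C"
    "\<And>f. f \<in> Ar J \<Longrightarrow> fa T f \<in> Hom C (fo T (Dom J f)) (fo T (Cod J f))"
    "\<And>x. x \<in> Ob J \<Longrightarrow> fa T (Idn J x) = Idn C (fo T x)"
    "\<And>f g. f \<in> Ar J \<Longrightarrow> g \<in> Ar J \<Longrightarrow> Dom J g = Cod J f \<Longrightarrow>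
      fa T (g \<cdot>\<^bsub>J\<^esub> f) = fa T g \<cdot>\<^bsub>C\<^esub> fa T f" "category J"
    unfolding is_functor_def by auto
  have "fa T f \<in> Ar C \<and> Dom C (fa T f) = fo T (Dom J f) \<and> Cod C (fa T f) = fo T (Cod J f)"
    if "f \<in> Ar J" for f
    using T(2)[OF that] unfolding Hom_def by auto
  with F T show ?thesis
    unfolding is_functor_def fcomp_def by simp
qed

context small_category
begin

lemma is_functor_discrete:
  "(\<And>i. i < n \<Longrightarrow> X i \<in> Ob C) \<Longrightarrow> is_functor (discrete n) C \<lparr>fo = X, fa = \<lambda>i. Idn C (X i)\<rparr>"
  using finite_category_discrete[of n] category
  unfolding is_functor_def finite_category_def by (auto simp: discrete_def Hom_def)

lemma is_functor_cospan:
  assumes "f \<in> Ar C" "v \<in> Ar C" "Cod C f = Cod C v"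
  shows "is_functor cospan C
    \<lparr>fo = \<lambda>i. if i = 0 then Dom C f else if i = 1 then Dom C v else Cod C f,
     fa = \<lambda>j. if j = 3 then f else if j = 4 then v else
       Idn C (if j = 0 then Dom C f else if j = 1 then Dom C v else Cod C f)\<rparr>"
  using finite_category_cospan category assms
  unfolding is_functor_def finite_category_def by (auto simp: cospan_def Hom_def)

lemma is_limit_discrete_2:
  assumes "is_functor (discrete 2) C T"
  shows "is_limit C (discrete 2) T l \<pi> \<longleftrightarrow> is_product C (fo T 0) (fo T 1) l (\<pi> 0) (\<pi> 1)"
proof -
  have T: "fa T i = Idn C (fo T i)" "fo T i \<in> Ob C" if "i < 2" for i
    using assms that unfolding is_functor_def discrete_def by auto
  have lt: "(\<forall>i<2. P i) \<longleftrightarrow> P 0 \<and> P 1" for P :: "nat \<Rightarrow> bool"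
    by (auto simp: less_2_cases_iff)
  have cone: "is_cone C (discrete 2) T z \<kappa> \<longleftrightarrow>
    z \<in> Ob C \<and> \<kappa> 0 \<in> Hom C z (fo T 0) \<and> \<kappa> 1 \<in> Hom C z (fo T 1)" for z \<kappa>
    using T[of 0] T[of 1] unfolding is_cone_def discrete_def by (auto simp: lt Hom_def Ball_def)
  show ?thesis
  proof
    assume lim: "is_limit C (discrete 2) T l \<pi>"
    have "\<exists>!h. h \<in> Hom C z l \<and> \<pi> 0 \<cdot> h = f \<and> \<pi> 1 \<cdot> h = g"
      if "z \<in> Ob C" "f \<in> Hom C z (fo T 0)" "g \<in> Hom C z (fo T 1)" for z f g
    proof -
      have "is_cone C (discrete 2) T z (\<lambda>i. if i = 0 then f else g)"
        using that by (simp add: cone)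
      with lim have "\<exists>!h. h \<in> Hom C z l \<and> (\<forall>i\<in>Ob (discrete 2). \<pi> i \<cdot> h = (if i = 0 then f else g))"
        unfolding is_limit_def by blast
      moreover have "Ob (discrete 2) = {0, 1}" by (auto simp: discrete_def less_2_cases_iff)
      ultimately show ?thesis by simp
    qed
    then show "is_product C (fo T 0) (fo T 1) l (\<pi> 0) (\<pi> 1)"
      using lim cone unfolding is_limit_def is_product_def by blast
  next
    assume "is_product C (fo T 0) (fo T 1) l (\<pi> 0) (\<pi> 1)"
    then show "is_limit C (discrete 2) T l \<pi>"
      unfolding is_limit_def is_product_def cone by (auto simp: discrete_def lt Ball_def)
  qed
qed

lemma is_limit_cospan:
  assumes "is_functor cospan C T"
  shows "is_limit C cospan T l \<pi> \<longleftrightarrow>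
    is_pullback C (fa T 3) (fa T 4) (\<pi> 0) (\<pi> 1) \<and> Dom C (\<pi> 0) = l \<and> \<pi> 2 = fa T 3 \<cdot> \<pi> 0"
proof -
  have "fa T 3 \<in> Hom C (fo T 0) (fo T 2)" "fa T 4 \<in> Hom C (fo T 1) (fo T 2)"
    using assms unfolding is_functor_def cospan_def by auto
  then have T3: "fa T 3 \<in> Ar C" "Dom C (fa T 3) = fo T 0" "Cod C (fa T 3) = fo T 2"
    and T4: "fa T 4 \<in> Ar C" "Dom C (fa T 4) = fo T 1" "Cod C (fa T 4) = fo T 2"
    by (auto simp: Hom_def)
  have T: "fa T 0 = Idn C (fo T 0)" "fa T (Suc 0) = Idn C (fo T 1)" "fa T 2 = Idn C (fo T 2)"
    using assms unfolding is_functor_def cospan_def by auto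
  have cone: "is_cone C cospan T z \<kappa> \<longleftrightarrow>
    z \<in> Ob C \<and> \<kappa> 0 \<in> Hom C z (fo T 0) \<and> \<kappa> 1 \<in> Hom C z (fo T 1) \<and>
    fa T 3 \<cdot> \<kappa> 0 = fa T 4 \<cdot> \<kappa> 1 \<and> \<kappa> 2 = fa T 3 \<cdot> \<kappa> 0" for z \<kappa>
    using T3 T4 unfolding is_cone_def cospan_def by (auto simp: Hom_def T)
  show ?thesis
  proof
    assume lim: "is_limit C cospan T l \<pi>"
    then have c: "l \<in> Ob C" "\<pi> 0 \<in> Hom C l (fo T 0)" "\<pi> 1 \<in> Hom C l (fo T 1)"
      "fa T 3 \<cdot> \<pi> 0 = fa T 4 \<cdot> \<pi> 1" "\<pi> 2 = fa T 3 \<cdot> \<pi> 0"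
      unfolding is_limit_def cone by auto
    have "\<exists>!h. h \<in> Hom C z l \<and> \<pi> 0 \<cdot> h = s \<and> \<pi> 1 \<cdot> h = t"
      if "z \<in> Ob C" "s \<in> Hom C z (fo T 0)" "t \<in> Hom C z (fo T 1)" "fa T 3 \<cdot> s = fa T 4 \<cdot> t" for z s t
    proof -
      let ?\<kappa> = "\<lambda>i::nat. if i = 0 then s else if i = 1 then t else fa T 3 \<cdot> s"
      have "is_cone C cospan T z ?\<kappa>"
        using that by (simp add: cone)
      with lim have "\<exists>!h. h \<in> Hom C z l \<and> (\<forall>i\<in>Ob cospan. \<pi> i \<cdot> h = ?\<kappa> i)"
        unfolding is_limit_def by blast
      then have "\<exists>!h. h \<in> Hom C z l \<and> (\<forall>i\<in>{0, 1, 2}. \<pi> i \<cdot> h = ?\<kappa> i)"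
        by (simp add: cospan_def)
      moreover have "(\<forall>i\<in>{0, 1, 2}. \<pi> i \<cdot> h = ?\<kappa> i) \<longleftrightarrow> \<pi> 0 \<cdot> h = s \<and> \<pi> 1 \<cdot> h = t"
        if "h \<in> Hom C z l" for h
      proof -
        have "\<pi> 2 \<cdot> h = fa T 3 \<cdot> (\<pi> 0 \<cdot> h)"
          unfolding c(5) using that c T3 by (intro Cmp_assoc) (auto simp: Hom_def)
        then show ?thesis by auto
      qed
      ultimately show ?thesis by (metis (no_types, lifting))
    qed
    moreover have "\<pi> 0 \<in> Ar C" "\<pi> 1 \<in> Ar C" "Dom C (\<pi> 0) = l" "Dom C (\<pi> 1) = l"
      "Cod C (\<pi> 0) = fo T 0" "Cod C (\<pi> 1) = fo T 1"
      using c by (auto simp: Hom_def)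
    ultimately show "is_pullback C (fa T 3) (fa T 4) (\<pi> 0) (\<pi> 1) \<and> Dom C (\<pi> 0) = l \<and> \<pi> 2 = fa T 3 \<cdot> \<pi> 0"
      using c(4,5) T3 T4 unfolding is_pullback_def by simp
  next
    assume pb: "is_pullback C (fa T 3) (fa T 4) (\<pi> 0) (\<pi> 1) \<and> Dom C (\<pi> 0) = l \<and> \<pi> 2 = fa T 3 \<cdot> \<pi> 0"
    then have c: "\<pi> 0 \<in> Ar C" "\<pi> 1 \<in> Ar C" "Dom C (\<pi> 0) = l" "Dom C (\<pi> 1) = l"
      "Cod C (\<pi> 0) = fo T 0" "Cod C (\<pi> 1) = fo T 1" "fa T 3 \<cdot> \<pi> 0 = fa T 4 \<cdot> \<pi> 1"
      "\<pi> 2 = fa T 3 \<cdot> \<pi> 0"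
      using is_pullbackD[of "fa T 3" "fa T 4" "\<pi> 0" "\<pi> 1"] T3 T4 by auto
    have u: "\<exists>!h. h \<in> Hom C z l \<and> (\<forall>i\<in>{0, 1, 2}. \<pi> i \<cdot> h = \<kappa> i)" if "is_cone C cospan T z \<kappa>" for z \<kappa>
    proof -
      have "\<exists>!h. h \<in> Hom C z l \<and> \<pi> 0 \<cdot> h = \<kappa> 0 \<and> \<pi> 1 \<cdot> h = \<kappa> 1"
      proof -
        have "\<forall>z\<in>Ob C. \<forall>s\<in>Hom C z (fo T 0). \<forall>t\<in>Hom C z (fo T 1). fa T 3 \<cdot> s = fa T 4 \<cdot> t \<longrightarrow>
          (\<exists>!h. h \<in> Hom C z l \<and> \<pi> 0 \<cdot> h = s \<and> \<pi> 1 \<cdot> h = t)"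
          using pb[THEN conjunct1] unfolding is_pullback_def c(3) T3(2) T4(2) by blast
        with that show ?thesis unfolding cone by blast
      qed
      moreover have "(\<forall>i\<in>{0, 1, 2}. \<pi> i \<cdot> h = \<kappa> i) \<longleftrightarrow> \<pi> 0 \<cdot> h = \<kappa> 0 \<and> \<pi> 1 \<cdot> h = \<kappa> 1"
        if "h \<in> Hom C z l" for h
      proof -
        have "\<pi> 2 \<cdot> h = fa T 3 \<cdot> (\<pi> 0 \<cdot> h)"
          unfolding c(8) using that c(1-6) T3 by (intro Cmp_assoc) (auto simp: Hom_def)
        then show ?thesis using \<open>is_cone C cospan T z \<kappa>\<close> by (auto simp: cone)
      qed
      ultimately show ?thesis by (metis (no_types, lifting))
    qed
    have "l \<in> Ob C" using Dom_Cod_Ob(1)[OF c(1)] c(3) by simp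
    then have "is_cone C cospan T l \<pi>"
      using c by (simp add: cone Hom_def)
    with u show "is_limit C cospan T l \<pi>"
      unfolding is_limit_def by (simp add: cospan_def)
  qed
qed

lemma is_productD:
  assumes "is_product C x y P p q"
  shows "P \<in> Ob C" "p \<in> Ar C" "q \<in> Ar C" "Dom C p = P" "Dom C q = P" "Cod C p = x" "Cod C q = y"
    "x \<in> Ob C" "y \<in> Ob C"
  using assms Dom_Cod_Ob(2)[of p] Dom_Cod_Ob(2)[of q] unfolding is_product_def Hom_def by auto

lemma is_product_lift:
  assumes pr: "is_product C x y P p q" and "f \<in> Ar C" "g \<in> Ar C" "Cod C f = x" "Cod C g = y"
    and "Dom C g = Dom C f"
  obtains h where "h \<in> Ar C" "Dom C h = Dom C f" "Cod C h = P" "p \<cdot> h = f" "q \<cdot> h = g"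
proof -
  have "Dom C f \<in> Ob C" "f \<in> Hom C (Dom C f) x" "g \<in> Hom C (Dom C f) y"
    using assms by (auto simp: Hom_def)
  with pr obtain h where "h \<in> Hom C (Dom C f) P" "p \<cdot> h = f" "q \<cdot> h = g"
    unfolding is_product_def by metis
  with that[of h] show ?thesis by (simp add: Hom_def)
qed

lemma is_product_unique:
  assumes pr: "is_product C x y P p q" and g: "g \<in> Ar C" "Cod C g = P" and h: "h \<in> Ar C" "Cod C h = P"
    and "Dom C g = Dom C h" "p \<cdot> g = p \<cdot> h" "q \<cdot> g = q \<cdot> h"
  shows "g = h"
proof -
  have "Dom C h \<in> Ob C" "p \<cdot> h \<in> Hom C (Dom C h) x" "q \<cdot> h \<in> Hom C (Dom C h) y"
    "g \<in> Hom C (Dom C h) P" "h \<in> Hom C (Dom C h) P"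
    using assms is_productD[OF pr] by (auto simp: Hom_def)
  then show ?thesis
    using pr assms(7,8) unfolding is_product_def by blast
qed

lemma is_product_swap: "is_product C x y P p q \<Longrightarrow> is_product C y x P q p"
  unfolding is_product_def by (metis (no_types, lifting))

text \<open>The subobject \<open>u \<times> y\<close> of \<open>x \<times> y\<close> is the pullback of \<open>u\<close> along the first projection: an arrow
  into \<open>x \<times> y\<close> whose first component factors through \<open>u\<close> is a pair of an arrow into the domain of
  \<open>u\<close> and an arbitrary arrow into \<open>y\<close>. Both inclusions are needed, because the two sides range over
  different choices of products, pullbacks and representatives.\<close>

lemma sub_prod_full_right:
  assumes pr: "is_product C x y P p q" and U: "U \<in> carrier (Sub C x)"
  shows "sub_prod C P p q U (full_sub C y) = sub_pullback C p U"
proof (intro Set.set_eqI iffI)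
  note c = is_productD[OF pr]
  fix w
  assume "w \<in> sub_prod C P p q U (full_sub C y)"
  then obtain u v Q p' q' where u: "u \<in> U" and v: "v \<in> full_sub C y"
    and pr': "is_product C (Dom C u) (Dom C v) Q p' q'" and w: "w \<in> Hom C Q P"
    and e: "p \<cdot> w = u \<cdot> p'" "q \<cdot> w = v \<cdot> q'"
    unfolding sub_prod_def by blast
  note c' = is_productD[OF pr']
  have wA: "w \<in> Ar C" "Dom C w = Q" "Cod C w = P" using w by (auto simp: Hom_def)
  have uA: "u \<in> Ar C" "Cod C u = x" using in_Sub[OF U u] monoD by auto
  have vm: "mono C v" "Cod C v = y" "factors C (Idn C y) v"
    using v c by (auto simp: full_sub_eq in_sub_of_iff mono_Idn)
  then have vA: "v \<in> Ar C" by (simp add: monoD)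
  \<comment> \<open>A representative of the full subobject is an isomorphism.\<close>
  obtain v' where v': "v' \<in> Ar C" "Cod C v' = Dom C v" "Idn C y = v \<cdot> v'"
    using vm(3) vA factors_iff by blast
  have v'D: "Dom C v' = y"
    using v' vA c(9) by (metis Cmp_simps(2) Idn_simps(2))
  have "\<exists>!h. h \<in> Hom C z (Dom C w) \<and> w \<cdot> h = s \<and> p' \<cdot> h = t"
    if "z \<in> Ob C" "s \<in> Hom C z (Dom C p)" "t \<in> Hom C z (Dom C u)" "p \<cdot> s = u \<cdot> t" for z s t
  proof -
    have s: "s \<in> Ar C" "Dom C s = z" "Cod C s = P" and t: "t \<in> Ar C" "Dom C t = z" "Cod C t = Dom C u"
      using that c by (auto simp: Hom_def)
    obtain h where h: "h \<in> Ar C" "Dom C h = z" "Cod C h = Q" "p' \<cdot> h = t" "q' \<cdot> h = v' \<cdot> (q \<cdot> s)"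
      using is_product_lift[OF pr', of t "v' \<cdot> (q \<cdot> s)"] s t v' v'D c by auto
    have "p \<cdot> (w \<cdot> h) = p \<cdot> s"
      using Cmp_square[of p w u p' h] e(1) h s t c c' wA uA that(4) by simp
    moreover have "q \<cdot> (w \<cdot> h) = q \<cdot> s"
    proof -
      have "q \<cdot> (w \<cdot> h) = v \<cdot> (q' \<cdot> h)"
        using Cmp_square[of q w v q' h] e(2) h c c' wA vA vm(2) by simp
      also have "\<dots> = (v \<cdot> v') \<cdot> (q \<cdot> s)"
        unfolding h(5) using s v' v'D c vA by (intro Cmp_assoc[symmetric]) auto
      also have "\<dots> = q \<cdot> s" unfolding v'(3)[symmetric] using c s by simp
      finally show ?thesis .
    qed
    ultimately have wh: "w \<cdot> h = s"
      using h s wA by - (rule is_product_unique[OF pr], auto)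
    moreover have "k = h" if k: "k \<in> Hom C z (Dom C w)" "w \<cdot> k = s" "p' \<cdot> k = t" for k
    proof -
      have kA: "k \<in> Ar C" "Dom C k = z" "Cod C k = Q" using k wA by (auto simp: Hom_def)
      have "v \<cdot> (q' \<cdot> k) = v \<cdot> (q' \<cdot> h)"
        using Cmp_square[of q w v q' h] Cmp_square[of q w v q' k] e(2) h(1-3) kA c c' wA vA vm(2) wh k(2)
        by simp
      then have "q' \<cdot> k = q' \<cdot> h"
        using h(1-3) kA c' vA by - (rule mono_cancel[OF vm(1)], auto)
      then show "k = h"
        using h kA k by - (rule is_product_unique[OF pr'], auto)
    qed
    moreover have "h \<in> Hom C z (Dom C w)" using h wA by (simp add: Hom_def)
    ultimately show ?thesis using h(4) by blast
  qed
  then have "is_pullback C p u w p'"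
    unfolding is_pullback_def using c c' wA uA e by simp
  with u show "w \<in> sub_pullback C p U" unfolding sub_pullback_def by blast
next
  note c = is_productD[OF pr]
  fix w
  assume "w \<in> sub_pullback C p U"
  then obtain u r where u: "u \<in> U" and pb: "is_pullback C p u w r"
    unfolding sub_pullback_def by blast
  note d = is_pullbackD[OF pb]
  have "\<exists>!h. h \<in> Hom C z (Dom C w) \<and> r \<cdot> h = f \<and> (q \<cdot> w) \<cdot> h = g"
    if "z \<in> Ob C" "f \<in> Hom C z (Dom C u)" "g \<in> Hom C z y" for z f g
  proof -
    have f: "f \<in> Ar C" "Dom C f = z" "Cod C f = Dom C u" and g: "g \<in> Ar C" "Dom C g = z" "Cod C g = y"
      using that by (auto simp: Hom_def)
    obtain k where k: "k \<in> Ar C" "Dom C k = z" "Cod C k = P" "p \<cdot> k = u \<cdot> f" "q \<cdot> k = g"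
      using is_product_lift[OF pr, of "u \<cdot> f" g] f g c d by auto
    obtain h where h: "h \<in> Ar C" "Dom C h = z" "Cod C h = Dom C w" "w \<cdot> h = k" "r \<cdot> h = f"
      using is_pullback_lift[OF pb, of k f] k f c d by auto
    have "(q \<cdot> w) \<cdot> h = g" using h k c d by simp
    moreover have "h' = h" if h': "h' \<in> Hom C z (Dom C w)" "r \<cdot> h' = f" "(q \<cdot> w) \<cdot> h' = g" for h'
    proof -
      have h'A: "h' \<in> Ar C" "Dom C h' = z" "Cod C h' = Dom C w" using h' by (auto simp: Hom_def)
      have "p \<cdot> (w \<cdot> h') = p \<cdot> k"
        using Cmp_square[of p w u r h'] h'A h' d k by simp
      moreover have "q \<cdot> (w \<cdot> h') = q \<cdot> k" using h' h'A c d k by simp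
      ultimately have "w \<cdot> h' = k"
        using h'A k c d by - (rule is_product_unique[OF pr], auto)
      then show "h' = h"
        using h h' h'A d by - (rule is_pullback_unique[OF pb], auto)
    qed
    moreover have "h \<in> Hom C z (Dom C w)" using h by (simp add: Hom_def)
    ultimately show ?thesis using h(5) by blast
  qed
  moreover have "Dom C w \<in> Ob C" "r \<in> Hom C (Dom C w) (Dom C u)" "q \<cdot> w \<in> Hom C (Dom C w) y"
    "Dom C (Idn C y) = y"
    using c d by (auto simp: Hom_def)
  ultimately have "is_product C (Dom C u) (Dom C (Idn C y)) (Dom C w) r (q \<cdot> w)"
    unfolding is_product_def by (intro conjI ballI) simp_all
  moreover have "w \<in> Hom C (Dom C w) P" using c d by (simp add: Hom_def)
  moreover have "q \<cdot> w = Idn C y \<cdot> (q \<cdot> w)" using c d by simp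
  moreover have "Idn C y \<in> full_sub C y"
    using c by (simp add: full_sub_eq in_sub_of_iff mono_Idn)
  ultimately show "w \<in> sub_prod C P p q U (full_sub C y)"
    unfolding sub_prod_def using u d(9) by blast
qed

lemma sub_prod_swap: "sub_prod C P p q U V = sub_prod C P q p V U"
  unfolding sub_prod_def by (blast intro: is_product_swap)

lemma sub_prod_full_left:
  assumes "is_product C x y P p q" and "V \<in> carrier (Sub C y)"
  shows "sub_prod C P p q (full_sub C x) V = sub_pullback C q V"
  using sub_prod_full_right[OF is_product_swap] assms sub_prod_swap by metis

end

locale finite_limit_functor = C: small_category C + D: small_category D
  for C :: "('o, 'm) cat" and D :: "('p, 'n) cat" and F :: "('o, 'm, 'p, 'n) func" +
  assumes is_functor: "is_functor C D F" and preserves: "preserves_finite_limits C D F"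
begin

lemma functor_simps [simp]:
  "x \<in> Ob C \<Longrightarrow> fo F x \<in> Ob D"
  "f \<in> Ar C \<Longrightarrow> fa F f \<in> Ar D"
  "f \<in> Ar C \<Longrightarrow> Dom D (fa F f) = fo F (Dom C f)"
  "f \<in> Ar C \<Longrightarrow> Cod D (fa F f) = fo F (Cod C f)"
  "x \<in> Ob C \<Longrightarrow> fa F (Idn C x) = Idn D (fo F x)"
  "f \<in> Ar C \<Longrightarrow> g \<in> Ar C \<Longrightarrow> Dom C g = Cod C f \<Longrightarrow> fa F (g \<cdot>\<^bsub>C\<^esub> f) = fa F g \<cdot>\<^bsub>D\<^esub> fa F f"
  using is_functor unfolding is_functor_def Hom_def by auto

lemma preserves_product:
  assumes "is_product C x y P p q"
  shows "is_product D (fo F x) (fo F y) (fo F P) (fa F p) (fa F q)"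
proof -
  define T where "T = (\<lparr>fo = \<lambda>i. if i = 0 then x else y, fa = \<lambda>i. Idn C (if i = 0 then x else y)\<rparr>
    :: (nat, nat, 'o, 'm) func)"
  have T: "is_functor (discrete 2) C T"
    unfolding T_def using C.is_productD[OF assms] by (intro C.is_functor_discrete) auto
  have "is_limit C (discrete 2) T P (\<lambda>i. if i = 0 then p else q)"
    unfolding C.is_limit_discrete_2[OF T] using assms by (simp add: T_def)
  then have "is_limit D (discrete 2) (fcomp F T) (fo F P) (fa F \<circ> (\<lambda>i. if i = 0 then p else q))"
    using preserves T finite_category_discrete unfolding preserves_finite_limits_def by blast
  then show ?thesis
    unfolding D.is_limit_discrete_2[OF is_functor_fcomp[OF T is_functor]]
    by (simp add: T_def fcomp_def)
qed

lemma preserves_pullback: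
  assumes "is_pullback C f v w q"
  shows "is_pullback D (fa F f) (fa F v) (fa F w) (fa F q)"
proof -
  note c = C.is_pullbackD[OF assms]
  define T where "T = (\<lparr>fo = \<lambda>i. if i = 0 then Dom C f else if i = 1 then Dom C v else Cod C f,
     fa = \<lambda>j. if j = 3 then f else if j = 4 then v else
       Idn C (if j = 0 then Dom C f else if j = 1 then Dom C v else Cod C f)\<rparr> :: (nat, nat, 'o, 'm) func)"
  have T: "is_functor cospan C T"
    unfolding T_def using c by (intro C.is_functor_cospan) auto
  let ?\<pi> = "\<lambda>i::nat. if i = 0 then w else if i = 1 then q else f \<cdot>\<^bsub>C\<^esub> w"
  have "is_limit C cospan T (Dom C w) ?\<pi>"
    unfolding C.is_limit_cospan[OF T] using assms by (simp add: T_def)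
  then have "is_limit D cospan (fcomp F T) (fo F (Dom C w)) (fa F \<circ> ?\<pi>)"
    using preserves T finite_category_cospan unfolding preserves_finite_limits_def by blast
  then show ?thesis
    unfolding D.is_limit_cospan[OF is_functor_fcomp[OF T is_functor]]
    by (simp add: T_def fcomp_def)
qed

end

section \<open>The subobject lattices of a coherent category\<close>

locale coherent =
  fixes C :: "('o, 'm) cat" (structure)
  assumes coherent: "coherent_category C"

sublocale coherent \<subseteq> small_category
  using coherent by unfold_locales (simp add: coherent_category_def)

context coherent
begin

lemma finite_limit_exists:
  "finite_category (J :: (nat, nat) cat) \<Longrightarrow> is_functor J C T \<Longrightarrow> \<exists>l \<pi>. is_limit C J T l \<pi>"
proof -
  assume J: "finite_category J" "is_functor J C T"
  have "has_finite_limits C"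
    using coherent unfolding coherent_category_def by (elim conjE)
  with J show "\<exists>l \<pi>. is_limit C J T l \<pi>"
    unfolding has_finite_limits_def by simp
qed

lemma pullback_exists:
  assumes "f \<in> Ar C" "v \<in> Ar C" "Cod C f = Cod C v"
  obtains w q where "is_pullback C f v w q"
proof -
  note T = is_functor_cospan[OF assms]
  obtain l \<pi> where "is_limit C cospan
    \<lparr>fo = \<lambda>i. if i = 0 then Dom C f else if i = 1 then Dom C v else Cod C f,
     fa = \<lambda>j. if j = 3 then f else if j = 4 then v else
       Idn C (if j = 0 then Dom C f else if j = 1 then Dom C v else Cod C f)\<rparr> l \<pi>"
    using finite_limit_exists[OF finite_category_cospan T] by (elim exE)
  then have "is_pullback C f v (\<pi> 0) (\<pi> 1)"
    using is_limit_cospan[OF T] by simp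
  then show ?thesis by (rule that)
qed

lemma product_exists:
  assumes "x \<in> Ob C" "y \<in> Ob C"
  obtains P p q where "is_product C x y P p q"
proof -
  define X where "X = (\<lambda>i::nat. if i = 0 then x else y)"
  have T: "is_functor (discrete 2) C \<lparr>fo = X, fa = \<lambda>i. Idn C (X i)\<rparr>"
    using assms by (intro is_functor_discrete) (simp add: X_def)
  obtain l \<pi> where "is_product C x y l (\<pi> 0) (\<pi> (1::nat))"
    using finite_limit_exists[OF finite_category_discrete T] unfolding is_limit_discrete_2[OF T]
    by (auto simp: X_def)
  then show ?thesis by (rule that)
qed

lemma sub_pullback_lies_in:
  assumes "f \<in> Ar C" and V: "V \<in> carrier (Sub C (Cod C f))"
  shows "sub_pullback C f V \<in> carrier (Sub C (Dom C f))"
    and "lies_in C s (sub_pullback C f V) \<longleftrightarrow> s \<in> Ar C \<and> Cod C s = Dom C f \<and> lies_in C (f \<cdot> s) V"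
proof -
  obtain v where v: "mono C v" "Cod C v = Cod C f" "V = sub_of C v" "v \<in> Ar C"
    using Sub_nonempty[OF V] by metis
  obtain w q where pb: "is_pullback C f v w q"
    using pullback_exists assms v by metis
  have w: "mono C w" "Cod C w = Dom C f" "w \<in> Ar C" "sub_pullback C f V = sub_of C w"
    using is_pullback_mono[OF pb v(1)] is_pullbackD[OF pb] is_pullback_sub_pullback[OF pb v(1)] v by auto
  then show "sub_pullback C f V \<in> carrier (Sub C (Dom C f))" by simp
  show "lies_in C s (sub_pullback C f V) \<longleftrightarrow> s \<in> Ar C \<and> Cod C s = Dom C f \<and> lies_in C (f \<cdot> s) V"
    using w v is_pullback_factors[OF pb, of s] factors_type[of s w] by auto
qed

text \<open>The diagonal of the pullback square of two monomorphisms represents their meet.\<close>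

lemma pullback_of_monos_lies_in:
  assumes pb: "is_pullback C u v w q" and "mono C u" "mono C v"
  shows "mono C (u \<cdot> w)" "factors C s (u \<cdot> w) \<longleftrightarrow> factors C s u \<and> factors C s v"
proof -
  note c = is_pullbackD[OF pb]
  show m: "mono C (u \<cdot> w)"
    using is_pullback_mono[OF pb] assms c by (intro mono_Cmp) auto
  have "factors C (u \<cdot> w) u" using c by (intro factorsI) auto
  moreover have "factors C (u \<cdot> w) v" unfolding c(9) using c by (intro factorsI) auto
  moreover have "factors C s (u \<cdot> w)" if s: "factors C s u" "factors C s v"
  proof -
    obtain t where t: "t \<in> Ar C" "Cod C t = Dom C u" "s = u \<cdot> t"
      using s c factors_iff[of u] by auto
    with s have "factors C t w"
      using is_pullback_factors[OF pb] by auto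
    then obtain r where r: "r \<in> Ar C" "Cod C r = Dom C w" "t = w \<cdot> r"
      using c factors_iff[of w] by auto
    have "s = (u \<cdot> w) \<cdot> r"
      unfolding t r by (rule Cmp_assoc[symmetric]) (use r c in auto)
    then show ?thesis
      using r c by (metis Cmp_simps(1,2) factorsI)
  qed
  ultimately show "factors C s (u \<cdot> w) \<longleftrightarrow> factors C s u \<and> factors C s v"
    using factors_trans c by blast
qed

lemma Sub_meet:
  assumes U: "U \<in> carrier (Sub C x)" and V: "V \<in> carrier (Sub C x)"
  shows "U \<sqinter>\<^bsub>Sub C x\<^esub> V \<in> carrier (Sub C x)"
    and "lies_in C s (U \<sqinter>\<^bsub>Sub C x\<^esub> V) \<longleftrightarrow> lies_in C s U \<and> lies_in C s V"
    and "greatest (Sub C x) (U \<sqinter>\<^bsub>Sub C x\<^esub> V) (Lower (Sub C x) {U, V})"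
proof -
  obtain u where u: "mono C u" "Cod C u = x" "U = sub_of C u" "u \<in> Ar C"
    using Sub_nonempty[OF U] by metis
  obtain v where v: "mono C v" "Cod C v = x" "V = sub_of C v" "v \<in> Ar C"
    using Sub_nonempty[OF V] by metis
  obtain w q where pb: "is_pullback C u v w q"
    using pullback_exists[of u v] u v by metis
  note m = pullback_of_monos_lies_in[OF pb u(1) v(1)]
  let ?W = "sub_of C (u \<cdot> w)"
  have W: "?W \<in> carrier (Sub C x)"
    using m u is_pullbackD[OF pb] by simp
  have li: "lies_in C t ?W \<longleftrightarrow> lies_in C t U \<and> lies_in C t V" for t
    using m(2) u v by (simp add: m(1))
  have "greatest (Sub C x) ?W (Lower (Sub C x) {U, V})" "U \<sqinter>\<^bsub>Sub C x\<^esub> V = ?W"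
    using U V W by (intro meet_eqI[OF Sub_partial_order]; simp add: Sub_le_iff li)+
  then show "U \<sqinter>\<^bsub>Sub C x\<^esub> V \<in> carrier (Sub C x)"
    "lies_in C s (U \<sqinter>\<^bsub>Sub C x\<^esub> V) \<longleftrightarrow> lies_in C s U \<and> lies_in C s V"
    "greatest (Sub C x) (U \<sqinter>\<^bsub>Sub C x\<^esub> V) (Lower (Sub C x) {U, V})"
    using W li by auto
qed

lemma union_exists:
  "x \<in> Ob C \<Longrightarrow> A \<subseteq> carrier (Sub C x) \<Longrightarrow> finite A \<Longrightarrow> \<exists>W. is_union C x A W"
  using coherent unfolding coherent_category_def by blast

lemma union_pullback:
  "f \<in> Ar C \<Longrightarrow> is_union C (Cod C f) A W \<Longrightarrow>
    is_union C (Dom C f) (sub_pullback C f ` A) (sub_pullback C f W)"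
  using coherent unfolding coherent_category_def by blast

lemma is_union_pair: "is_union C x {U, V} W \<Longrightarrow> U \<squnion>\<^bsub>Sub C x\<^esub> V = W"
proof -
  assume "is_union C x {U, V} W"
  then have l: "least (Sub C x) W (Upper (Sub C x) {U, V})" and UV: "U \<in> carrier (Sub C x)" "V \<in> carrier (Sub C x)"
    unfolding is_union_def by auto
  show ?thesis
    by (rule join_eqI(2)[OF Sub_partial_order UV])
      (use l UV least_Upper_above[OF l] least_le[OF l] in \<open>auto simp: Upper_def\<close>)
qed

lemma is_union_empty: "is_union C x {} W \<Longrightarrow> \<bottom>\<^bsub>Sub C x\<^esub> = W"
  by (rule bottom_eqI(2)[OF Sub_partial_order]) (auto simp: is_union_def least_def)

lemma Sub_join:
  assumes U: "U \<in> carrier (Sub C x)" and V: "V \<in> carrier (Sub C x)"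
  shows "is_union C x {U, V} (U \<squnion>\<^bsub>Sub C x\<^esub> V)"
proof -
  have "x \<in> Ob C" using Sub_nonempty[OF U] Dom_Cod_Ob(2) by metis
  then obtain W where "is_union C x {U, V} W"
    using union_exists[of x "{U, V}"] assms by auto
  with is_union_pair show ?thesis by metis
qed

lemma Sub_bottom: "x \<in> Ob C \<Longrightarrow> is_union C x {} \<bottom>\<^bsub>Sub C x\<^esub>"
  using union_exists[of x "{}"] is_union_empty[of x] by auto

lemma Sub_join_le_iff:
  assumes U: "U \<in> carrier (Sub C x)" and V: "V \<in> carrier (Sub C x)" and W: "W \<in> carrier (Sub C x)"
  shows "U \<squnion>\<^bsub>Sub C x\<^esub> V \<sqsubseteq>\<^bsub>Sub C x\<^esub> W \<longleftrightarrow> U \<sqsubseteq>\<^bsub>Sub C x\<^esub> W \<and> V \<sqsubseteq>\<^bsub>Sub C x\<^esub> W"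
proof -
  have l: "least (Sub C x) (U \<squnion>\<^bsub>Sub C x\<^esub> V) (Upper (Sub C x) {U, V})"
    using Sub_join[OF U V] unfolding is_union_def by blast
  then have J: "U \<squnion>\<^bsub>Sub C x\<^esub> V \<in> carrier (Sub C x)" by simp
  have "U \<sqsubseteq>\<^bsub>Sub C x\<^esub> U \<squnion>\<^bsub>Sub C x\<^esub> V" "V \<sqsubseteq>\<^bsub>Sub C x\<^esub> U \<squnion>\<^bsub>Sub C x\<^esub> V"
    using least_Upper_above[OF l] U V by auto
  moreover have "U \<squnion>\<^bsub>Sub C x\<^esub> V \<sqsubseteq>\<^bsub>Sub C x\<^esub> W" if "U \<sqsubseteq>\<^bsub>Sub C x\<^esub> W" "V \<sqsubseteq>\<^bsub>Sub C x\<^esub> W"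
    using least_le[OF l, of W] W that by (auto simp: Upper_def)
  ultimately show ?thesis
    using J U V W by (auto simp: Sub_le_iff)
qed

text \<open>Meeting with the subobject of \<open>u\<close> is pullback along \<open>u\<close> followed by composition with \<open>u\<close>,
  and composition with \<open>u\<close> is left adjoint to pullback. Joins are preserved by the former through
  stability and by the latter as a left adjoint: this is why subobject lattices are distributive.\<close>

lemma Sub_meet_le_iff:
  assumes u: "mono C u" and V: "V \<in> carrier (Sub C (Cod C u))" and T: "T \<in> carrier (Sub C (Cod C u))"
  shows "sub_of C u \<sqinter>\<^bsub>Sub C (Cod C u)\<^esub> V \<sqsubseteq>\<^bsub>Sub C (Cod C u)\<^esub> T \<longleftrightarrow>
    sub_pullback C u V \<sqsubseteq>\<^bsub>Sub C (Dom C u)\<^esub> sub_pullback C u T"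
proof -
  have uA: "u \<in> Ar C" and U: "sub_of C u \<in> carrier (Sub C (Cod C u))" using u monoD by auto
  have "(\<forall>s. factors C s u \<and> lies_in C s V \<longrightarrow> lies_in C s T) \<longleftrightarrow>
    (\<forall>s. s \<in> Ar C \<and> Cod C s = Dom C u \<and> lies_in C (u \<cdot> s) V \<longrightarrow> lies_in C (u \<cdot> s) T)"
    using uA factorsI factors_iff[OF uA] by metis
  then show ?thesis
    using u uA U V T by (simp add: Sub_le_iff Sub_meet sub_pullback_lies_in)
qed

lemma sub_pullback_join:
  assumes "f \<in> Ar C" "V \<in> carrier (Sub C (Cod C f))" "W \<in> carrier (Sub C (Cod C f))"
  shows "sub_pullback C f (V \<squnion>\<^bsub>Sub C (Cod C f)\<^esub> W) =
    sub_pullback C f V \<squnion>\<^bsub>Sub C (Dom C f)\<^esub> sub_pullback C f W"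
  using union_pullback[OF assms(1) Sub_join[OF assms(2,3)]] is_union_pair by fastforce

lemma Sub_distributive:
  assumes "x \<in> Ob C"
  shows "distributive_lattice (Sub C x)"
proof (rule distributive_latticeI[OF Sub_partial_order])
  fix U V W
  assume UVW: "U \<in> carrier (Sub C x)" "V \<in> carrier (Sub C x)" "W \<in> carrier (Sub C x)"
  then obtain u where u: "mono C u" "Cod C u = x" "U = sub_of C u" "u \<in> Ar C"
    using Sub_nonempty by metis
  have join_closed: "A \<squnion>\<^bsub>Sub C z\<^esub> B \<in> carrier (Sub C z)"
    if "A \<in> carrier (Sub C z)" "B \<in> carrier (Sub C z)" for A B z
    using Sub_join[OF that] unfolding is_union_def by blast
  let ?T = "U \<sqinter>\<^bsub>Sub C x\<^esub> V \<squnion>\<^bsub>Sub C x\<^esub> U \<sqinter>\<^bsub>Sub C x\<^esub> W"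
  have T: "?T \<in> carrier (Sub C x)" using UVW by (simp add: join_closed Sub_meet)
  then have "U \<sqinter>\<^bsub>Sub C x\<^esub> V \<sqsubseteq>\<^bsub>Sub C x\<^esub> ?T" "U \<sqinter>\<^bsub>Sub C x\<^esub> W \<sqsubseteq>\<^bsub>Sub C x\<^esub> ?T"
    using UVW Sub_join_le_iff[of "U \<sqinter>\<^bsub>Sub C x\<^esub> V" x "U \<sqinter>\<^bsub>Sub C x\<^esub> W" ?T] Sub_meet(1)
      partial_order.axioms(1)[OF Sub_partial_order] weak_partial_order.le_refl by metis+
  then have "sub_pullback C u V \<sqsubseteq>\<^bsub>Sub C (Dom C u)\<^esub> sub_pullback C u ?T"
    "sub_pullback C u W \<sqsubseteq>\<^bsub>Sub C (Dom C u)\<^esub> sub_pullback C u ?T"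
    using Sub_meet_le_iff u UVW T by metis+
  then have "sub_pullback C u (V \<squnion>\<^bsub>Sub C x\<^esub> W) \<sqsubseteq>\<^bsub>Sub C (Dom C u)\<^esub> sub_pullback C u ?T"
    using sub_pullback_join[of u V W] u UVW T
      Sub_join_le_iff[of "sub_pullback C u V" "Dom C u" "sub_pullback C u W"]
      sub_pullback_lies_in(1) by metis
  then show "U \<sqinter>\<^bsub>Sub C x\<^esub> (V \<squnion>\<^bsub>Sub C x\<^esub> W) \<sqsubseteq>\<^bsub>Sub C x\<^esub> ?T"
    using Sub_meet_le_iff u UVW T join_closed by metis
next
  show "\<exists>t. least (Sub C x) t (carrier (Sub C x))"
    using Sub_bottom[OF assms] unfolding is_union_def Upper_empty by blast
  show "\<exists>t. greatest (Sub C x) t (carrier (Sub C x))"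
    using Sub_top(3)[OF assms] by (rule exI)
  fix U V
  assume UV: "U \<in> carrier (Sub C x)" "V \<in> carrier (Sub C x)"
  show "\<exists>g. greatest (Sub C x) g (Lower (Sub C x) {U, V})"
    using Sub_meet(3)[OF UV] by (rule exI)
  show "\<exists>g. least (Sub C x) g (Upper (Sub C x) {U, V})"
    using Sub_join[OF UV] unfolding is_union_def by blast
qed

definition pullback_map :: "'m \<Rightarrow> 'm set \<Rightarrow> 'm set" where
  "pullback_map f = (\<lambda>V\<in>carrier (Sub C (Cod C f)). sub_pullback C f V)"

lemma pullback_map_hom:
  assumes f: "f \<in> Ar C"
  shows "pullback_map f \<in> dlat_hom (Sub C (Cod C f)) (Sub C (Dom C f))"
proof (rule dlat_homI)
  show L: "distributive_lattice (Sub C (Cod C f))" "distributive_lattice (Sub C (Dom C f))"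
    using f by (simp_all add: Sub_distributive)
  show "pullback_map f \<in> extensional (carrier (Sub C (Cod C f)))" by (simp add: pullback_map_def)
  fix V W
  assume V: "V \<in> carrier (Sub C (Cod C f))"
  then show "pullback_map f V \<in> carrier (Sub C (Dom C f))"
    using f by (simp add: pullback_map_def sub_pullback_lies_in)
  assume W: "W \<in> carrier (Sub C (Cod C f))"
  show "pullback_map f (V \<squnion>\<^bsub>Sub C (Cod C f)\<^esub> W) = pullback_map f V \<squnion>\<^bsub>Sub C (Dom C f)\<^esub> pullback_map f W"
    using f V W by (simp add: pullback_map_def sub_pullback_join distributive_lattice_closed[OF L(1)])
  show "pullback_map f (V \<sqinter>\<^bsub>Sub C (Cod C f)\<^esub> W) = pullback_map f V \<sqinter>\<^bsub>Sub C (Dom C f)\<^esub> pullback_map f W"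
    using f V W by (intro Sub_eqI[of _ "Dom C f"])
      (auto simp: pullback_map_def sub_pullback_lies_in Sub_meet)
next
  show "pullback_map f \<top>\<^bsub>Sub C (Cod C f)\<^esub> = \<top>\<^bsub>Sub C (Dom C f)\<^esub>"
    using f by (intro Sub_eqI[of _ "Dom C f"])
      (auto simp: pullback_map_def sub_pullback_lies_in Sub_top)
  have b: "is_union C (Dom C f) {} (sub_pullback C f \<bottom>\<^bsub>Sub C (Cod C f)\<^esub>)"
    using union_pullback[OF f Sub_bottom] f by simp
  show "pullback_map f \<bottom>\<^bsub>Sub C (Cod C f)\<^esub> = \<bottom>\<^bsub>Sub C (Dom C f)\<^esub>"
    using is_union_empty[OF b] distributive_lattice_closed(2)[OF Sub_distributive[of "Cod C f"]] f
    by (simp add: pullback_map_def)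
qed

end

section \<open>Coherent functors act on subobjects\<close>

context finite_limit_functor
begin

text \<open>An arrow is monic iff it is its own pullback along itself, with identities as projections;
  finite limit preservation carries this over.\<close>

lemma preserves_mono:
  assumes "mono C u"
  shows "mono D (fa F u)"
proof -
  have u: "u \<in> Ar C" using assms C.monoD by blast
  let ?i = "Idn C (Dom C u)"
  have "is_pullback C u u ?i ?i"
    unfolding is_pullback_def
  proof (intro conjI ballI impI)
    fix z s t
    assume *: "z \<in> Ob C" "s \<in> Hom C z (Dom C u)" "t \<in> Hom C z (Dom C u)" "u \<cdot>\<^bsub>C\<^esub> s = u \<cdot>\<^bsub>C\<^esub> t"
    then have "t = s" using assms unfolding mono_def by blast
    moreover have "?i \<cdot>\<^bsub>C\<^esub> h = h" if "h \<in> Hom C z (Dom C u)" for h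
      using that by (simp add: Hom_def)
    moreover have "Dom C ?i = Dom C u" using u by simp
    ultimately show "\<exists>!h. h \<in> Hom C z (Dom C ?i) \<and> ?i \<cdot>\<^bsub>C\<^esub> h = s \<and> ?i \<cdot>\<^bsub>C\<^esub> h = t"
      using *(2) by metis
  qed (use u in simp_all)
  from preserves_pullback[OF this] u
  have pb: "is_pullback D (fa F u) (fa F u) (Idn D (fo F (Dom C u))) (Idn D (fo F (Dom C u)))"
    by simp
  show ?thesis
  proof (rule D.monoI)
    fix g h
    assume *: "g \<in> Ar D" "h \<in> Ar D" "Cod D g = Dom D (fa F u)" "Cod D h = Dom D (fa F u)"
      "Dom D g = Dom D h" "fa F u \<cdot>\<^bsub>D\<^esub> g = fa F u \<cdot>\<^bsub>D\<^esub> h"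
    then obtain k where "k \<in> Ar D" "Cod D k = Dom D (Idn D (fo F (Dom C u)))"
      "Idn D (fo F (Dom C u)) \<cdot>\<^bsub>D\<^esub> k = g" "Idn D (fo F (Dom C u)) \<cdot>\<^bsub>D\<^esub> k = h"
      using D.is_pullback_lift[OF pb, of g h] by metis
    then show "g = h" by simp
  qed (use u in simp)
qed

lemma preserves_factors:
  assumes "factors C s v" "v \<in> Ar C"
  shows "factors D (fa F s) (fa F v)"
proof -
  obtain g where "g \<in> Ar C" "Cod C g = Dom C v" "s = v \<cdot>\<^bsub>C\<^esub> g"
    using assms C.factors_iff by blast
  then show ?thesis using assms by (simp add: D.factorsI)
qed

lemma sub_image_sub_of:
  assumes u: "mono C u"
  shows "sub_image D F (sub_of C u) = sub_of D (fa F u)"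
proof -
  have "subobj_rel D (Cod D (fa F v)) `` {fa F v} = sub_of D (fa F u)" if v: "v \<in> sub_of C u" for v
  proof -
    have v': "mono C v" "Cod C v = Cod C u" "factors C u v" "factors C v u"
      using v C.in_sub_of_iff[OF u] by auto
    have "fa F u \<in> sub_of D (fa F v)"
      using v' u C.monoD[of u] C.monoD[of v]
      by (simp add: D.in_sub_of_iff preserves_mono preserves_factors)
    moreover have "sub_of D (fa F v) \<in> carrier (Sub D (Cod D (fa F v)))"
      using v' by (simp add: preserves_mono)
    ultimately have "sub_of D (fa F v) = sub_of D (fa F u)"
      using D.in_Sub(3) by blast
    then show ?thesis by (simp add: sub_of_def)
  qed
  moreover have "u \<in> sub_of C u" using u C.in_sub_of_iff C.monoD by auto
  ultimately show ?thesis unfolding sub_image_def by blast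
qed

lemma sub_image_closed:
  assumes "U \<in> carrier (Sub C x)"
  shows "sub_image D F U \<in> carrier (Sub D (fo F x))"
proof -
  obtain u where "mono C u" "Cod C u = x" "U = sub_of C u" "u \<in> Ar C"
    using C.Sub_nonempty[OF assms] by metis
  then show ?thesis by (simp add: sub_image_sub_of preserves_mono)
qed

end

locale coherent_functor_between = C: coherent C + D: coherent D
  for C :: "('o, 'm) cat" and D :: "('p, 'n) cat" and F :: "('o, 'm, 'p, 'n) func" +
  assumes coherent_functor: "coherent_functor C D F"

sublocale coherent_functor_between \<subseteq> finite_limit_functor C D F
  using coherent_functor by unfold_locales (simp_all add: coherent_functor_def)

context coherent_functor_between
begin

lemma sub_image_pullback:
  assumes f: "f \<in> Ar C" and V: "V \<in> carrier (Sub C (Cod C f))"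
  shows "sub_image D F (sub_pullback C f V) = sub_pullback D (fa F f) (sub_image D F V)"
proof -
  obtain v where v: "mono C v" "Cod C v = Cod C f" "V = sub_of C v" "v \<in> Ar C"
    using C.Sub_nonempty[OF V] by metis
  obtain w q where pb: "is_pullback C f v w q"
    using C.pullback_exists[of f v] f v by metis
  have "mono C w" using C.is_pullback_mono[OF pb v(1)] .
  then show ?thesis
    using C.is_pullback_sub_pullback[OF pb v(1)] v
      D.is_pullback_sub_pullback[OF preserves_pullback[OF pb] preserves_mono[OF v(1)]]
    by (simp add: sub_image_sub_of)
qed

lemma sub_image_meet:
  assumes U: "U \<in> carrier (Sub C x)" and V: "V \<in> carrier (Sub C x)"
  shows "sub_image D F (U \<sqinter>\<^bsub>Sub C x\<^esub> V) = sub_image D F U \<sqinter>\<^bsub>Sub D (fo F x)\<^esub> sub_image D F V"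
proof -
  obtain u where u: "mono C u" "Cod C u = x" "U = sub_of C u" "u \<in> Ar C"
    using C.Sub_nonempty[OF U] by metis
  obtain v where v: "mono C v" "Cod C v = x" "V = sub_of C v" "v \<in> Ar C"
    using C.Sub_nonempty[OF V] by metis
  obtain w q where pb: "is_pullback C u v w q"
    using C.pullback_exists[of u v] u v by metis
  note m = C.pullback_of_monos_lies_in[OF pb u(1) v(1)]
  note m' = D.pullback_of_monos_lies_in[OF preserves_pullback[OF pb]
    preserves_mono[OF u(1)] preserves_mono[OF v(1)]]
  note c = C.is_pullbackD[OF pb]
  have "U \<sqinter>\<^bsub>Sub C x\<^esub> V = sub_of C (u \<cdot>\<^bsub>C\<^esub> w)"
    by (rule C.Sub_eqI[of _ x])
      (use U V u v m c in \<open>auto simp: C.Sub_meet\<close>)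
  then have "sub_image D F (U \<sqinter>\<^bsub>Sub C x\<^esub> V) = sub_of D (fa F u \<cdot>\<^bsub>D\<^esub> fa F w)"
    using c(1-8) m(1) by (simp add: sub_image_sub_of)
  also have "\<dots> = sub_image D F U \<sqinter>\<^bsub>Sub D (fo F x)\<^esub> sub_image D F V"
    by (rule D.Sub_eqI[of _ "fo F x"])
      (use u v m' c in \<open>auto simp: D.Sub_meet sub_image_sub_of preserves_mono\<close>)
  finally show ?thesis .
qed

definition image_map :: "'o \<Rightarrow> 'm set \<Rightarrow> 'n set" where
  "image_map x = (\<lambda>U\<in>carrier (Sub C x). sub_image D F U)"

lemma image_map_hom:
  assumes x: "x \<in> Ob C"
  shows "image_map x \<in> dlat_hom (Sub C x) (Sub D (fo F x))"
proof (rule dlat_homI)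
  have union: "is_union D (fo F x) (sub_image D F ` A) (sub_image D F W)" if "is_union C x A W" for A W
    using coherent_functor that unfolding coherent_functor_def by blast
  show L: "distributive_lattice (Sub C x)" "distributive_lattice (Sub D (fo F x))"
    using x by (simp_all add: C.Sub_distributive D.Sub_distributive)
  show "image_map x \<in> extensional (carrier (Sub C x))" by (simp add: image_map_def)
  fix U V
  assume U: "U \<in> carrier (Sub C x)"
  then show "image_map x U \<in> carrier (Sub D (fo F x))"
    by (simp add: image_map_def sub_image_closed)
  assume V: "V \<in> carrier (Sub C x)"
  show "image_map x (U \<sqinter>\<^bsub>Sub C x\<^esub> V) = image_map x U \<sqinter>\<^bsub>Sub D (fo F x)\<^esub> image_map x V"
    using U V by (simp add: image_map_def sub_image_meet C.Sub_meet)
  have "is_union D (fo F x) {sub_image D F U, sub_image D F V} (sub_image D F (U \<squnion>\<^bsub>Sub C x\<^esub> V))"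
    using union[OF C.Sub_join[OF U V]] by simp
  from D.is_union_pair[OF this]
  show "image_map x (U \<squnion>\<^bsub>Sub C x\<^esub> V) = image_map x U \<squnion>\<^bsub>Sub D (fo F x)\<^esub> image_map x V"
    using U V distributive_lattice_closed(4)[OF L(1) U V] by (simp add: image_map_def)
next
  have union: "is_union D (fo F x) (sub_image D F ` A) (sub_image D F W)" if "is_union C x A W" for A W
    using coherent_functor that unfolding coherent_functor_def by blast
  have b: "is_union D (fo F x) {} (sub_image D F \<bottom>\<^bsub>Sub C x\<^esub>)"
    using union[OF C.Sub_bottom[OF x]] by simp
  show "image_map x \<bottom>\<^bsub>Sub C x\<^esub> = \<bottom>\<^bsub>Sub D (fo F x)\<^esub>"
    using D.is_union_empty[OF b] distributive_lattice_closed(2)[OF C.Sub_distributive[OF x]]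
    by (simp add: image_map_def)
  have "image_map x \<top>\<^bsub>Sub C x\<^esub> = sub_image D F (full_sub C x)"
    using C.Sub_top[OF x] by (simp add: image_map_def)
  also have "\<dots> = \<top>\<^bsub>Sub D (fo F x)\<^esub>"
    using x by (simp add: C.full_sub_eq sub_image_sub_of C.mono_Idn D.Sub_top D.full_sub_eq)
  finally show "image_map x \<top>\<^bsub>Sub C x\<^esub> = \<top>\<^bsub>Sub D (fo F x)\<^esub>" .
qed

end

section \<open>Limits of sets through their elements\<close>

lemma category_SetCat: "category SetCat"
proof -
  have 1: "compose A f (\<lambda>u\<in>A. u) = f" and 2: "compose A (\<lambda>u\<in>B. u) f = f"
    if "f \<in> A \<rightarrow>\<^sub>E B" for f :: "'s \<Rightarrow> 's" and A B
    using that by (auto simp: fun_eq_iff compose_def PiE_def extensional_def Pi_def)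
  have 3: "compose A (compose B h g) f = compose A h (compose A g f)"
    if "f \<in> A \<rightarrow>\<^sub>E B" for f g h :: "'s \<Rightarrow> 's" and A B
    using that by (auto simp: fun_eq_iff compose_def)
  have 4: "compose A g f \<in> A \<rightarrow>\<^sub>E E" if "f \<in> A \<rightarrow>\<^sub>E B" "g \<in> B \<rightarrow>\<^sub>E E" for f g :: "'s \<Rightarrow> 's" and A B E
    using that by (auto simp: compose_def)
  show ?thesis
    unfolding category_def
    by (auto simp: SetCat_def Hom_def app_def 1 2 3 4)
qed

interpretation SetCat: small_category SetCat
  by unfold_locales (rule category_SetCat)

lemma SetCat_Ob: "A \<in> Ob SetCat"
  by (simp add: SetCat_def)

lemma SetCat_app:
  assumes "f \<in> Ar SetCat" "a \<in> Dom SetCat f"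
  shows "app f a \<in> Cod SetCat f"
  using assms by (auto simp: SetCat_def app_def)

lemma SetCat_Cmp_app: "a \<in> Dom SetCat f \<Longrightarrow> app (g \<cdot>\<^bsub>SetCat\<^esub> f) a = app g (app f a)"
  by (simp add: SetCat_def app_def compose_def)

lemma SetCat_Idn_app: "a \<in> A \<Longrightarrow> app (Idn SetCat A) a = a"
  by (simp add: SetCat_def app_def)

text \<open>A point of a set, as the generalised element that is constant on \<open>Z\<close>. Limits in \<open>SetCat\<close> are
  tested on points by taking a singleton for \<open>Z\<close>.\<close>

definition const_arrow :: "'s set \<Rightarrow> 's \<Rightarrow> 's set \<Rightarrow> 's set \<times> ('s \<Rightarrow> 's) \<times> 's set" where
  "const_arrow Z b B = (Z, \<lambda>_\<in>Z. b, B)"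

lemma const_arrow [simp]:
  assumes "b \<in> B"
  shows "const_arrow Z b B \<in> Ar SetCat" "Dom SetCat (const_arrow Z b B) = Z"
    "Cod SetCat (const_arrow Z b B) = B" "z \<in> Z \<Longrightarrow> app (const_arrow Z b B) z = b"
  using assms by (auto simp: const_arrow_def SetCat_def app_def)

lemma SetCat_Cmp_const_arrow:
  assumes "f \<in> Ar SetCat" "b \<in> Dom SetCat f"
  shows "f \<cdot>\<^bsub>SetCat\<^esub> const_arrow Z b (Dom SetCat f) = const_arrow Z (app f b) (Cod SetCat f)"
  using assms by (auto simp: const_arrow_def SetCat_def app_def compose_def fun_eq_iff)

lemma SetCat_pullback_element:
  assumes pb: "is_pullback SetCat f v w q" and a: "a \<in> Dom SetCat f" and b: "b \<in> Dom SetCat v"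
    and "app f a = app v b"
  shows "\<exists>e\<in>Dom SetCat w. app w e = a \<and> app q e = b"
proof -
  note c = SetCat.is_pullbackD[OF pb]
  let ?a = "const_arrow {a} a (Dom SetCat f)" and ?b = "const_arrow {a} b (Dom SetCat v)"
  have e: "f \<cdot>\<^bsub>SetCat\<^esub> ?a = v \<cdot>\<^bsub>SetCat\<^esub> ?b"
    unfolding SetCat_Cmp_const_arrow[OF c(1) a] SetCat_Cmp_const_arrow[OF c(2) b] c(5) assms(4) ..
  have k: "?a \<in> Ar SetCat" "?b \<in> Ar SetCat" "Cod SetCat ?a = Dom SetCat f"
    "Cod SetCat ?b = Dom SetCat v" "Dom SetCat ?b = Dom SetCat ?a"
    using a b by (simp_all only: const_arrow)
  obtain h where h: "h \<in> Ar SetCat" "Dom SetCat h = Dom SetCat ?a"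
    "Cod SetCat h = Dom SetCat w" "w \<cdot>\<^bsub>SetCat\<^esub> h = ?a" "q \<cdot>\<^bsub>SetCat\<^esub> h = ?b"
    by (rule SetCat.is_pullback_lift[OF pb k e])
  from h(2) a have hD: "Dom SetCat h = {a}" by (simp only: const_arrow)
  have "app w (app h a) = a"
    using SetCat_Cmp_app[of a h w] unfolding h(4) hD by (simp add: a)
  moreover have "app q (app h a) = b"
    using SetCat_Cmp_app[of a h q] unfolding h(5) hD by (simp add: b)
  moreover have "app h a \<in> Dom SetCat w"
    using SetCat_app[of h a] h(1) unfolding hD h(3) by simp
  ultimately show ?thesis by blast
qed

lemma SetCat_product_element:
  assumes pr: "is_product SetCat A B P p q" and a: "a \<in> A" and b: "b \<in> B"
  shows "\<exists>!e. e \<in> P \<and> app p e = a \<and> app q e = b"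
proof -
  note c = SetCat.is_productD[OF pr]
  obtain h where h: "h \<in> Ar SetCat" "Dom SetCat h = {a}" "Cod SetCat h = P"
    "p \<cdot>\<^bsub>SetCat\<^esub> h = const_arrow {a} a A" "q \<cdot>\<^bsub>SetCat\<^esub> h = const_arrow {a} b B"
    using SetCat.is_product_lift[OF pr, of "const_arrow {a} a A" "const_arrow {a} b B"] a b by auto
  have "app p (app h a) = a" "app q (app h a) = b"
    using h a b SetCat_Cmp_app[of a h p] SetCat_Cmp_app[of a h q] by auto
  moreover have "app h a \<in> P"
    using SetCat_app[of h a] h by auto
  moreover have "e = e'" if e: "e \<in> P" "app p e = a \<and> app q e = b" and e': "e' \<in> P" "app p e' = a \<and> app q e' = b" for e e'
  proof -
    have "const_arrow {a} e P = const_arrow {a} e' P"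
    proof (rule SetCat.is_product_unique[OF pr])
      show "p \<cdot>\<^bsub>SetCat\<^esub> const_arrow {a} e P = p \<cdot>\<^bsub>SetCat\<^esub> const_arrow {a} e' P"
        using e e' c SetCat_Cmp_const_arrow[of p] by simp
      show "q \<cdot>\<^bsub>SetCat\<^esub> const_arrow {a} e P = q \<cdot>\<^bsub>SetCat\<^esub> const_arrow {a} e' P"
        using e e' c SetCat_Cmp_const_arrow[of q] by simp
    qed (use e e' in simp_all)
    then have "app (const_arrow {a} e P) a = app (const_arrow {a} e' P) a" by simp
    then show ?thesis using e(1) e'(1) by simp
  qed
  ultimately show ?thesis by blast
qed

section \<open>Images as covers\<close>

context coherent
begin

lemma image_exists:
  assumes "f \<in> Ar C"
  shows "\<exists>I. is_image C f I"
proof -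
  have "\<forall>f\<in>Ar C. \<exists>I. is_image C f I"
    using coherent unfolding coherent_category_def by (elim conjE)
  with assms show ?thesis by (rule bspec[rotated])
qed

lemma image_pullback:
  assumes "is_pullback C g f f' q" "is_image C f I"
  shows "is_image C f' (sub_pullback C g I)"
proof -
  have "\<forall>f g f' q I. is_pullback C g f f' q \<and> is_image C f I \<longrightarrow> is_image C f' (sub_pullback C g I)"
    using coherent unfolding coherent_category_def by (elim conjE)
  with assms show ?thesis by blast
qed

lemma is_imageD:
  assumes "is_image C f I"
  shows "f \<in> Ar C" "I \<in> carrier (Sub C (Cod C f))" "lies_in C f I"
    and "\<And>V. V \<in> carrier (Sub C (Cod C f)) \<Longrightarrow> lies_in C f V \<Longrightarrow> I \<sqsubseteq>\<^bsub>Sub C (Cod C f)\<^esub> V"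
  using assms unfolding is_image_def least_def lies_in_def by auto

text \<open>Inclusions between subobjects can be tested after pulling back along \<open>h\<close>, as long as only
  elements of the image \<open>I\<close> of \<open>h\<close> are concerned. For \<open>t\<close> in \<open>I\<close> and \<open>T\<close>, stability makes \<open>t\<^sup>*I\<close>, which is
  full, the image of the pullback \<open>h'\<close> of \<open>h\<close> along \<open>t\<close>. The assumption puts \<open>h'\<close> into \<open>t\<^sup>*T'\<close>, so that
  \<open>t\<^sup>*T'\<close> is full as well.\<close>

lemma lies_in_of_image:
  assumes im: "is_image C h I" and T: "T \<in> carrier (Sub C (Cod C h))" and T': "T' \<in> carrier (Sub C (Cod C h))"
    and le: "\<And>s. s \<in> Ar C \<Longrightarrow> Cod C s = Dom C h \<Longrightarrow> lies_in C (h \<cdot> s) T \<Longrightarrow> lies_in C (h \<cdot> s) T'"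
    and tI: "lies_in C t I" and tT: "lies_in C t T"
  shows "lies_in C t T'"
proof -
  note i = is_imageD[OF im]
  have t: "t \<in> Ar C" "Cod C t = Cod C h" using lies_in_type[OF tT T] by auto
  obtain h' q where pb: "is_pullback C t h h' q" using pullback_exists[of t h] t i by metis
  note c = is_pullbackD[OF pb]
  note im' = image_pullback[OF pb im]
  have "lies_in C (t \<cdot> h') T" using c by (intro lies_in_Cmp[OF tT T]) auto
  then have "lies_in C (h \<cdot> q) T'" unfolding c(9) using c(4,8) by (intro le) auto
  then have "lies_in C (t \<cdot> h') T'" unfolding c(9) .
  then have "lies_in C h' (sub_pullback C t T')"
    using c(1-8) T' t by (simp add: sub_pullback_lies_in)
  then have le: "sub_pullback C t I \<sqsubseteq>\<^bsub>Sub C (Dom C t)\<^esub> sub_pullback C t T'"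
    using is_imageD(4)[OF im'] c T' t sub_pullback_lies_in(1)[of t T'] by simp
  have "lies_in C (Idn C (Dom C t)) (sub_pullback C t I)"
    using tI t i by (simp add: sub_pullback_lies_in)
  then have "lies_in C (Idn C (Dom C t)) (sub_pullback C t T')"
    using le Sub_le_iff[of "sub_pullback C t I" "Dom C t" "sub_pullback C t T'"]
      sub_pullback_lies_in(1)[of t I] sub_pullback_lies_in(1)[of t T'] t i T' by simp
  then show ?thesis using t T' by (simp add: sub_pullback_lies_in)
qed

end

section \<open>Spans in the category of elements\<close>

locale coherent_model = coherent C
  for C :: "('o, 'm) cat" (structure) +
  fixes M :: "('o, 'm, 's) set_func"
  assumes model: "coherent_functor C SetCat M"

sublocale coherent_model \<subseteq> M: finite_limit_functor C SetCat M
  using model by unfold_locales (simp_all add: coherent_functor_def)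

context coherent_model
begin

text \<open>The action of \<open>M\<close> on identities and composites is simplified at the level of elements
  instead, by \<open>act_Idn\<close> and \<open>act_Cmp\<close>.\<close>

declare M.functor_simps(5,6) [simp del]

abbreviation act :: "'m \<Rightarrow> 's \<Rightarrow> 's" where
  "act f \<equiv> app (fa M f)"

lemma act_closed [simp]: "f \<in> Ar C \<Longrightarrow> a \<in> fo M (Dom C f) \<Longrightarrow> Cod C f = y \<Longrightarrow> act f a \<in> fo M y"
  using SetCat_app[of "fa M f" a] by auto

lemma act_Cmp [simp]:
  "f \<in> Ar C \<Longrightarrow> g \<in> Ar C \<Longrightarrow> Dom C g = Cod C f \<Longrightarrow> a \<in> fo M (Dom C f) \<Longrightarrow> act (g \<cdot> f) a = act g (act f a)"
  using SetCat_Cmp_app[of a "fa M f" "fa M g"] by (simp add: M.functor_simps)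

lemma act_Idn [simp]: "x \<in> Ob C \<Longrightarrow> a \<in> fo M x \<Longrightarrow> act (Idn C x) a = a"
  by (simp add: M.functor_simps SetCat_Idn_app)

lemma pullback_element:
  assumes pb: "is_pullback C f v w q" and "a \<in> fo M (Dom C f)" "b \<in> fo M (Dom C v)" "act f a = act v b"
  obtains e where "e \<in> fo M (Dom C w)" "act w e = a" "act q e = b"
  using SetCat_pullback_element[OF M.preserves_pullback[OF pb], of a b] assms is_pullbackD[OF pb]
  by auto

lemma unique_pair:
  assumes "is_product C x y P p q" "a \<in> fo M x" "b \<in> fo M y"
  shows "\<exists>!c. is_pair M P p q a b c"
  using SetCat_product_element[OF M.preserves_product[OF assms(1)] assms(2,3)]
  unfolding is_pair_def .

text \<open>\<open>M\<close> takes a terminal object to a terminal, hence inhabited, set. This gives \<open>LM\<close> a summand in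
  which to find its top and bottom.\<close>

lemma element_exists: "\<exists>x\<in>Ob C. \<exists>a. a \<in> fo M x"
proof -
  define T where "T = (\<lparr>fo = \<lambda>_. undefined, fa = \<lambda>_. Idn C undefined\<rparr> :: (nat, nat, 'o, 'm) func)"
  have T: "is_functor (discrete 0) C T"
    unfolding T_def by (rule is_functor_discrete) simp
  obtain l \<pi> where l: "is_limit C (discrete 0) T l \<pi>"
    using finite_limit_exists[OF finite_category_discrete T] by (elim exE)
  have "is_limit SetCat (discrete 0) (fcomp M T) (fo M l) (fa M \<circ> \<pi>)"
    using M.preserves finite_category_discrete[of 0] T l unfolding preserves_finite_limits_def by blast
  \<comment> \<open>Any inhabited set will do as the vertex of a cone; its arrow to \<open>M l\<close> provides an element.\<close>
  moreover have "is_cone SetCat (discrete 0) (fcomp M T) UNIV \<kappa>" for \<kappa>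
    by (simp add: is_cone_def discrete_def SetCat_Ob)
  ultimately have "\<exists>h. h \<in> Hom SetCat UNIV (fo M l)"
    unfolding is_limit_def by blast
  then obtain h where "h \<in> Hom SetCat UNIV (fo M l)" by (elim exE)
  then have "app h undefined \<in> fo M l"
    using SetCat_app[of h undefined] by (auto simp: Hom_def)
  moreover have "l \<in> Ob C" using l unfolding is_limit_def is_cone_def by blast
  ultimately show ?thesis by blast
qed

text \<open>A span from \<open>(x, a)\<close> to \<open>(y, b)\<close> in the category of elements, with apex \<open>(Dom C f, d)\<close>.\<close>

definition span :: "'o \<Rightarrow> 's \<Rightarrow> 'o \<Rightarrow> 's \<Rightarrow> 'm \<Rightarrow> 'm \<Rightarrow> 's \<Rightarrow> bool" where
  "span x a y b f g d \<longleftrightarrow> f \<in> Ar C \<and> g \<in> Ar C \<and> Dom C g = Dom C f \<and> Cod C f = x \<and> Cod C g = y \<and>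
     d \<in> fo M (Dom C f) \<and> act f d = a \<and> act g d = b"

text \<open>\<open>f\<^sup>*U \<le> g\<^sup>*V\<close>, for arrows \<open>f\<close> and \<open>g\<close> with the same domain.\<close>

definition le_along :: "'m \<Rightarrow> 'm set \<Rightarrow> 'm \<Rightarrow> 'm set \<Rightarrow> bool" where
  "le_along f U g V \<longleftrightarrow>
     (\<forall>s\<in>Ar C. Cod C s = Dom C f \<longrightarrow> lies_in C (f \<cdot> s) U \<longrightarrow> lies_in C (g \<cdot> s) V)"

lemma le_along_iff:
  assumes "f \<in> Ar C" "g \<in> Ar C" "Dom C g = Dom C f"
    and "U \<in> carrier (Sub C (Cod C f))" "V \<in> carrier (Sub C (Cod C g))"
  shows "le_along f U g V \<longleftrightarrow> sub_pullback C f U \<sqsubseteq>\<^bsub>Sub C (Dom C f)\<^esub> sub_pullback C g V"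
proof -
  have "sub_pullback C f U \<in> carrier (Sub C (Dom C f))" "sub_pullback C g V \<in> carrier (Sub C (Dom C f))"
    using assms sub_pullback_lies_in(1)[of g V] by (auto simp: sub_pullback_lies_in)
  with assms show ?thesis
    unfolding le_along_def by (auto simp: Sub_le_iff sub_pullback_lies_in)
qed

lemma le_along_Cmp:
  assumes "le_along f U g V" "f \<in> Ar C" "g \<in> Ar C" "Dom C g = Dom C f" "k \<in> Ar C" "Cod C k = Dom C f"
  shows "le_along (f \<cdot> k) U (g \<cdot> k) V"
  using assms unfolding le_along_def by simp

lemma le_along_trans:
  assumes "le_along f U g V" "le_along g V h W" "Dom C g = Dom C f"
  shows "le_along f U h W"
  using assms unfolding le_along_def by metis

lemma span_swap: "span x a y b f g d \<Longrightarrow> span y b x a g f d"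
  unfolding span_def by auto

lemma span_Cmp:
  assumes "span x a y b f g d" "k \<in> Ar C" "Cod C k = Dom C f" "e \<in> fo M (Dom C k)" "act k e = d"
  shows "span x a y b (f \<cdot> k) (g \<cdot> k) e"
  using assms unfolding span_def by auto

lemma span_Idn: "x \<in> Ob C \<Longrightarrow> a \<in> fo M x \<Longrightarrow> span x a x a (Idn C x) (Idn C x) a"
  unfolding span_def by auto

lemma span_exists:
  assumes "x \<in> Ob C" "y \<in> Ob C" "a \<in> fo M x" "b \<in> fo M y"
  obtains f g d where "span x a y b f g d"
proof -
  obtain P p q where pr: "is_product C x y P p q" using product_exists assms by metis
  obtain c where "is_pair M P p q a b c" using unique_pair[OF pr] assms by metis
  then have "span x a y b p q c"
    using is_productD[OF pr] unfolding span_def is_pair_def by auto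
  then show ?thesis by (rule that)
qed

text \<open>Spans are composed by pullback; preservation of pullbacks supplies an element over the
  elements at both apices.\<close>

lemma span_compose:
  assumes 1: "span x a y b f g d" and 2: "span y b z c f' g' d'"
  obtains k k' e where "k \<in> Ar C" "k' \<in> Ar C" "Cod C k = Dom C f" "Cod C k' = Dom C f'" "Dom C k' = Dom C k"
    "g \<cdot> k = f' \<cdot> k'" "e \<in> fo M (Dom C k)" "act k e = d" "act k' e = d'"
proof -
  obtain k k' where pb: "is_pullback C g f' k k'"
    using pullback_exists[of g f'] 1 2 unfolding span_def by metis
  note c = is_pullbackD[OF pb]
  obtain e where "e \<in> fo M (Dom C k)" "act k e = d" "act k' e = d'"
    using pullback_element[OF pb, of d d'] 1 2 unfolding span_def by metis
  then show ?thesis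
    using c 1 2 by (intro that[of k k' e]) (auto simp: span_def)
qed

text \<open>Two spans between the same elements have a common refinement: both are arrows into the
  product, where they act as the same pair, and can be pulled back over it.\<close>

lemma span_refine:
  assumes 1: "span x a y b f g d" and 2: "span x a y b f' g' d'"
  obtains k k' e where "k \<in> Ar C" "k' \<in> Ar C" "Cod C k = Dom C f" "Cod C k' = Dom C f'" "Dom C k' = Dom C k"
    "f \<cdot> k = f' \<cdot> k'" "g \<cdot> k = g' \<cdot> k'" "e \<in> fo M (Dom C k)" "act k e = d" "act k' e = d'"
proof -
  from 1 have s1: "f \<in> Ar C" "g \<in> Ar C" "Dom C g = Dom C f" "Cod C f = x" "Cod C g = y"
     "d \<in> fo M (Dom C f)" "act f d = a" "act g d = b" unfolding span_def by auto
  from 2 have s2: "f' \<in> Ar C" "g' \<in> Ar C" "Dom C g' = Dom C f'" "Cod C f' = x" "Cod C g' = y"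
     "d' \<in> fo M (Dom C f')" "act f' d' = a" "act g' d' = b" unfolding span_def by auto
  have "x \<in> Ob C" "y \<in> Ob C" using s1 Dom_Cod_Ob(2) by blast+
  then obtain P p q where pr: "is_product C x y P p q" using product_exists by metis
  note c = is_productD[OF pr]
  obtain h where h: "h \<in> Ar C" "Dom C h = Dom C f" "Cod C h = P" "p \<cdot> h = f" "q \<cdot> h = g"
    using is_product_lift[OF pr s1(1,2,4,5,3)] by metis
  obtain h' where h': "h' \<in> Ar C" "Dom C h' = Dom C f'" "Cod C h' = P" "p \<cdot> h' = f'" "q \<cdot> h' = g'"
    using is_product_lift[OF pr s2(1,2,4,5,3)] by metis
  have "a \<in> fo M x" "b \<in> fo M y" using s1 by auto
  moreover have "is_pair M P p q a b (act h d)"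
    using act_Cmp[of h p d] act_Cmp[of h q d] h c s1 unfolding is_pair_def by simp
  moreover have "is_pair M P p q a b (act h' d')"
    using act_Cmp[of h' p d'] act_Cmp[of h' q d'] h' c s2 unfolding is_pair_def by simp
  ultimately have e: "act h d = act h' d'" using unique_pair[OF pr] by blast
  obtain k k' where pb: "is_pullback C h h' k k'"
    using pullback_exists[of h h'] h h' by metis
  note k = is_pullbackD[OF pb]
  obtain e where e: "e \<in> fo M (Dom C k)" "act k e = d" "act k' e = d'"
    using pullback_element[OF pb _ _ e] h h' s1 s2 by metis
  have "p \<cdot> (h \<cdot> k) = p \<cdot> (h' \<cdot> k')" "q \<cdot> (h \<cdot> k) = q \<cdot> (h' \<cdot> k')" using k(9) by auto
  then have "f \<cdot> k = f' \<cdot> k'" "g \<cdot> k = g' \<cdot> k'"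
    using Cmp_assoc[of k h p] Cmp_assoc[of k' h' p] Cmp_assoc[of k h q] Cmp_assoc[of k' h' q] h h' k c
    by simp_all
  with e k h h' show ?thesis by (intro that[of k k' e]) auto
qed

section \<open>The relation defining \<open>LM\<close> in terms of spans\<close>

lemma L_gens_iff: "((x, a), U) \<in> L_gens C M \<longleftrightarrow> x \<in> Ob C \<and> a \<in> fo M x \<and> U \<in> carrier (Sub C x)"
  by (simp add: L_gens_def)

text \<open>The preorder whose symmetric part is \<open>L_rel\<close>.\<close>

definition L_le :: "'o \<Rightarrow> 's \<Rightarrow> 'm set \<Rightarrow> 'o \<Rightarrow> 's \<Rightarrow> 'm set \<Rightarrow> bool" where
  "L_le x a U y b V \<longleftrightarrow> (\<exists>f g d. span x a y b f g d \<and> le_along f U g V)"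

text \<open>By refinement, two opposite inequalities may be assumed to hold along the same span.\<close>

lemma L_le_both:
  assumes "L_le x a U y b V" "L_le y b V x a U"
  obtains f g d where "span x a y b f g d" "le_along f U g V" "le_along g V f U"
proof -
  from assms(1) obtain f g d where 1: "span x a y b f g d" "le_along f U g V" unfolding L_le_def by blast
  from assms(2) obtain f' g' d' where 2: "span x a y b f' g' d'" "le_along g' V f' U"
    unfolding L_le_def using span_swap by blast
  obtain k k' e where k: "k \<in> Ar C" "k' \<in> Ar C" "Cod C k = Dom C f" "Cod C k' = Dom C f'" "Dom C k' = Dom C k"
    "f \<cdot> k = f' \<cdot> k'" "g \<cdot> k = g' \<cdot> k'" "e \<in> fo M (Dom C k)" "act k e = d" "act k' e = d'"
    using span_refine[OF 1(1) 2(1)] by metis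
  show ?thesis
  proof (rule that)
    show "span x a y b (f \<cdot> k) (g \<cdot> k) e" using span_Cmp 1 k by metis
    show "le_along (f \<cdot> k) U (g \<cdot> k) V"
      using 1 k unfolding span_def by (intro le_along_Cmp) auto
    show "le_along (g \<cdot> k) V (f \<cdot> k) U"
      unfolding k(6,7) using 2 k unfolding span_def by (intro le_along_Cmp) auto
  qed
qed

text \<open>From left to right, a representative of \<open>\<phi>\<close> followed by the projections is a span along which
  both inequalities hold. From right to left, \<open>\<phi>\<close> is the image of the arrow into \<open>x \<times> y\<close> given by
  a span that witnesses both inequalities.\<close>

lemma L_rel_iff_L_le:
  assumes X: "((x, a), U) \<in> L_gens C M" and Y: "((y, b), V) \<in> L_gens C M"
  shows "(((x, a), U), ((y, b), V)) \<in> L_rel C M \<longleftrightarrow> L_le x a U y b V \<and> L_le y b V x a U"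
proof
  from X Y have xy: "x \<in> Ob C" "y \<in> Ob C" "a \<in> fo M x" "b \<in> fo M y"
    and U: "U \<in> carrier (Sub C x)" and V: "V \<in> carrier (Sub C y)" by (auto simp: L_gens_iff)
  {
    assume "(((x, a), U), ((y, b), V)) \<in> L_rel C M"
    then obtain P p q c \<Phi> where \<Phi>: "\<Phi> \<in> carrier (Sub C P)" and pr: "is_product C x y P p q"
      and pair: "is_pair M P p q a b c" and c\<Phi>: "in_sub C M c \<Phi>"
      and eq: "\<Phi> \<sqinter>\<^bsub>Sub C P\<^esub> sub_prod C P p q U (full_sub C y) =
        \<Phi> \<sqinter>\<^bsub>Sub C P\<^esub> sub_prod C P p q (full_sub C x) V"
      unfolding L_rel_def by auto
    note c = is_productD[OF pr]
    have pU: "sub_pullback C p U \<in> carrier (Sub C P)" and qV: "sub_pullback C q V \<in> carrier (Sub C P)"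
      using sub_pullback_lies_in(1)[of p U] sub_pullback_lies_in(1)[of q V] c U V by auto
    \<comment> \<open>The apex of the span is the domain of the representative \<open>w\<close>, at the element \<open>d\<close> over \<open>c\<close>.\<close>
    obtain w d where w: "w \<in> \<Phi>" and d: "d \<in> fo M (Dom C w)" "act w d = c"
      using c\<Phi> unfolding in_sub_def by blast
    have wA: "w \<in> Ar C" "Cod C w = P" using in_Sub[OF \<Phi> w] monoD by auto
    have sp: "span x a y b (p \<cdot> w) (q \<cdot> w) d"
      using pair c wA d unfolding span_def is_pair_def by auto
    have "lies_in C (p \<cdot> (w \<cdot> s)) U \<longleftrightarrow> lies_in C (q \<cdot> (w \<cdot> s)) V" if s: "s \<in> Ar C" "Cod C s = Dom C w" for s
    proof -
      have "lies_in C (w \<cdot> s) \<Phi>" using w wA s factorsI unfolding lies_in_def by blast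
      moreover have "lies_in C (w \<cdot> s) (\<Phi> \<sqinter>\<^bsub>Sub C P\<^esub> sub_pullback C p U) \<longleftrightarrow>
          lies_in C (w \<cdot> s) (\<Phi> \<sqinter>\<^bsub>Sub C P\<^esub> sub_pullback C q V)"
        using eq by (simp add: sub_prod_full_right[OF pr U] sub_prod_full_left[OF pr V])
      ultimately show ?thesis
        using c wA s U V by (simp add: Sub_meet \<Phi> pU qV sub_pullback_lies_in)
    qed
    then have "le_along (p \<cdot> w) U (q \<cdot> w) V" "le_along (q \<cdot> w) V (p \<cdot> w) U"
      unfolding le_along_def using c wA by auto
    with sp span_swap[OF sp] show "L_le x a U y b V \<and> L_le y b V x a U"
      unfolding L_le_def by blast
  }
  assume "L_le x a U y b V \<and> L_le y b V x a U"
  then obtain f g d where s: "span x a y b f g d" "le_along f U g V" "le_along g V f U"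
    using L_le_both by metis
  from s(1) have s1: "f \<in> Ar C" "g \<in> Ar C" "Dom C g = Dom C f" "Cod C f = x" "Cod C g = y"
     "d \<in> fo M (Dom C f)" "act f d = a" "act g d = b" unfolding span_def by auto
  obtain P p q where pr: "is_product C x y P p q" using product_exists xy by metis
  note c = is_productD[OF pr]
  obtain h where h: "h \<in> Ar C" "Dom C h = Dom C f" "Cod C h = P" "p \<cdot> h = f" "q \<cdot> h = g"
    using is_product_lift[OF pr s1(1,2,4,5,3)] by metis
  obtain \<Phi> where im: "is_image C h \<Phi>" using image_exists h by blast
  have \<Phi>: "\<Phi> \<in> carrier (Sub C P)" "lies_in C h \<Phi>" using is_imageD[OF im] h by auto
  have pU: "sub_pullback C p U \<in> carrier (Sub C P)" and qV: "sub_pullback C q V \<in> carrier (Sub C P)"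
    using sub_pullback_lies_in(1)[of p U] sub_pullback_lies_in(1)[of q V] c U V by auto
  have pair: "is_pair M P p q a b (act h d)"
    using act_Cmp[of h p d] act_Cmp[of h q d] h c s1 unfolding is_pair_def by simp
  \<comment> \<open>The pair \<open>(a, b)\<close> is in \<open>M \<Phi>\<close> because it comes from \<open>d\<close> along \<open>h\<close>, which factors through its image.\<close>
  have in\<Phi>: "in_sub C M (act h d) \<Phi>"
  proof -
    obtain w where w: "w \<in> \<Phi>" "factors C h w" using \<Phi>(2) unfolding lies_in_def by blast
    have wA: "w \<in> Ar C" using in_Sub[OF \<Phi>(1) w(1)] monoD by auto
    then obtain k where k: "k \<in> Ar C" "Cod C k = Dom C w" "h = w \<cdot> k" using w factors_iff by blast
    then have "Dom C k = Dom C f" using wA h(2) by simp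
    then have "act h d = act w (act k d)" "act k d \<in> fo M (Dom C w)"
      using k wA s1 by auto
    with w show ?thesis unfolding in_sub_def by blast
  qed
  have e: "lies_in C (h \<cdot> r) (sub_pullback C p U) \<longleftrightarrow> lies_in C (f \<cdot> r) U"
    "lies_in C (h \<cdot> r) (sub_pullback C q V) \<longleftrightarrow> lies_in C (g \<cdot> r) V"
    if "r \<in> Ar C" "Cod C r = Dom C f" for r
    using that c h U V Cmp_assoc[of r h p] Cmp_assoc[of r h q] by (simp_all add: sub_pullback_lies_in)
  have "lies_in C t \<Phi> \<and> lies_in C t (sub_pullback C p U) \<longleftrightarrow>
    lies_in C t \<Phi> \<and> lies_in C t (sub_pullback C q V)" for t
  proof -
    have "lies_in C t (sub_pullback C q V)" if "lies_in C t \<Phi>" "lies_in C t (sub_pullback C p U)"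
      by (rule lies_in_of_image[OF im _ _ _ that])
        (use pU qV h(2,3) e s(2) in \<open>auto simp: le_along_def\<close>)
    moreover have "lies_in C t (sub_pullback C p U)" if "lies_in C t \<Phi>" "lies_in C t (sub_pullback C q V)"
      by (rule lies_in_of_image[OF im _ _ _ that])
        (use pU qV h(2,3) e s(3) s1(3) in \<open>auto simp: le_along_def\<close>)
    ultimately show ?thesis by blast
  qed
  then have "\<Phi> \<sqinter>\<^bsub>Sub C P\<^esub> sub_pullback C p U = \<Phi> \<sqinter>\<^bsub>Sub C P\<^esub> sub_pullback C q V"
    using \<Phi> pU qV by (intro Sub_eqI[of _ P]) (auto simp: Sub_meet)
  then have "\<Phi> \<sqinter>\<^bsub>Sub C P\<^esub> sub_prod C P p q U (full_sub C y) =
      \<Phi> \<sqinter>\<^bsub>Sub C P\<^esub> sub_prod C P p q (full_sub C x) V"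
    by (simp add: sub_prod_full_right[OF pr U] sub_prod_full_left[OF pr V])
  then have "\<exists>P p q c. \<exists>\<Phi>\<in>carrier (Sub C P). is_product C x y P p q \<and> is_pair M P p q a b c \<and>
      in_sub C M c \<Phi> \<and> \<Phi> \<sqinter>\<^bsub>Sub C P\<^esub> sub_prod C P p q U (full_sub C y) =
      \<Phi> \<sqinter>\<^bsub>Sub C P\<^esub> sub_prod C P p q (full_sub C x) V"
    using pr pair in\<Phi> \<Phi>(1) by blast
  with X Y show "(((x, a), U), ((y, b), V)) \<in> L_rel C M"
    unfolding L_rel_def by simp
qed

lemma L_le_refl:
  assumes "x \<in> Ob C" "a \<in> fo M x" "U \<in> carrier (Sub C x)" "V \<in> carrier (Sub C x)" "U \<sqsubseteq>\<^bsub>Sub C x\<^esub> V"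
  shows "L_le x a U x a V"
proof -
  have "lies_in C s U \<longrightarrow> lies_in C s V" for s
    using assms(3-5) by (simp add: Sub_le_iff)
  then have "le_along (Idn C x) U (Idn C x) V"
    using assms(1) unfolding le_along_def by simp
  with span_Idn[OF assms(1,2)] show ?thesis unfolding L_le_def by blast
qed

lemma L_le_trans:
  assumes "L_le x a U y b V" "L_le y b V z c W"
  shows "L_le x a U z c W"
proof -
  from assms obtain f g d f' g' d' where 1: "span x a y b f g d" "le_along f U g V"
    and 2: "span y b z c f' g' d'" "le_along f' V g' W" unfolding L_le_def by blast
  obtain k k' e where k: "k \<in> Ar C" "k' \<in> Ar C" "Cod C k = Dom C f" "Cod C k' = Dom C f'" "Dom C k' = Dom C k"
    "g \<cdot> k = f' \<cdot> k'" "e \<in> fo M (Dom C k)" "act k e = d" "act k' e = d'"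
    using span_compose[OF 1(1) 2(1)] by metis
  have "le_along (f \<cdot> k) U (g \<cdot> k) V"
    using 1 k unfolding span_def by (intro le_along_Cmp) auto
  moreover have "le_along (g \<cdot> k) V (g' \<cdot> k') W"
    unfolding k(6) using 2 k unfolding span_def by (intro le_along_Cmp) auto
  moreover have "Dom C (g \<cdot> k) = Dom C (f \<cdot> k)" using 1 k(1-5) unfolding span_def by auto
  ultimately have "le_along (f \<cdot> k) U (g' \<cdot> k') W" by (rule le_along_trans)
  moreover have "span x a z c (f \<cdot> k) (g' \<cdot> k') e"
    using 1 2 k unfolding span_def by auto
  ultimately show ?thesis unfolding L_le_def by blast
qed

lemma L_rel_equiv: "equiv (L_gens C M) (L_rel C M)"
proof (rule equivI)
  show sub: "L_rel C M \<subseteq> L_gens C M \<times> L_gens C M" unfolding L_rel_def by auto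
  have iff: "(X, Y) \<in> L_rel C M \<longleftrightarrow> (\<exists>x a U y b V. X = ((x, a), U) \<and> Y = ((y, b), V) \<and> X \<in> L_gens C M \<and>
    Y \<in> L_gens C M \<and> L_le x a U y b V \<and> L_le y b V x a U)" for X Y
    using sub L_rel_iff_L_le by (cases X, cases Y) fast
  have "L_le x a U x a U" if "x \<in> Ob C" "a \<in> fo M x" "U \<in> carrier (Sub C x)" for x a U
    using that L_le_refl by (simp add: Sub_le_iff)
  then show "refl_on (L_gens C M) (L_rel C M)"
    by (intro refl_onI) (auto simp: iff L_gens_def)
  show "sym (L_rel C M)"
    by (intro symI) (auto simp: iff)
  show "trans (L_rel C M)"
    by (intro transI) (auto simp: iff intro: L_le_trans)
qed

end

section \<open>The lattice \<open>LM\<close>\<close>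

context coherent_model
begin

lemma L_class_eq_iff:
  assumes "((x, a), U) \<in> L_gens C M" "((y, b), V) \<in> L_gens C M"
  shows "L_class C M x a U = L_class C M y b V \<longleftrightarrow> L_le x a U y b V \<and> L_le y b V x a U"
  unfolding L_class_def eq_equiv_class_iff[OF L_rel_equiv assms] by (rule L_rel_iff_L_le[OF assms])

lemma LM_carrier_iff:
  "X \<in> carrier (LM C M) \<longleftrightarrow>
    (\<exists>x\<in>Ob C. \<exists>a\<in>fo M x. \<exists>U\<in>carrier (Sub C x). X = L_class C M x a U)"
  unfolding LM_def quotient_def L_class_def L_gens_def by auto

lemma L_class_closed [simp]:
  "x \<in> Ob C \<Longrightarrow> a \<in> fo M x \<Longrightarrow> U \<in> carrier (Sub C x) \<Longrightarrow> L_class C M x a U \<in> carrier (LM C M)"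
  unfolding LM_carrier_iff by blast

text \<open>Every arrow of the category of elements is a span with an identity leg, along which a subobject
  and its pullback agree.\<close>

lemma L_class_pullback:
  assumes "f \<in> Ar C" "d \<in> fo M (Dom C f)" "U \<in> carrier (Sub C (Cod C f))"
  shows "L_class C M (Dom C f) d (sub_pullback C f U) = L_class C M (Cod C f) (act f d) U"
proof -
  have s: "span (Dom C f) d (Cod C f) (act f d) (Idn C (Dom C f)) f d"
    using assms unfolding span_def by auto
  moreover have "le_along (Idn C (Dom C f)) (sub_pullback C f U) f U"
    "le_along f U (Idn C (Dom C f)) (sub_pullback C f U)"
    using assms unfolding le_along_def by (auto simp: sub_pullback_lies_in)
  ultimately have "L_le (Dom C f) d (sub_pullback C f U) (Cod C f) (act f d) U"
    "L_le (Cod C f) (act f d) U (Dom C f) d (sub_pullback C f U)"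
    using span_swap[OF s] unfolding L_le_def by blast+
  then show ?thesis
    using assms by (intro L_class_eq_iff[THEN iffD2]) (auto simp: L_gens_iff sub_pullback_lies_in)
qed

text \<open>The order is defined through common summands. An inequality in a common summand extends to
  other representatives by composing spans; conversely, the apex of a span is a common summand.\<close>

lemma LM_le_iff:
  assumes X: "((x, a), U) \<in> L_gens C M" and Y: "((y, b), V) \<in> L_gens C M"
  shows "L_class C M x a U \<sqsubseteq>\<^bsub>LM C M\<^esub> L_class C M y b V \<longleftrightarrow> L_le x a U y b V"
proof
  assume "L_class C M x a U \<sqsubseteq>\<^bsub>LM C M\<^esub> L_class C M y b V"
  then obtain z c U' V' where g: "((z, c), U') \<in> L_gens C M" "((z, c), V') \<in> L_gens C M"
    and e: "L_class C M x a U = L_class C M z c U'" "L_class C M y b V = L_class C M z c V'"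
    and le: "U' \<sqsubseteq>\<^bsub>Sub C z\<^esub> V'"
    unfolding LM_def by auto
  have "L_le x a U z c U'" "L_le z c V' y b V"
    using e L_class_eq_iff[OF X g(1)] L_class_eq_iff[OF Y g(2)] by auto
  moreover have "L_le z c U' z c V'" using g le by (intro L_le_refl) (auto simp: L_gens_iff)
  ultimately show "L_le x a U y b V" using L_le_trans by blast
next
  assume "L_le x a U y b V"
  then obtain f g d where sp: "span x a y b f g d" and le: "le_along f U g V"
    unfolding L_le_def by blast
  then have c: "f \<in> Ar C" "g \<in> Ar C" "Dom C g = Dom C f" "Cod C f = x" "Cod C g = y"
     "d \<in> fo M (Dom C f)" "act f d = a" "act g d = b" unfolding span_def by auto
  have UV: "U \<in> carrier (Sub C (Cod C f))" "V \<in> carrier (Sub C (Cod C g))"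
    using X Y c by (auto simp: L_gens_iff)
  have fU: "sub_pullback C f U \<in> carrier (Sub C (Dom C f))" and gV: "sub_pullback C g V \<in> carrier (Sub C (Dom C f))"
    using sub_pullback_lies_in(1)[OF c(1) UV(1)] sub_pullback_lies_in(1)[OF c(2) UV(2)] c(3) by auto
  have "sub_pullback C f U \<sqsubseteq>\<^bsub>Sub C (Dom C f)\<^esub> sub_pullback C g V"
    using le_along_iff[OF c(1,2,3) UV] le by blast
  moreover have "L_class C M x a U = L_class C M (Dom C f) d (sub_pullback C f U)"
    "L_class C M y b V = L_class C M (Dom C f) d (sub_pullback C g V)"
    using L_class_pullback[OF c(1,6) UV(1)] L_class_pullback[OF c(2) _ UV(2)] c by auto
  moreover have "((Dom C f, d), sub_pullback C f U) \<in> L_gens C M" "((Dom C f, d), sub_pullback C g V) \<in> L_gens C M"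
    using c fU gV by (auto simp: L_gens_iff)
  ultimately show "L_class C M x a U \<sqsubseteq>\<^bsub>LM C M\<^esub> L_class C M y b V"
    unfolding LM_def by auto
qed

lemma LM_partial_order: "partial_order (LM C M)"
proof
  show eq: "(.=\<^bsub>LM C M\<^esub>) = (=)" by (simp add: LM_def)
  show "X .=\<^bsub>LM C M\<^esub> X" for X by (simp add: eq)
  show "Y .=\<^bsub>LM C M\<^esub> X" if "X .=\<^bsub>LM C M\<^esub> Y" for X Y using that by (simp add: eq)
  show "X .=\<^bsub>LM C M\<^esub> Z" if "X .=\<^bsub>LM C M\<^esub> Y" "Y .=\<^bsub>LM C M\<^esub> Z" for X Y Z using that by (simp add: eq)
  show "X \<sqsubseteq>\<^bsub>LM C M\<^esub> Z \<longleftrightarrow> Y \<sqsubseteq>\<^bsub>LM C M\<^esub> W" if "X .=\<^bsub>LM C M\<^esub> Y" "Z .=\<^bsub>LM C M\<^esub> W" for X Y Z W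
    using that by (simp add: eq)
  fix X Y Z
  assume "X \<in> carrier (LM C M)"
  then obtain x a U where X: "((x, a), U) \<in> L_gens C M" "X = L_class C M x a U"
    unfolding LM_carrier_iff L_gens_iff by blast
  then have "L_le x a U x a U" by (intro L_le_refl) (auto simp: L_gens_iff Sub_le_iff)
  with X show "X \<sqsubseteq>\<^bsub>LM C M\<^esub> X" using LM_le_iff by blast
  assume "Y \<in> carrier (LM C M)"
  then obtain y b V where Y: "((y, b), V) \<in> L_gens C M" "Y = L_class C M y b V"
    unfolding LM_carrier_iff L_gens_iff by blast
  show "X .=\<^bsub>LM C M\<^esub> Y" if "X \<sqsubseteq>\<^bsub>LM C M\<^esub> Y" "Y \<sqsubseteq>\<^bsub>LM C M\<^esub> X"
    using that X Y L_class_eq_iff[OF X(1) Y(1)] LM_le_iff[OF X(1) Y(1)] LM_le_iff[OF Y(1) X(1)]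
    by (simp add: eq)
  assume "Z \<in> carrier (LM C M)"
  then obtain z c W where Z: "((z, c), W) \<in> L_gens C M" "Z = L_class C M z c W"
    unfolding LM_carrier_iff L_gens_iff by blast
  show "X \<sqsubseteq>\<^bsub>LM C M\<^esub> Z" if "X \<sqsubseteq>\<^bsub>LM C M\<^esub> Y" "Y \<sqsubseteq>\<^bsub>LM C M\<^esub> Z"
    using that X Y Z LM_le_iff L_le_trans by metis
qed

lemma LM_common_summand:
  assumes "X \<in> carrier (LM C M)" "Y \<in> carrier (LM C M)"
  shows "\<exists>x\<in>Ob C. \<exists>a\<in>fo M x. \<exists>U\<in>carrier (Sub C x). \<exists>V\<in>carrier (Sub C x).
    X = L_class C M x a U \<and> Y = L_class C M x a V"
proof -
  obtain x a U where x: "x \<in> Ob C" "a \<in> fo M x" and U: "U \<in> carrier (Sub C x)" and X: "X = L_class C M x a U"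
    using assms(1) unfolding LM_carrier_iff by blast
  obtain y b V where y: "y \<in> Ob C" "b \<in> fo M y" and V: "V \<in> carrier (Sub C y)" and Y: "Y = L_class C M y b V"
    using assms(2) unfolding LM_carrier_iff by blast
  obtain f g d where "span x a y b f g d" using span_exists x y by metis
  then have c: "f \<in> Ar C" "g \<in> Ar C" "Dom C g = Dom C f" "Cod C f = x" "Cod C g = y"
     "d \<in> fo M (Dom C f)" "act f d = a" "act g d = b" unfolding span_def by auto
  have "X = L_class C M (Dom C f) d (sub_pullback C f U)" "Y = L_class C M (Dom C f) d (sub_pullback C g V)"
    using L_class_pullback[of f d U] L_class_pullback[of g d V] c U V X Y by auto
  moreover have "sub_pullback C f U \<in> carrier (Sub C (Dom C f))" "sub_pullback C g V \<in> carrier (Sub C (Dom C f))"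
    using sub_pullback_lies_in(1)[of f U] sub_pullback_lies_in(1)[of g V] c U V by auto
  moreover have "Dom C f \<in> Ob C" using c by simp
  ultimately show ?thesis using c(6) by blast
qed

lemma LM_common_summand_3:
  assumes "X \<in> carrier (LM C M)" "Y \<in> carrier (LM C M)" "Z \<in> carrier (LM C M)"
  obtains x a U V W where "x \<in> Ob C" "a \<in> fo M x" "U \<in> carrier (Sub C x)" "V \<in> carrier (Sub C x)"
    "W \<in> carrier (Sub C x)" "X = L_class C M x a U" "Y = L_class C M x a V" "Z = L_class C M x a W"
proof -
  obtain x a U V where x: "x \<in> Ob C" "a \<in> fo M x" and U: "U \<in> carrier (Sub C x)" and V: "V \<in> carrier (Sub C x)"
    and X: "X = L_class C M x a U" and Y: "Y = L_class C M x a V"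
    using LM_common_summand[OF assms(1,2)] by blast
  obtain y b W where y: "y \<in> Ob C" "b \<in> fo M y" and W: "W \<in> carrier (Sub C y)" and Z: "Z = L_class C M y b W"
    using assms(3) unfolding LM_carrier_iff by blast
  obtain f g d where "span x a y b f g d" using span_exists x y by metis
  then have c: "f \<in> Ar C" "g \<in> Ar C" "Dom C g = Dom C f" "Cod C f = x" "Cod C g = y"
     "d \<in> fo M (Dom C f)" "act f d = a" "act g d = b" unfolding span_def by auto
  show ?thesis
  proof (rule that)
    show "Dom C f \<in> Ob C" "d \<in> fo M (Dom C f)" using c by auto
    show "sub_pullback C f U \<in> carrier (Sub C (Dom C f))" "sub_pullback C f V \<in> carrier (Sub C (Dom C f))"
      "sub_pullback C g W \<in> carrier (Sub C (Dom C f))"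
      using sub_pullback_lies_in(1)[of f] sub_pullback_lies_in(1)[of g W] c U V W by auto
    show "X = L_class C M (Dom C f) d (sub_pullback C f U)" "Y = L_class C M (Dom C f) d (sub_pullback C f V)"
      "Z = L_class C M (Dom C f) d (sub_pullback C g W)"
      using L_class_pullback[of f d] L_class_pullback[of g d W] c U V W X Y Z by auto
  qed
qed

text \<open>Meets are computed in any summand: the two inequalities that make an element a lower bound
  hold along spans, hence along a common refinement of these, and pullback preserves meets. Joins
  are treated in the same way, while for the top and the bottom one span suffices.\<close>

lemma L_class_meet:
  assumes x: "x \<in> Ob C" "a \<in> fo M x" and U: "U \<in> carrier (Sub C x)" and V: "V \<in> carrier (Sub C x)"
  shows "greatest (LM C M) (L_class C M x a (U \<sqinter>\<^bsub>Sub C x\<^esub> V)) (Lower (LM C M) {L_class C M x a U, L_class C M x a V})"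
    and "L_class C M x a U \<sqinter>\<^bsub>LM C M\<^esub> L_class C M x a V = L_class C M x a (U \<sqinter>\<^bsub>Sub C x\<^esub> V)"
proof -
  note m = Sub_meet[OF U V]
  have gens: "((x, a), U) \<in> L_gens C M" "((x, a), V) \<in> L_gens C M" "((x, a), U \<sqinter>\<^bsub>Sub C x\<^esub> V) \<in> L_gens C M"
    using x U V m by (simp_all add: L_gens_iff)
  have 1: "L_class C M x a (U \<sqinter>\<^bsub>Sub C x\<^esub> V) \<sqsubseteq>\<^bsub>LM C M\<^esub> L_class C M x a U"
    and 2: "L_class C M x a (U \<sqinter>\<^bsub>Sub C x\<^esub> V) \<sqsubseteq>\<^bsub>LM C M\<^esub> L_class C M x a V"
    using gens x U V m by (auto simp: LM_le_iff Sub_le_iff intro: L_le_refl)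
  have 3: "Z \<sqsubseteq>\<^bsub>LM C M\<^esub> L_class C M x a (U \<sqinter>\<^bsub>Sub C x\<^esub> V)"
    if ZC: "Z \<in> carrier (LM C M)" "Z \<sqsubseteq>\<^bsub>LM C M\<^esub> L_class C M x a U" "Z \<sqsubseteq>\<^bsub>LM C M\<^esub> L_class C M x a V" for Z
  proof -
    obtain y b W where Z: "((y, b), W) \<in> L_gens C M" "Z = L_class C M y b W"
      using ZC(1) unfolding LM_carrier_iff L_gens_iff by blast
    obtain f g d f' g' d' where 1: "span y b x a f g d" "le_along f W g U"
      and 2: "span y b x a f' g' d'" "le_along f' W g' V"
      using ZC(2,3) Z gens unfolding L_le_def by (auto simp: LM_le_iff L_le_def)
    obtain k k' e where k: "k \<in> Ar C" "k' \<in> Ar C" "Cod C k = Dom C f" "Cod C k' = Dom C f'" "Dom C k' = Dom C k"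
      "f \<cdot> k = f' \<cdot> k'" "g \<cdot> k = g' \<cdot> k'" "e \<in> fo M (Dom C k)" "act k e = d" "act k' e = d'"
      using span_refine[OF 1(1) 2(1)] by metis
    have "le_along (f \<cdot> k) W (g \<cdot> k) U"
      using 1 k(1,3) unfolding span_def by (intro le_along_Cmp) auto
    moreover have "le_along (f \<cdot> k) W (g \<cdot> k) V"
      unfolding k(6,7) using 2 k(2,4) unfolding span_def by (intro le_along_Cmp) auto
    ultimately have "le_along (f \<cdot> k) W (g \<cdot> k) (U \<sqinter>\<^bsub>Sub C x\<^esub> V)"
      unfolding le_along_def m(2) by blast
    moreover have "span y b x a (f \<cdot> k) (g \<cdot> k) e" using span_Cmp 1 k by metis
    ultimately show ?thesis
      using Z gens by (auto simp: LM_le_iff L_le_def)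
  qed
  from meet_eqI[OF LM_partial_order _ _ _ 1 2 3] x U V m(1)
  show "greatest (LM C M) (L_class C M x a (U \<sqinter>\<^bsub>Sub C x\<^esub> V)) (Lower (LM C M) {L_class C M x a U, L_class C M x a V})"
    "L_class C M x a U \<sqinter>\<^bsub>LM C M\<^esub> L_class C M x a V = L_class C M x a (U \<sqinter>\<^bsub>Sub C x\<^esub> V)"
    by simp_all
qed

lemma L_class_join:
  assumes x: "x \<in> Ob C" "a \<in> fo M x" and U: "U \<in> carrier (Sub C x)" and V: "V \<in> carrier (Sub C x)"
  shows "least (LM C M) (L_class C M x a (U \<squnion>\<^bsub>Sub C x\<^esub> V)) (Upper (LM C M) {L_class C M x a U, L_class C M x a V})"
    and "L_class C M x a U \<squnion>\<^bsub>LM C M\<^esub> L_class C M x a V = L_class C M x a (U \<squnion>\<^bsub>Sub C x\<^esub> V)"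
proof -
  note closed = distributive_lattice_closed(4)[OF Sub_distributive]
  have J: "U \<squnion>\<^bsub>Sub C x\<^esub> V \<in> carrier (Sub C x)" using closed x U V by blast
  have le: "U \<sqsubseteq>\<^bsub>Sub C x\<^esub> U \<squnion>\<^bsub>Sub C x\<^esub> V" "V \<sqsubseteq>\<^bsub>Sub C x\<^esub> U \<squnion>\<^bsub>Sub C x\<^esub> V"
    using Sub_join_le_iff[OF U V J] J by (auto simp: Sub_le_iff)
  have gens: "((x, a), U) \<in> L_gens C M" "((x, a), V) \<in> L_gens C M" "((x, a), U \<squnion>\<^bsub>Sub C x\<^esub> V) \<in> L_gens C M"
    using x U V J by (simp_all add: L_gens_iff)
  have 1: "L_class C M x a U \<sqsubseteq>\<^bsub>LM C M\<^esub> L_class C M x a (U \<squnion>\<^bsub>Sub C x\<^esub> V)"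
    and 2: "L_class C M x a V \<sqsubseteq>\<^bsub>LM C M\<^esub> L_class C M x a (U \<squnion>\<^bsub>Sub C x\<^esub> V)"
    using gens x U V J le by (auto simp: LM_le_iff intro: L_le_refl)
  have 3: "L_class C M x a (U \<squnion>\<^bsub>Sub C x\<^esub> V) \<sqsubseteq>\<^bsub>LM C M\<^esub> Z"
    if ZC: "Z \<in> carrier (LM C M)" "L_class C M x a U \<sqsubseteq>\<^bsub>LM C M\<^esub> Z" "L_class C M x a V \<sqsubseteq>\<^bsub>LM C M\<^esub> Z" for Z
  proof -
    obtain y b W where Z: "((y, b), W) \<in> L_gens C M" "Z = L_class C M y b W"
      using ZC(1) unfolding LM_carrier_iff L_gens_iff by blast
    obtain f g d f' g' d' where 1: "span x a y b f g d" "le_along f U g W"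
      and 2: "span x a y b f' g' d'" "le_along f' V g' W"
      using ZC(2,3) Z gens unfolding L_le_def by (auto simp: LM_le_iff L_le_def)
    obtain k k' e where k: "k \<in> Ar C" "k' \<in> Ar C" "Cod C k = Dom C f" "Cod C k' = Dom C f'" "Dom C k' = Dom C k"
      "f \<cdot> k = f' \<cdot> k'" "g \<cdot> k = g' \<cdot> k'" "e \<in> fo M (Dom C k)" "act k e = d" "act k' e = d'"
      using span_refine[OF 1(1) 2(1)] by metis
    define l r where lr: "l = f \<cdot> k" "r = g \<cdot> k"
    have sp: "span x a y b l r e" unfolding lr using span_Cmp 1 k by metis
    then have c: "l \<in> Ar C" "r \<in> Ar C" "Dom C r = Dom C l" "Cod C l = x" "Cod C r = y"
      unfolding span_def by auto
    have W: "W \<in> carrier (Sub C y)" using Z by (simp add: L_gens_iff)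
    have "le_along l U r W"
      unfolding lr using 1 k(1,3) unfolding span_def by (intro le_along_Cmp) auto
    moreover have "le_along l V r W"
      unfolding lr k(6,7) using 2 k(2,4) unfolding span_def by (intro le_along_Cmp) auto
    ultimately have "sub_pullback C l U \<sqsubseteq>\<^bsub>Sub C (Dom C l)\<^esub> sub_pullback C r W"
      "sub_pullback C l V \<sqsubseteq>\<^bsub>Sub C (Dom C l)\<^esub> sub_pullback C r W"
      using le_along_iff[OF c(1,2,3)] c(4,5) U V W by auto
    moreover have "sub_pullback C l U \<in> carrier (Sub C (Dom C l))" "sub_pullback C l V \<in> carrier (Sub C (Dom C l))"
      "sub_pullback C r W \<in> carrier (Sub C (Dom C l))"
      using sub_pullback_lies_in(1)[of l] sub_pullback_lies_in(1)[of r W] c U V W by auto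
    ultimately have "sub_pullback C l (U \<squnion>\<^bsub>Sub C x\<^esub> V) \<sqsubseteq>\<^bsub>Sub C (Dom C l)\<^esub> sub_pullback C r W"
      using sub_pullback_join[OF c(1), of U V] c(4) U V Sub_join_le_iff by auto
    then have "le_along l (U \<squnion>\<^bsub>Sub C x\<^esub> V) r W"
      using le_along_iff[OF c(1,2,3)] c(4,5) J W by auto
    with sp show ?thesis
      using Z gens by (auto simp: LM_le_iff L_le_def)
  qed
  from join_eqI[OF LM_partial_order _ _ _ 1 2 3] x U V J
  show "least (LM C M) (L_class C M x a (U \<squnion>\<^bsub>Sub C x\<^esub> V)) (Upper (LM C M) {L_class C M x a U, L_class C M x a V})"
    "L_class C M x a U \<squnion>\<^bsub>LM C M\<^esub> L_class C M x a V = L_class C M x a (U \<squnion>\<^bsub>Sub C x\<^esub> V)"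
    by simp_all
qed

lemma L_class_top:
  assumes x: "x \<in> Ob C" "a \<in> fo M x"
  shows "greatest (LM C M) (L_class C M x a \<top>\<^bsub>Sub C x\<^esub>) (carrier (LM C M))"
    and "\<top>\<^bsub>LM C M\<^esub> = L_class C M x a \<top>\<^bsub>Sub C x\<^esub>"
proof -
  note t = Sub_top[OF x(1)]
  have T: "L_class C M x a \<top>\<^bsub>Sub C x\<^esub> \<in> carrier (LM C M)" using x t by simp
  have le: "Z \<sqsubseteq>\<^bsub>LM C M\<^esub> L_class C M x a \<top>\<^bsub>Sub C x\<^esub>" if ZC: "Z \<in> carrier (LM C M)" for Z
  proof -
    obtain y b W where Z: "((y, b), W) \<in> L_gens C M" "Z = L_class C M y b W"
      using ZC(1) unfolding LM_carrier_iff L_gens_iff by blast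
    obtain f g d where sp: "span y b x a f g d" using span_exists x Z by (metis L_gens_iff)
    then have "le_along f W g (full_sub C x)" unfolding le_along_def t(2) span_def by auto
    with sp Z x t show ?thesis
      by (auto simp: LM_le_iff L_le_def L_gens_iff)
  qed
  show "greatest (LM C M) (L_class C M x a \<top>\<^bsub>Sub C x\<^esub>) (carrier (LM C M))"
    "\<top>\<^bsub>LM C M\<^esub> = L_class C M x a \<top>\<^bsub>Sub C x\<^esub>"
    using top_eqI[OF LM_partial_order T le] by auto
qed

lemma L_class_bottom:
  assumes x: "x \<in> Ob C" "a \<in> fo M x"
  shows "least (LM C M) (L_class C M x a \<bottom>\<^bsub>Sub C x\<^esub>) (carrier (LM C M))"
    and "\<bottom>\<^bsub>LM C M\<^esub> = L_class C M x a \<bottom>\<^bsub>Sub C x\<^esub>"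
proof -
  have b: "\<bottom>\<^bsub>Sub C x\<^esub> \<in> carrier (Sub C x)"
    using distributive_lattice_closed(2)[OF Sub_distributive[OF x(1)]] .
  have T: "L_class C M x a \<bottom>\<^bsub>Sub C x\<^esub> \<in> carrier (LM C M)" using x b by simp
  have le: "L_class C M x a \<bottom>\<^bsub>Sub C x\<^esub> \<sqsubseteq>\<^bsub>LM C M\<^esub> Z" if ZC: "Z \<in> carrier (LM C M)" for Z
  proof -
    obtain y b' W where Z: "((y, b'), W) \<in> L_gens C M" "Z = L_class C M y b' W"
      using ZC(1) unfolding LM_carrier_iff L_gens_iff by blast
    obtain f g d where sp: "span x a y b' f g d" using span_exists x Z by (metis L_gens_iff)
    then have c: "f \<in> Ar C" "g \<in> Ar C" "Dom C g = Dom C f" "Cod C f = x" "Cod C g = y"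
      unfolding span_def by auto
    have W: "W \<in> carrier (Sub C y)" using Z by (simp add: L_gens_iff)
    have "is_union C (Dom C f) {} (sub_pullback C f \<bottom>\<^bsub>Sub C x\<^esub>)"
      using union_pullback[OF c(1), of "{}"] Sub_bottom[OF x(1)] c(4) by simp
    moreover have "sub_pullback C g W \<in> carrier (Sub C (Dom C f))"
      using sub_pullback_lies_in(1)[of g W] c W by auto
    ultimately have "sub_pullback C f \<bottom>\<^bsub>Sub C x\<^esub> \<sqsubseteq>\<^bsub>Sub C (Dom C f)\<^esub> sub_pullback C g W"
      unfolding is_union_def least_def by simp
    then have "le_along f \<bottom>\<^bsub>Sub C x\<^esub> g W"
      using le_along_iff[OF c(1,2,3)] c(4,5) b W by auto
    with sp Z x b show ?thesis
      by (auto simp: LM_le_iff L_le_def L_gens_iff)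
  qed
  show "least (LM C M) (L_class C M x a \<bottom>\<^bsub>Sub C x\<^esub>) (carrier (LM C M))"
    "\<bottom>\<^bsub>LM C M\<^esub> = L_class C M x a \<bottom>\<^bsub>Sub C x\<^esub>"
    using bottom_eqI[OF LM_partial_order T le] by auto
qed

lemma LM_distributive: "distributive_lattice (LM C M)"
proof (rule distributive_latticeI[OF LM_partial_order])
  obtain x a where x: "x \<in> Ob C" "a \<in> fo M x" using element_exists by blast
  show "\<exists>t. greatest (LM C M) t (carrier (LM C M))" using L_class_top(1)[OF x] by (rule exI)
  show "\<exists>t. least (LM C M) t (carrier (LM C M))" using L_class_bottom(1)[OF x] by (rule exI)
next
  fix X Y Z
  assume X: "X \<in> carrier (LM C M)" and Y: "Y \<in> carrier (LM C M)"
  show "\<exists>g. greatest (LM C M) g (Lower (LM C M) {X, Y})" "\<exists>g. least (LM C M) g (Upper (LM C M) {X, Y})"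
    using LM_common_summand[OF X Y] L_class_meet(1) L_class_join(1) by blast+
  assume Z: "Z \<in> carrier (LM C M)"
  obtain x a U V W where x: "x \<in> Ob C" "a \<in> fo M x" and UVW: "U \<in> carrier (Sub C x)" "V \<in> carrier (Sub C x)"
    "W \<in> carrier (Sub C x)" "X = L_class C M x a U" "Y = L_class C M x a V" "Z = L_class C M x a W"
    using LM_common_summand_3[OF X Y Z] by metis
  note d = Sub_distributive[OF x(1)]
  note cl = distributive_lattice_closed[OF d]
  have "U \<sqinter>\<^bsub>Sub C x\<^esub> (V \<squnion>\<^bsub>Sub C x\<^esub> W) = (U \<sqinter>\<^bsub>Sub C x\<^esub> V) \<squnion>\<^bsub>Sub C x\<^esub> (U \<sqinter>\<^bsub>Sub C x\<^esub> W)"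
    using d UVW unfolding distributive_lattice_def by blast
  then have "X \<sqinter>\<^bsub>LM C M\<^esub> (Y \<squnion>\<^bsub>LM C M\<^esub> Z) = (X \<sqinter>\<^bsub>LM C M\<^esub> Y) \<squnion>\<^bsub>LM C M\<^esub> (X \<sqinter>\<^bsub>LM C M\<^esub> Z)"
    using x UVW cl by (simp add: L_class_meet(2) L_class_join(2))
  moreover have "X \<sqinter>\<^bsub>LM C M\<^esub> (Y \<squnion>\<^bsub>LM C M\<^esub> Z) \<in> carrier (LM C M)"
    using x UVW cl by (simp add: L_class_meet(2) L_class_join(2))
  ultimately show "X \<sqinter>\<^bsub>LM C M\<^esub> (Y \<squnion>\<^bsub>LM C M\<^esub> Z) \<sqsubseteq>\<^bsub>LM C M\<^esub> (X \<sqinter>\<^bsub>LM C M\<^esub> Y) \<squnion>\<^bsub>LM C M\<^esub> (X \<sqinter>\<^bsub>LM C M\<^esub> Z)"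
    using partial_order.axioms(1)[OF LM_partial_order] weak_partial_order.le_refl by fastforce
qed

lemma L_in_hom:
  assumes x: "x \<in> Ob C" "a \<in> fo M x"
  shows "L_in C M (x, a) \<in> dlat_hom (Sub C x) (LM C M)"
proof (rule dlat_homI[OF Sub_distributive[OF x(1)] LM_distributive])
  note cl = distributive_lattice_closed[OF Sub_distributive[OF x(1)]]
  show "L_in C M (x, a) \<top>\<^bsub>Sub C x\<^esub> = \<top>\<^bsub>LM C M\<^esub>" "L_in C M (x, a) \<bottom>\<^bsub>Sub C x\<^esub> = \<bottom>\<^bsub>LM C M\<^esub>"
    using x cl by (simp_all add: L_in_def L_class_top(2)[symmetric] L_class_bottom(2)[symmetric])
  fix U V
  assume U: "U \<in> carrier (Sub C x)" and V: "V \<in> carrier (Sub C x)"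
  show "L_in C M (x, a) (U \<sqinter>\<^bsub>Sub C x\<^esub> V) = L_in C M (x, a) U \<sqinter>\<^bsub>LM C M\<^esub> L_in C M (x, a) V"
    "L_in C M (x, a) (U \<squnion>\<^bsub>Sub C x\<^esub> V) = L_in C M (x, a) U \<squnion>\<^bsub>LM C M\<^esub> L_in C M (x, a) V"
    using x U V cl by (simp_all add: L_in_def L_class_meet(2) L_class_join(2))
qed (use x in \<open>auto simp: L_in_def\<close>)

end

section \<open>The universal property\<close>

lemma category_op_cat: "category C \<Longrightarrow> category (op_cat C)"
  unfolding category_def op_cat_def Hom_def by simp

context coherent
begin

lemma pullback_map_Idn:
  assumes "x \<in> Ob C"
  shows "pullback_map (Idn C x) = (\<lambda>V\<in>carrier (Sub C x). V)"
proof -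
  have "sub_pullback C (Idn C x) V = V" if V: "V \<in> carrier (Sub C x)" for V
    using assms V sub_pullback_lies_in(1)[of "Idn C x" V]
    by (intro Sub_eqI[of _ x]) (auto simp: sub_pullback_lies_in)
  then show ?thesis
    using assms unfolding pullback_map_def by (simp cong: restrict_cong)
qed

lemma pullback_map_Cmp:
  assumes "f \<in> Ar C" "g \<in> Ar C" "Dom C g = Cod C f"
  shows "pullback_map (g \<cdot> f) = compose (carrier (Sub C (Cod C g))) (pullback_map f) (pullback_map g)"
proof (rule ext)
  fix V
  show "pullback_map (g \<cdot> f) V = compose (carrier (Sub C (Cod C g))) (pullback_map f) (pullback_map g) V"
  proof (cases "V \<in> carrier (Sub C (Cod C g))")
    case True
    then have gV: "sub_pullback C g V \<in> carrier (Sub C (Cod C f))"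
      using assms sub_pullback_lies_in(1)[of g V] by simp
    have "sub_pullback C (g \<cdot> f) V = sub_pullback C f (sub_pullback C g V)"
      using assms gV True sub_pullback_lies_in(1)[of "g \<cdot> f" V]
      by (intro Sub_eqI[of _ "Dom C f"]) (auto simp: sub_pullback_lies_in)
    with True assms gV show ?thesis by (simp add: pullback_map_def compose_def)
  qed (use assms in \<open>simp add: pullback_map_def compose_def\<close>)
qed

end

context coherent_model
begin

lemma category_elements: "category (elements C M)"
  unfolding category_def elements_def Hom_def by auto

lemma L_shape_Ob: "Ob (L_shape C M) = {(x, a). x \<in> Ob C \<and> a \<in> fo M x}"
  by (simp add: op_cat_def elements_def)

lemma L_shape_Ar: "j \<in> Ar (L_shape C M) \<longleftrightarrow>
    (\<exists>f d. j = ((Dom C f, d), f, (Cod C f, act f d)) \<and> f \<in> Ar C \<and> d \<in> fo M (Dom C f))"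
  by (auto simp: op_cat_def elements_def Hom_def)

lemma L_shape_Dom_Cod [simp]:
  "Dom (L_shape C M) (i, f, j) = j" "Cod (L_shape C M) (i, f, j) = i"
  by (simp_all add: op_cat_def elements_def)

lemma L_diagram_simps [simp]:
  "fo (L_diagram C) (x, a) = Sub C x"
  "fa (L_diagram C) (i, f, j) = (Sub C (Cod C f), pullback_map f, Sub C (Dom C f))"
  by (simp_all add: fcomp_def SubF_def forget_def pullback_map_def)

lemma is_functor_L_diagram: "is_functor (L_shape C M) DLat (L_diagram C)"
  unfolding is_functor_def
proof (intro conjI ballI impI)
  show "category (L_shape C M)" by (rule category_op_cat[OF category_elements])
  show "category DLat" by (rule category_DLat)
next
  fix i assume "i \<in> Ob (L_shape C M)"
  then obtain x a where i: "i = (x, a)" "x \<in> Ob C" by (auto simp: L_shape_Ob)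
  then show "fo (L_diagram C) i \<in> Ob DLat" by (simp add: DLat_def Sub_distributive)
  have "Idn (L_shape C M) i = ((x, a), Idn C x, (x, a))"
    using i by (simp add: op_cat_def elements_def)
  then show "fa (L_diagram C) (Idn (L_shape C M) i) = Idn DLat (fo (L_diagram C) i)"
    using i by (simp add: DLat_def pullback_map_Idn)
next
  fix j assume "j \<in> Ar (L_shape C M)"
  then show "fa (L_diagram C) j \<in> Hom DLat (fo (L_diagram C) (Dom (L_shape C M) j))
      (fo (L_diagram C) (Cod (L_shape C M) j))"
    by (auto simp: L_shape_Ar Hom_def DLat_def Sub_distributive pullback_map_hom)
next
  fix j k assume "j \<in> Ar (L_shape C M)" "k \<in> Ar (L_shape C M)" "Dom (L_shape C M) k = Cod (L_shape C M) j"
  then obtain f d g e where j: "j = ((Dom C f, d), f, (Cod C f, act f d))" "f \<in> Ar C"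
    and k: "k = ((Dom C g, e), g, (Cod C g, act g e))" "g \<in> Ar C" "Dom C f = Cod C g"
    unfolding L_shape_Ar by auto
  have "k \<cdot>\<^bsub>L_shape C M\<^esub> j = ((Dom C g, e), f \<cdot> g, (Cod C f, act f d))"
    using j k by (simp add: op_cat_def elements_def)
  then show "fa (L_diagram C) (k \<cdot>\<^bsub>L_shape C M\<^esub> j) = fa (L_diagram C) k \<cdot>\<^bsub>DLat\<^esub> fa (L_diagram C) j"
    using j k pullback_map_Cmp[of g f] by (simp add: DLat_def app_def)
qed

lemma dlat_cocone_iff:
  "dlat_cocone (L_shape C M) (L_diagram C) E \<kappa> \<longleftrightarrow> distributive_lattice E \<and>
    (\<forall>x\<in>Ob C. \<forall>a\<in>fo M x. \<kappa> (x, a) \<in> dlat_hom (Sub C x) E) \<and>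
    (\<forall>f\<in>Ar C. \<forall>d\<in>fo M (Dom C f). \<forall>U\<in>carrier (Sub C (Cod C f)).
      \<kappa> (Dom C f, d) (sub_pullback C f U) = \<kappa> (Cod C f, act f d) U)"
proof -
  have "compose (carrier (Sub C (Cod C f))) (\<kappa> (Dom C f, d)) (pullback_map f) = \<kappa> (Cod C f, act f d) \<longleftrightarrow>
    (\<forall>U\<in>carrier (Sub C (Cod C f)). \<kappa> (Dom C f, d) (sub_pullback C f U) = \<kappa> (Cod C f, act f d) U)"
    if "\<kappa> (Cod C f, act f d) \<in> extensional (carrier (Sub C (Cod C f)))" for f d
    using that by (auto simp: fun_eq_iff compose_def pullback_map_def extensional_def)
  then have *: "compose (carrier (Sub C (Cod C f))) (\<kappa> (Dom C f, d)) (pullback_map f) = \<kappa> (Cod C f, act f d) \<longleftrightarrow>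
    (\<forall>U\<in>carrier (Sub C (Cod C f)). \<kappa> (Dom C f, d) (sub_pullback C f U) = \<kappa> (Cod C f, act f d) U)"
    if "\<kappa> (Cod C f, act f d) \<in> dlat_hom (Sub C (Cod C f)) E" for f d
    using that dlat_homD(6) by blast
  have ob: "(\<forall>i\<in>Ob (L_shape C M). \<kappa> i \<in> dlat_hom (fo (L_diagram C) i) E) \<longleftrightarrow>
      (\<forall>x\<in>Ob C. \<forall>a\<in>fo M x. \<kappa> (x, a) \<in> dlat_hom (Sub C x) E)"
    unfolding L_shape_Ob by auto
  have ar: "(\<forall>j\<in>Ar (L_shape C M). compose (carrier (fo (L_diagram C) (Dom (L_shape C M) j)))
        (\<kappa> (Cod (L_shape C M) j)) (app (fa (L_diagram C) j)) = \<kappa> (Dom (L_shape C M) j)) \<longleftrightarrow>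
      (\<forall>f\<in>Ar C. \<forall>d\<in>fo M (Dom C f). compose (carrier (Sub C (Cod C f))) (\<kappa> (Dom C f, d)) (pullback_map f) =
        \<kappa> (Cod C f, act f d))" (is "?l \<longleftrightarrow> ?r")
  proof
    assume l: ?l
    show ?r
    proof (intro ballI)
      fix f d assume "f \<in> Ar C" "d \<in> fo M (Dom C f)"
      then have "((Dom C f, d), f, (Cod C f, act f d)) \<in> Ar (L_shape C M)" by (auto simp: L_shape_Ar)
      from bspec[OF l this]
      show "compose (carrier (Sub C (Cod C f))) (\<kappa> (Dom C f, d)) (pullback_map f) = \<kappa> (Cod C f, act f d)"
        by (simp add: app_def)
    qed
  qed (auto simp: L_shape_Ar app_def)
  show ?thesis
    unfolding dlat_cocone_def ob ar using * by auto
qed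

lemma mediating_iff:
  assumes "dlat_cocone (L_shape C M) (L_diagram C) E \<kappa>"
  shows "mediating (L_shape C M) (L_diagram C) (LM C M) (L_in C M) E \<kappa> h \<longleftrightarrow> h \<in> dlat_hom (LM C M) E \<and>
    (\<forall>x\<in>Ob C. \<forall>a\<in>fo M x. \<forall>U\<in>carrier (Sub C x). h (L_class C M x a U) = \<kappa> (x, a) U)"
proof -
  have "compose (carrier (Sub C x)) h (L_in C M (x, a)) = \<kappa> (x, a) \<longleftrightarrow>
    (\<forall>U\<in>carrier (Sub C x). h (L_class C M x a U) = \<kappa> (x, a) U)" if "x \<in> Ob C" "a \<in> fo M x" for x a
  proof -
    have "\<kappa> (x, a) \<in> extensional (carrier (Sub C x))"
      using assms that dlat_homD(6) unfolding dlat_cocone_iff by blast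
    then show ?thesis by (auto simp: fun_eq_iff compose_def L_in_def extensional_def)
  qed
  then show ?thesis
    unfolding mediating_def L_shape_Ob by auto
qed

lemma LM_cocone: "dlat_cocone (L_shape C M) (L_diagram C) (LM C M) (L_in C M)"
  unfolding dlat_cocone_iff
  using LM_distributive L_in_hom sub_pullback_lies_in(1) L_class_pullback
  by (auto simp: L_in_def)

text \<open>A cocone takes equal values on related elements, since these become equal after pulling
  back along some span.\<close>

lemma cocone_L_class:
  assumes co: "dlat_cocone (L_shape C M) (L_diagram C) E \<kappa>"
    and X: "((x, a), U) \<in> L_gens C M" and Y: "((y, b), V) \<in> L_gens C M"
    and eq: "L_class C M x a U = L_class C M y b V"
  shows "\<kappa> (x, a) U = \<kappa> (y, b) V"
proof -
  obtain f g d where s: "span x a y b f g d" "le_along f U g V" "le_along g V f U"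
    using L_le_both L_class_eq_iff[OF X Y] eq by metis
  from s(1) have c: "f \<in> Ar C" "g \<in> Ar C" "Dom C g = Dom C f" "Cod C f = x" "Cod C g = y"
     "d \<in> fo M (Dom C f)" "act f d = a" "act g d = b" unfolding span_def by auto
  have UV: "U \<in> carrier (Sub C (Cod C f))" "V \<in> carrier (Sub C (Cod C g))"
    using X Y c by (auto simp: L_gens_iff)
  have "sub_pullback C f U \<sqsubseteq>\<^bsub>Sub C (Dom C f)\<^esub> sub_pullback C g V"
    "sub_pullback C g V \<sqsubseteq>\<^bsub>Sub C (Dom C f)\<^esub> sub_pullback C f U"
    using le_along_iff[OF c(1-3) UV] le_along_iff[OF c(2,1) c(3)[symmetric] UV(2,1)] s(2,3)
    unfolding c(3) by blast+
  then have "sub_pullback C f U = sub_pullback C g V"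
    by (rule partial_order.le_antisym[OF Sub_partial_order])
      (use sub_pullback_lies_in(1)[OF c(1) UV(1)] sub_pullback_lies_in(1)[OF c(2) UV(2)] c(3) in simp_all)
  moreover have "\<kappa> (Dom C f, d) (sub_pullback C f U) = \<kappa> (x, a) U"
    using co c UV unfolding dlat_cocone_iff by blast
  moreover have "\<kappa> (Dom C g, d) (sub_pullback C g V) = \<kappa> (y, b) V"
  proof -
    have "d \<in> fo M (Dom C g)" using c by simp
    then show ?thesis using co c(2,5,8) UV unfolding dlat_cocone_iff by blast
  qed
  ultimately show ?thesis using c(3) by simp
qed

theorem LM_universal:
  fixes E :: "'d gorder"
  assumes co: "dlat_cocone (L_shape C M) (L_diagram C) E \<kappa>"
  shows "\<exists>!h. mediating (L_shape C M) (L_diagram C) (LM C M) (L_in C M) E \<kappa> h"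
proof (rule ex_ex1I)
  have E: "distributive_lattice E" and hom: "\<And>x a. x \<in> Ob C \<Longrightarrow> a \<in> fo M x \<Longrightarrow> \<kappa> (x, a) \<in> dlat_hom (Sub C x) E"
    using co unfolding dlat_cocone_iff by blast+
  \<comment> \<open>The value on a class is read off from any representative.\<close>
  define h where "h = (\<lambda>X\<in>carrier (LM C M). SOME e. \<exists>x a U. ((x, a), U) \<in> L_gens C M \<and>
    X = L_class C M x a U \<and> e = \<kappa> (x, a) U)"
  have h: "h (L_class C M x a U) = \<kappa> (x, a) U" if "x \<in> Ob C" "a \<in> fo M x" "U \<in> carrier (Sub C x)" for x a U
  proof -
    have g: "((x, a), U) \<in> L_gens C M" using that by (simp add: L_gens_iff)
    have "(SOME e. \<exists>y b V. ((y, b), V) \<in> L_gens C M \<and> L_class C M x a U = L_class C M y b V \<and>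
      e = \<kappa> (y, b) V) = \<kappa> (x, a) U"
    proof (rule some_equality)
      show "\<exists>y b V. ((y, b), V) \<in> L_gens C M \<and> L_class C M x a U = L_class C M y b V \<and>
        \<kappa> (x, a) U = \<kappa> (y, b) V" using g by blast
    next
      fix e assume "\<exists>y b V. ((y, b), V) \<in> L_gens C M \<and> L_class C M x a U = L_class C M y b V \<and> e = \<kappa> (y, b) V"
      then show "e = \<kappa> (x, a) U" using cocone_L_class[OF co g] by metis
    qed
    with that show ?thesis by (simp add: h_def)
  qed
  have "h \<in> dlat_hom (LM C M) E"
  proof (rule dlat_homI[OF LM_distributive E])
    show "h \<in> extensional (carrier (LM C M))" by (simp add: h_def)
    obtain x a where x: "x \<in> Ob C" "a \<in> fo M x" using element_exists by blast
    note cl = distributive_lattice_closed[OF Sub_distributive[OF x(1)]]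
    show "h \<top>\<^bsub>LM C M\<^esub> = \<top>\<^bsub>E\<^esub>" "h \<bottom>\<^bsub>LM C M\<^esub> = \<bottom>\<^bsub>E\<^esub>"
      using x cl dlat_homD(4,5)[OF hom[OF x]] by (simp_all add: L_class_top(2)[OF x] L_class_bottom(2)[OF x] h)
  next
    fix X assume "X \<in> carrier (LM C M)"
    then show "h X \<in> carrier E"
      unfolding LM_carrier_iff using h dlat_homD(1)[OF hom] by auto
  next
    fix X Y assume "X \<in> carrier (LM C M)" "Y \<in> carrier (LM C M)"
    then obtain x a U V where x: "x \<in> Ob C" "a \<in> fo M x" and U: "U \<in> carrier (Sub C x)" "V \<in> carrier (Sub C x)"
      and XY: "X = L_class C M x a U" "Y = L_class C M x a V" using LM_common_summand by metis
    note cl = distributive_lattice_closed[OF Sub_distributive[OF x(1)]]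
    show "h (X \<sqinter>\<^bsub>LM C M\<^esub> Y) = h X \<sqinter>\<^bsub>E\<^esub> h Y"
      using x U cl dlat_homD(2)[OF hom[OF x]] by (simp add: XY L_class_meet(2) h)
    show "h (X \<squnion>\<^bsub>LM C M\<^esub> Y) = h X \<squnion>\<^bsub>E\<^esub> h Y"
      using x U cl dlat_homD(3)[OF hom[OF x]] by (simp add: XY L_class_join(2) h)
  qed
  with h show "\<exists>h. mediating (L_shape C M) (L_diagram C) (LM C M) (L_in C M) E \<kappa> h"
    unfolding mediating_iff[OF co] by blast
next
  fix h h'
  assume "mediating (L_shape C M) (L_diagram C) (LM C M) (L_in C M) E \<kappa> h"
    "mediating (L_shape C M) (L_diagram C) (LM C M) (L_in C M) E \<kappa> h'"
  then have hh': "h \<in> dlat_hom (LM C M) E" "h' \<in> dlat_hom (LM C M) E"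
    "\<And>x a U. x \<in> Ob C \<Longrightarrow> a \<in> fo M x \<Longrightarrow> U \<in> carrier (Sub C x) \<Longrightarrow> h (L_class C M x a U) = h' (L_class C M x a U)"
    unfolding mediating_iff[OF co] by auto
  show "h = h'"
  proof (rule extensionalityI)
    show "h \<in> extensional (carrier (LM C M))" "h' \<in> extensional (carrier (LM C M))"
      using hh' dlat_homD(6) by blast+
    show "h X = h' X" if "X \<in> carrier (LM C M)" for X
      using that hh'(3) unfolding LM_carrier_iff by blast
  qed
qed

theorem LM_colimit: "dlat_colimit TYPE('d) (L_shape C M) (L_diagram C) (LM C M) (L_in C M)"
  unfolding dlat_colimit_def using is_functor_L_diagram LM_cocone LM_universal by blast

theorem product_representative:
  assumes pr: "is_product C x y P p q" and pair: "is_pair M P p q a b c"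
    and x: "x \<in> Ob C" "a \<in> fo M x" and U: "U \<in> carrier (Sub C x)"
  shows "(((x, a), U), ((P, c), sub_prod C P p q U (full_sub C y))) \<in> L_rel C M"
proof -
  note pc = is_productD[OF pr]
  have c: "c \<in> fo M P" "act p c = a" using pair unfolding is_pair_def by auto
  have "L_class C M P c (sub_pullback C p U) = L_class C M x a U"
    using L_class_pullback[of p c U] c pc U by simp
  moreover have "sub_pullback C p U \<in> carrier (Sub C P)" using sub_pullback_lies_in(1)[of p U] pc U by simp
  ultimately show ?thesis
    using x U c pc(1) eq_equiv_class_iff[OF L_rel_equiv, of "((x, a), U)" "((P, c), sub_pullback C p U)"]
    unfolding sub_prod_full_right[OF pr U] L_class_def by (auto simp: L_gens_iff)
qed

end

section \<open>Functoriality\<close>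

text \<open>A morphism of models \<open>(F, \<eta>)\<close> from \<open>(C, M)\<close> to \<open>(D, N)\<close>.\<close>

locale coherent_model_morphism = dom: coherent_model C M + cod: coherent_model D N +
  F: coherent_functor_between C D F
  for C :: "('o, 'm) cat" and M :: "('o, 'm, 's) set_func"
    and D :: "('p, 'n) cat" and N :: "('p, 'n, 's) set_func"
    and F :: "('o, 'm, 'p, 'n) func" +
  fixes \<eta> :: "'o \<Rightarrow> 's set \<times> ('s \<Rightarrow> 's) \<times> 's set"
  assumes natural: "nat_trans C SetCat M (fcomp N F) \<eta>"
begin

lemma component_closed:
  assumes "x \<in> Ob C" "a \<in> fo M x"
  shows "app (\<eta> x) a \<in> fo N (fo F x)"
proof -
  have "\<eta> x \<in> Hom SetCat (fo M x) (fo N (fo F x))"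
    using natural assms unfolding nat_trans_def fcomp_def by simp
  then show ?thesis using SetCat_app[of "\<eta> x" a] assms by (auto simp: Hom_def)
qed

lemma component_natural:
  assumes f: "f \<in> Ar C" and d: "d \<in> fo M (Dom C f)"
  shows "app (fa N (fa F f)) (app (\<eta> (Dom C f)) d) = app (\<eta> (Cod C f)) (app (fa M f) d)"
proof -
  have "\<eta> (Dom C f) \<in> Hom SetCat (fo M (Dom C f)) (fo N (fo F (Dom C f)))"
    using natural f unfolding nat_trans_def fcomp_def by simp
  then have "Dom SetCat (\<eta> (Dom C f)) = fo M (Dom C f)" by (simp add: Hom_def)
  moreover have "\<eta> (Cod C f) \<cdot>\<^bsub>SetCat\<^esub> fa M f = fa N (fa F f) \<cdot>\<^bsub>SetCat\<^esub> \<eta> (Dom C f)"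
    using natural f unfolding nat_trans_def fcomp_def by simp
  moreover have "Dom SetCat (fa M f) = fo M (Dom C f)" using f by simp
  ultimately show ?thesis
    using SetCat_Cmp_app[of d "fa M f" "\<eta> (Cod C f)"] SetCat_Cmp_app[of d "\<eta> (Dom C f)" "fa N (fa F f)"] d
    by simp
qed

lemma L_map_cocone_apply:
  assumes "x \<in> Ob C" "a \<in> fo M x" "U \<in> carrier (Sub C x)"
  shows "L_map_cocone C D N F \<eta> (x, a) U = L_class D N (fo F x) (app (\<eta> x) a) (sub_image D F U)"
  using assms by (simp add: L_map_cocone_def L_in_def F.sub_image_closed)

text \<open>The composite with \<open>Sub D (F x) \<rightarrow> LN\<close> is a homomorphism because \<open>F\<close> preserves finite meets and
  unions of subobjects. Compatibility with an arrow \<open>f\<close> of \<open>C\<close> is the compatibility of \<open>LN\<close> with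
  \<open>F f\<close>, since \<open>F\<close> commutes with pullback of subobjects and \<open>\<eta>\<close> is natural.\<close>

theorem L_map_cocone: "dlat_cocone (L_shape C M) (L_diagram C) (LM D N) (L_map_cocone C D N F \<eta>)"
  unfolding dom.dlat_cocone_iff
proof (intro conjI ballI)
  show "distributive_lattice (LM D N)" by (rule cod.LM_distributive)
next
  fix x a assume x: "x \<in> Ob C" "a \<in> fo M x"
  have "L_map_cocone C D N F \<eta> (x, a) =
    compose (carrier (Sub C x)) (L_in D N (fo F x, app (\<eta> x) a)) (F.image_map x)"
    by (simp add: L_map_cocone_def compose_def F.image_map_def cong: restrict_cong)
  also have "\<dots> \<in> dlat_hom (Sub C x) (LM D N)"
    using x component_closed[OF x]
    by (intro dlat_hom_compose[of _ "Sub D (fo F x)"] F.image_map_hom cod.L_in_hom)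
      (simp_all add: dom.Sub_distributive cod.Sub_distributive cod.LM_distributive)
  finally show "L_map_cocone C D N F \<eta> (x, a) \<in> dlat_hom (Sub C x) (LM D N)" .
next
  fix f d U assume *: "f \<in> Ar C" "d \<in> fo M (Dom C f)" "U \<in> carrier (Sub C (Cod C f))"
  have "L_class D N (Dom D (fa F f)) (app (\<eta> (Dom C f)) d) (sub_pullback D (fa F f) (sub_image D F U)) =
      L_class D N (Cod D (fa F f)) (app (fa N (fa F f)) (app (\<eta> (Dom C f)) d)) (sub_image D F U)"
    using * component_closed[of "Dom C f" d] F.sub_image_closed[OF *(3)]
    by (intro cod.L_class_pullback) simp_all
  then show "L_map_cocone C D N F \<eta> (Dom C f, d) (sub_pullback C f U) =
      L_map_cocone C D N F \<eta> (Cod C f, app (fa M f) d) U"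
    using * dom.sub_pullback_lies_in(1)[of f U]
    by (simp add: L_map_cocone_apply F.sub_image_pullback component_natural)
qed

theorem L_map_mediating:
  "mediating (L_shape C M) (L_diagram C) (LM C M) (L_in C M)
    (LM D N) (L_map_cocone C D N F \<eta>) (L_map C M D N F \<eta>)"
  unfolding L_map_def by (rule theI'[OF dom.LM_universal[OF L_map_cocone]])

theorem L_map_L_class:
  assumes "x \<in> Ob C" "a \<in> fo M x" "U \<in> carrier (Sub C x)"
  shows "L_map C M D N F \<eta> (L_class C M x a U) = L_class D N (fo F x) (app (\<eta> x) a) (sub_image D F U)"
  using L_map_mediating assms
  unfolding dom.mediating_iff[OF L_map_cocone] by (simp add: L_map_cocone_apply)

end

theorem proposition6p8:
  fixes C :: "('o, 'm) cat" and M :: "('o, 'm, 's) set_func"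
  assumes "coherent_category C" and "coherent_functor C SetCat M"
  shows
    "equiv (L_gens C M) (L_rel C M)
     \<and> (\<forall>x\<in>Ob C. \<forall>y\<in>Ob C. \<forall>a\<in>fo M x. \<forall>b\<in>fo M y. \<forall>P p q. is_product C x y P p q \<longrightarrow>
          (\<exists>!c. is_pair M P p q a b c) \<and>
          (\<forall>c. is_pair M P p q a b c \<longrightarrow> (\<forall>U\<in>carrier (Sub C x).
             (((x, a), U), ((P, c), sub_prod C P p q U (full_sub C y))) \<in> L_rel C M)))
     \<and> (\<forall>X\<in>carrier (LM C M). \<forall>Y\<in>carrier (LM C M). \<exists>x\<in>Ob C. \<exists>a\<in>fo M x.
          \<exists>U\<in>carrier (Sub C x). \<exists>V\<in>carrier (Sub C x).
            X = L_class C M x a U \<and> Y = L_class C M x a V)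
     \<and> (\<forall>x\<in>Ob C. \<forall>a\<in>fo M x. \<forall>U\<in>carrier (Sub C x). \<forall>V\<in>carrier (Sub C x).
          L_class C M x a U \<sqinter>\<^bsub>LM C M\<^esub> L_class C M x a V = L_class C M x a (U \<sqinter>\<^bsub>Sub C x\<^esub> V) \<and>
          L_class C M x a U \<squnion>\<^bsub>LM C M\<^esub> L_class C M x a V = L_class C M x a (U \<squnion>\<^bsub>Sub C x\<^esub> V))
     \<and> (\<forall>x\<in>Ob C. \<forall>a\<in>fo M x.
          \<top>\<^bsub>LM C M\<^esub> = L_class C M x a \<top>\<^bsub>Sub C x\<^esub> \<and> \<bottom>\<^bsub>LM C M\<^esub> = L_class C M x a \<bottom>\<^bsub>Sub C x\<^esub>)
     \<and> dlat_colimit TYPE('d) (L_shape C M) (L_diagram C) (LM C M) (L_in C M)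
     \<and> (\<forall>(D :: ('p, 'n) cat) (N :: ('p, 'n, 's) set_func) (F :: ('o, 'm, 'p, 'n) func) \<eta>.
          coherent_category D \<and> coherent_functor D SetCat N \<and> coherent_functor C D F \<and>
          nat_trans C SetCat M (fcomp N F) \<eta> \<longrightarrow>
            dlat_cocone (L_shape C M) (L_diagram C) (LM D N) (L_map_cocone C D N F \<eta>) \<and>
            (\<exists>!h. mediating (L_shape C M) (L_diagram C) (LM C M) (L_in C M)
                    (LM D N) (L_map_cocone C D N F \<eta>) h) \<and>
            mediating (L_shape C M) (L_diagram C) (LM C M) (L_in C M)
              (LM D N) (L_map_cocone C D N F \<eta>) (L_map C M D N F \<eta>) \<and>
            (\<forall>x\<in>Ob C. \<forall>a\<in>fo M x. \<forall>U\<in>carrier (Sub C x).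
               L_map C M D N F \<eta> (L_class C M x a U) =
               L_class D N (fo F x) (app (\<eta> x) a) (sub_image D F U)))"
proof -
  interpret coherent_model C M
    using assms by unfold_locales
  show ?thesis
  proof (intro conjI)
    show "equiv (L_gens C M) (L_rel C M)" by (rule L_rel_equiv)
    show "\<forall>x\<in>Ob C. \<forall>y\<in>Ob C. \<forall>a\<in>fo M x. \<forall>b\<in>fo M y. \<forall>P p q. is_product C x y P p q \<longrightarrow>
          (\<exists>!c. is_pair M P p q a b c) \<and>
          (\<forall>c. is_pair M P p q a b c \<longrightarrow> (\<forall>U\<in>carrier (Sub C x).
             (((x, a), U), ((P, c), sub_prod C P p q U (full_sub C y))) \<in> L_rel C M))"
      by (intro ballI allI impI conjI) (rule unique_pair product_representative; assumption)+
    show "\<forall>X\<in>carrier (LM C M). \<forall>Y\<in>carrier (LM C M). \<exists>x\<in>Ob C. \<exists>a\<in>fo M x.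
          \<exists>U\<in>carrier (Sub C x). \<exists>V\<in>carrier (Sub C x).
            X = L_class C M x a U \<and> Y = L_class C M x a V"
      using LM_common_summand by blast
    show "\<forall>x\<in>Ob C. \<forall>a\<in>fo M x. \<forall>U\<in>carrier (Sub C x). \<forall>V\<in>carrier (Sub C x).
          L_class C M x a U \<sqinter>\<^bsub>LM C M\<^esub> L_class C M x a V = L_class C M x a (U \<sqinter>\<^bsub>Sub C x\<^esub> V) \<and>
          L_class C M x a U \<squnion>\<^bsub>LM C M\<^esub> L_class C M x a V = L_class C M x a (U \<squnion>\<^bsub>Sub C x\<^esub> V)"
      using L_class_meet(2) L_class_join(2) by blast
    show "\<forall>x\<in>Ob C. \<forall>a\<in>fo M x.
          \<top>\<^bsub>LM C M\<^esub> = L_class C M x a \<top>\<^bsub>Sub C x\<^esub> \<and> \<bottom>\<^bsub>LM C M\<^esub> = L_class C M x a \<bottom>\<^bsub>Sub C x\<^esub>"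
      using L_class_top(2) L_class_bottom(2) by blast
    show "dlat_colimit TYPE('d) (L_shape C M) (L_diagram C) (LM C M) (L_in C M)"
      by (rule LM_colimit)
  next
    show "\<forall>(D :: ('p, 'n) cat) (N :: ('p, 'n, 's) set_func) (F :: ('o, 'm, 'p, 'n) func) \<eta>.
          coherent_category D \<and> coherent_functor D SetCat N \<and> coherent_functor C D F \<and>
          nat_trans C SetCat M (fcomp N F) \<eta> \<longrightarrow>
            dlat_cocone (L_shape C M) (L_diagram C) (LM D N) (L_map_cocone C D N F \<eta>) \<and>
            (\<exists>!h. mediating (L_shape C M) (L_diagram C) (LM C M) (L_in C M)
                    (LM D N) (L_map_cocone C D N F \<eta>) h) \<and>
            mediating (L_shape C M) (L_diagram C) (LM C M) (L_in C M)
              (LM D N) (L_map_cocone C D N F \<eta>) (L_map C M D N F \<eta>) \<and>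
            (\<forall>x\<in>Ob C. \<forall>a\<in>fo M x. \<forall>U\<in>carrier (Sub C x).
               L_map C M D N F \<eta> (L_class C M x a U) =
               L_class D N (fo F x) (app (\<eta> x) a) (sub_image D F U))"
    proof (intro allI impI, elim conjE)
      fix D :: "('p, 'n) cat" and N :: "('p, 'n, 's) set_func" and F :: "('o, 'm, 'p, 'n) func" and \<eta>
      assume "coherent_category D" "coherent_functor D SetCat N" "coherent_functor C D F"
        "nat_trans C SetCat M (fcomp N F) \<eta>"
      then interpret coherent_model_morphism C M D N F \<eta>
        using assms by unfold_locales
      show "dlat_cocone (L_shape C M) (L_diagram C) (LM D N) (L_map_cocone C D N F \<eta>) \<and>
            (\<exists>!h. mediating (L_shape C M) (L_diagram C) (LM C M) (L_in C M)
                    (LM D N) (L_map_cocone C D N F \<eta>) h) \<and>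
            mediating (L_shape C M) (L_diagram C) (LM C M) (L_in C M)
              (LM D N) (L_map_cocone C D N F \<eta>) (L_map C M D N F \<eta>) \<and>
            (\<forall>x\<in>Ob C. \<forall>a\<in>fo M x. \<forall>U\<in>carrier (Sub C x).
               L_map C M D N F \<eta> (L_class C M x a U) =
               L_class D N (fo F x) (app (\<eta> x) a) (sub_image D F U))"
        using L_map_cocone LM_universal[OF L_map_cocone] L_map_mediating L_map_L_class by blast
    qed
  qed
qed

end
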